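(* Let $\mathcal{A}$ be a $C^*$-algebra and let $T \in \Pi_1(\mathcal{A}, \ell_2)$ be an absolutely ($1$-)summing operator. Then for every $\varepsilon > 0$ there exist a Hilbert space $H$ and bounded linear operators $J : \mathcal{A} \to H$ and $K : H \to \ell_2$ such that: (1) $T = K \circ J$; (2) $\|J\| \leq 1$; (3) $K \in S_4(H, \ell_2)$ with $\sigma_4(K) \leq 2(1+\varepsilon)\,\pi_1(T)$.
   Context: "Operator" means bounded linear operator. For Banach spaces $E,F$, an operator $T:E\to F$ is absolutely summing ($1$-summing) if there is a constant $C$ such that for every finite sequence $(e_1,\dots,e_n)$ in $E$, $\sum_{i=1}^n \|Te_i\| \le C \sup\{\sum_{i=1}^n |\langle e_i,e^*\rangle| : e^*\in E^*, \|e^*\|\le 1\}$. The least such $C$ is denoted $\pi_1(T)$, and $\Pi_1(E,F)$ is the space of all such operators. For $1\le p<\infty$ and Hilbert spaces $H_1,H_2$, the $p$-th Schatten-von Neumann class $S_p(H_1,H_2)$ consists of all compact operators $U:H_1\to H_2$ having a representation $U=\sum_n \alpha_n(\cdot,e_n)f_n$ with $(e_n)$ a (finite or infinite) orthonormal sequence in $H_1$, $(f_n)$ an orthonormal sequence in $H_2$, and $(\alpha_n)\in \ell_p$; its norm is $\sigma_p(U)=(\sum_n|\alpha_n|^p)^{1/p}$. *)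

theory Defs
  imports "HOL-Analysis.Analysis"
begin

section \<open>Complex Banach spaces, Hilbert spaces and C*-algebras as type classes\<close>

class scaleC =
  fixes scaleC :: "complex \<Rightarrow> 'a \<Rightarrow> 'a"  (infixr "*\<^sub>C" 75)

class cbanach = banach + scaleC +
  assumes scaleC_add_right: "c *\<^sub>C (x + y) = c *\<^sub>C x + c *\<^sub>C y"
    and scaleC_add_left: "(c + d) *\<^sub>C x = c *\<^sub>C x + d *\<^sub>C x"
    and scaleC_scaleC: "c *\<^sub>C (d *\<^sub>C x) = (c * d) *\<^sub>C x"
    and scaleC_of_real: "complex_of_real r *\<^sub>C x = r *\<^sub>R x"
    and norm_scaleC: "norm (c *\<^sub>C x) = cmod c * norm x"

text \<open>Inner products are linear in the first argument.\<close>

class chilbert_space = cbanach +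
  fixes cinner :: "'a \<Rightarrow> 'a \<Rightarrow> complex"
  assumes cinner_add_left: "cinner (x + y) z = cinner x z + cinner y z"
    and cinner_scaleC_left: "cinner (c *\<^sub>C x) y = c * cinner x y"
    and cinner_commute: "cinner y x = cnj (cinner x y)"
    and cinner_self: "cinner x x = complex_of_real ((norm x)\<^sup>2)"

text \<open>C*-algebras are not assumed to be unital.\<close>

class cstar_algebra = cbanach + real_normed_algebra +
  fixes star :: "'a \<Rightarrow> 'a"
  assumes scaleC_mult_left: "(c *\<^sub>C x) * y = c *\<^sub>C (x * y)"
    and scaleC_mult_right: "x * (c *\<^sub>C y) = c *\<^sub>C (x * y)"
    and star_add: "star (x + y) = star x + star y"
    and star_scaleC: "star (c *\<^sub>C x) = cnj c *\<^sub>C star x"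
    and star_mult: "star (x * y) = star y * star x"
    and star_star: "star (star x) = x"
    and norm_star_mult_self: "norm (star x * x) = (norm x)\<^sup>2"

instantiation complex :: chilbert_space
begin
definition scaleC_complex :: "complex \<Rightarrow> complex \<Rightarrow> complex"
  where "scaleC_complex c x = c * x"
definition cinner_complex :: "complex \<Rightarrow> complex \<Rightarrow> complex"
  where "cinner_complex x y = x * cnj y"
instance
  by standard
    (simp_all add: scaleC_complex_def cinner_complex_def algebra_simps norm_mult
      scaleR_conv_of_real complex_norm_square del: of_real_power)
end

instantiation complex :: cstar_algebra
begin
definition star_complex :: "complex \<Rightarrow> complex" where "star_complex = cnj"
instance
  by standard
    (simp_all add: scaleC_complex_def star_complex_def norm_mult power2_eq_square)
end


section \<open>The Hilbert space of square-summable complex sequences\<close>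

lemma square_summable_iff_L2_set:
  fixes x :: "nat \<Rightarrow> complex"
  shows "summable (\<lambda>n. (cmod (x n))\<^sup>2) \<longleftrightarrow> (\<exists>B. \<forall>N. L2_set (\<lambda>n. cmod (x n)) {..<N} \<le> B)"
proof
  assume s: "summable (\<lambda>n. (cmod (x n))\<^sup>2)"
  have "L2_set (\<lambda>n. cmod (x n)) {..<N} \<le> sqrt (\<Sum>n. (cmod (x n))\<^sup>2)" for N
    unfolding L2_set_def using sum_le_suminf[OF s, of "{..<N}"] by simp
  then show "\<exists>B. \<forall>N. L2_set (\<lambda>n. cmod (x n)) {..<N} \<le> B" by blast
next
  assume "\<exists>B. \<forall>N. L2_set (\<lambda>n. cmod (x n)) {..<N} \<le> B"
  then obtain B where B: "\<And>N. L2_set (\<lambda>n. cmod (x n)) {..<N} \<le> B" by blast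
  have "(\<Sum>n<N. (cmod (x n))\<^sup>2) \<le> B\<^sup>2" for N
  proof -
    have "(L2_set (\<lambda>n. cmod (x n)) {..<N})\<^sup>2 \<le> B\<^sup>2"
      by (intro power_mono B L2_set_nonneg)
    then show ?thesis by (simp add: L2_set_def sum_nonneg)
  qed
  then show "summable (\<lambda>n. (cmod (x n))\<^sup>2)"
    by (intro summableI_nonneg_bounded) auto
qed

lemma L2_set_norm_triangle:
  fixes x y :: "nat \<Rightarrow> complex"
  shows "L2_set (\<lambda>n. cmod (x n + y n)) A \<le> L2_set (\<lambda>n. cmod (x n)) A + L2_set (\<lambda>n. cmod (y n)) A"
  by (rule order_trans[OF L2_set_mono L2_set_triangle_ineq]) (auto simp: norm_triangle_ineq)

lemma square_summable_add:
  fixes x y :: "nat \<Rightarrow> complex"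
  assumes "summable (\<lambda>n. (cmod (x n))\<^sup>2)" "summable (\<lambda>n. (cmod (y n))\<^sup>2)"
  shows "summable (\<lambda>n. (cmod (x n + y n))\<^sup>2)"
proof -
  obtain B C where "\<And>N. L2_set (\<lambda>n. cmod (x n)) {..<N} \<le> B"
    "\<And>N. L2_set (\<lambda>n. cmod (y n)) {..<N} \<le> C"
    using assms unfolding square_summable_iff_L2_set by blast
  then have "L2_set (\<lambda>n. cmod (x n + y n)) {..<N} \<le> B + C" for N
    by (rule order_trans[OF L2_set_norm_triangle add_mono])
  then show ?thesis unfolding square_summable_iff_L2_set by blast
qed

lemma square_summable_mult:
  fixes x :: "nat \<Rightarrow> complex"
  assumes "summable (\<lambda>n. (cmod (x n))\<^sup>2)"
  shows "summable (\<lambda>n. (cmod (c * x n))\<^sup>2)"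
  using summable_mult[OF assms, of "(cmod c)\<^sup>2"] by (simp add: norm_mult power_mult_distrib)

typedef ell2 = "{x :: nat \<Rightarrow> complex. summable (\<lambda>n. (cmod (x n))\<^sup>2)}"
  morphisms ell2_nth Abs_ell2
  by (rule exI[of _ "\<lambda>_. 0"]) simp

setup_lifting type_definition_ell2

lemma ell2_summable: "summable (\<lambda>n. (cmod (ell2_nth x n))\<^sup>2)"
  using ell2_nth[of x] by simp

lemma ell2_eqI: "(\<And>n. ell2_nth x n = ell2_nth y n) \<Longrightarrow> x = y"
  by (metis ell2_nth_inject ext)

instantiation ell2 :: "{real_normed_vector, scaleC}"
begin

lift_definition zero_ell2 :: ell2 is "\<lambda>_. 0" by simp
lift_definition plus_ell2 :: "ell2 \<Rightarrow> ell2 \<Rightarrow> ell2" is "\<lambda>x y n. x n + y n"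
  by (rule square_summable_add)
lift_definition uminus_ell2 :: "ell2 \<Rightarrow> ell2" is "\<lambda>x n. - x n" by simp
lift_definition minus_ell2 :: "ell2 \<Rightarrow> ell2 \<Rightarrow> ell2" is "\<lambda>x y n. x n - y n"
  using square_summable_add[of _ "\<lambda>n. - _ n"] by simp
lift_definition scaleC_ell2 :: "complex \<Rightarrow> ell2 \<Rightarrow> ell2" is "\<lambda>c x n. c * x n"
  by (rule square_summable_mult)
definition scaleR_ell2 :: "real \<Rightarrow> ell2 \<Rightarrow> ell2" where
  "scaleR_ell2 r x = complex_of_real r *\<^sub>C x"
definition norm_ell2 :: "ell2 \<Rightarrow> real" where
  "norm_ell2 x = sqrt (\<Sum>n. (cmod (ell2_nth x n))\<^sup>2)"
definition dist_ell2 :: "ell2 \<Rightarrow> ell2 \<Rightarrow> real" where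
  "dist_ell2 x y = norm (x - y)"
definition sgn_ell2 :: "ell2 \<Rightarrow> ell2" where
  "sgn_ell2 x = inverse (norm x) *\<^sub>R x"
definition uniformity_ell2 :: "(ell2 \<times> ell2) filter" where
  "uniformity_ell2 = (INF e\<in>{0 <..}. principal {(x, y). dist x y < e})"
definition open_ell2 :: "ell2 set \<Rightarrow> bool" where
  "open_ell2 U = (\<forall>x\<in>U. \<forall>\<^sub>F (x', y) in uniformity. x' = x \<longrightarrow> y \<in> U)"

lemma ell2_norm_lim: "(\<lambda>N. L2_set (\<lambda>n. cmod (ell2_nth x n)) {..<N}) \<longlonglongrightarrow> norm x"
  unfolding norm_ell2_def L2_set_def
  by (intro tendsto_intros summable_LIMSEQ ell2_summable)

lemma ell2_norm_le: "(\<And>N. L2_set (\<lambda>n. cmod (ell2_nth x n)) {..<N} \<le> B) \<Longrightarrow> norm x \<le> B"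
  by (rule LIMSEQ_le_const2[OF ell2_norm_lim]) blast

lemma L2_set_le_ell2_norm: "L2_set (\<lambda>n. cmod (ell2_nth x n)) {..<N} \<le> norm x"
  unfolding norm_ell2_def L2_set_def
  by (simp add: sum_le_suminf ell2_summable)

lemma ell2_nth_le_norm: "cmod (ell2_nth x n) \<le> norm x"
  using member_le_L2_set[of "{..<Suc n}" n "\<lambda>n. cmod (ell2_nth x n)"]
    L2_set_le_ell2_norm[of x "Suc n"] by simp

lemma ell2_norm_scaleC: "norm (c *\<^sub>C (x::ell2)) = cmod c * norm x"
proof -
  have "(\<Sum>n. (cmod (ell2_nth (c *\<^sub>C x) n))\<^sup>2) = (cmod c)\<^sup>2 * (\<Sum>n. (cmod (ell2_nth x n))\<^sup>2)"
    by (simp add: scaleC_ell2.rep_eq norm_mult power_mult_distrib suminf_mult ell2_summable)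
  then show ?thesis
    by (simp add: norm_ell2_def real_sqrt_mult)
qed

instance
proof
  fix x y z :: ell2 and a b :: real
  show "x + y + z = x + (y + z)" "x + y = y + x" "0 + x = x" "- x + x = 0" "x - y = x + - y"
    by (rule ell2_eqI; simp add: plus_ell2.rep_eq zero_ell2.rep_eq uminus_ell2.rep_eq
        minus_ell2.rep_eq algebra_simps)+
  show "a *\<^sub>R (x + y) = a *\<^sub>R x + a *\<^sub>R y" "(a + b) *\<^sub>R x = a *\<^sub>R x + b *\<^sub>R x"
    "a *\<^sub>R b *\<^sub>R x = (a * b) *\<^sub>R x" "1 *\<^sub>R x = x"
    by (rule ell2_eqI; simp add: plus_ell2.rep_eq scaleR_ell2_def scaleC_ell2.rep_eq algebra_simps)+
  show "dist x y = norm (x - y)" by (rule dist_ell2_def)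
  show "sgn x = inverse (norm x) *\<^sub>R x" by (rule sgn_ell2_def)
  show "uniformity = (INF e\<in>{0 <..}. principal {(x, y::ell2). dist x y < e})"
    by (rule uniformity_ell2_def)
  show "open U = (\<forall>x\<in>U. \<forall>\<^sub>F (x', y) in uniformity. x' = x \<longrightarrow> y \<in> U)" for U :: "ell2 set"
    by (rule open_ell2_def)
  show "norm x = 0 \<longleftrightarrow> x = 0"
  proof
    assume "norm x = 0"
    then show "x = 0"
      using ell2_nth_le_norm[of x] by (intro ell2_eqI) (simp add: zero_ell2.rep_eq)
  qed (simp add: norm_ell2_def zero_ell2.rep_eq)
  show "norm (x + y) \<le> norm x + norm y"
  proof (rule ell2_norm_le)
    fix N
    show "L2_set (\<lambda>n. cmod (ell2_nth (x + y) n)) {..<N} \<le> norm x + norm y"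
      unfolding plus_ell2.rep_eq
      by (rule order_trans[OF L2_set_norm_triangle]) (intro add_mono L2_set_le_ell2_norm)
  qed
  show "norm (a *\<^sub>R x) = \<bar>a\<bar> * norm x" by (simp add: scaleR_ell2_def ell2_norm_scaleC)
qed

end

lemma ell2_Cauchy_convergent:
  fixes X :: "nat \<Rightarrow> ell2"
  assumes X: "\<And>e. e > 0 \<Longrightarrow> \<exists>M. \<forall>m\<ge>M. \<forall>n\<ge>M. norm (X m - X n) < e"
  shows "\<exists>L. \<forall>e>0. \<exists>M. \<forall>n\<ge>M. norm (X n - L) \<le> e"
proof -
  have "Cauchy (\<lambda>m. ell2_nth (X m) k)" for k
  proof (rule metric_CauchyI)
    fix e :: real assume "e > 0"
    from X[OF this] obtain M where M: "\<And>m n. m \<ge> M \<Longrightarrow> n \<ge> M \<Longrightarrow> norm (X m - X n) < e" by blast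
    have "dist (ell2_nth (X m) k) (ell2_nth (X n) k) < e" if "m \<ge> M" "n \<ge> M" for m n
      using M[OF that] ell2_nth_le_norm[of "X m - X n" k]
      by (simp add: dist_norm minus_ell2.rep_eq)
    then show "\<exists>M. \<forall>m\<ge>M. \<forall>n\<ge>M. dist (ell2_nth (X m) k) (ell2_nth (X n) k) < e" by blast
  qed
  then obtain y where y: "\<And>k. (\<lambda>m. ell2_nth (X m) k) \<longlonglongrightarrow> y k"
    unfolding Cauchy_convergent_iff convergent_def by metis
  have tail: "L2_set (\<lambda>k. cmod (ell2_nth (X m) k - y k)) {..<N} \<le> e"
    if M: "\<forall>m\<ge>M. \<forall>n\<ge>M. norm (X m - X n) < e" and m: "m \<ge> M" for e M m N
  proof (rule LIMSEQ_le_const2)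
    show "(\<lambda>n. L2_set (\<lambda>k. cmod (ell2_nth (X m) k - ell2_nth (X n) k)) {..<N})
        \<longlonglongrightarrow> L2_set (\<lambda>k. cmod (ell2_nth (X m) k - y k)) {..<N}"
      unfolding L2_set_def by (intro tendsto_intros y)
    have "L2_set (\<lambda>k. cmod (ell2_nth (X m) k - ell2_nth (X n) k)) {..<N} \<le> e" if "n \<ge> M" for n
    proof -
      have "norm (X m - X n) < e" using M m that by blast
      with L2_set_le_ell2_norm[of "X m - X n" N] show ?thesis
        unfolding minus_ell2.rep_eq by linarith
    qed
    then show "\<exists>K. \<forall>n\<ge>K. L2_set (\<lambda>k. cmod (ell2_nth (X m) k - ell2_nth (X n) k)) {..<N} \<le> e"
      by blast
  qed
  obtain M1 where M1: "\<forall>m\<ge>M1. \<forall>n\<ge>M1. norm (X m - X n) < 1" using X[of 1] by auto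
  have "summable (\<lambda>k. (cmod (ell2_nth (X M1) k - y k))\<^sup>2)"
    unfolding square_summable_iff_L2_set using tail[OF M1 order_refl] by blast
  from square_summable_add[OF ell2_summable[of "X M1"], of "\<lambda>k. - (ell2_nth (X M1) k - y k)"] this
  have ysum: "summable (\<lambda>k. (cmod (y k))\<^sup>2)" by (simp add: norm_minus_commute)
  define L where "L = Abs_ell2 y"
  have L: "ell2_nth L = y" unfolding L_def using ysum by (simp add: Abs_ell2_inverse)
  have "\<exists>M. \<forall>n\<ge>M. norm (X n - L) \<le> e" if "e > 0" for e
  proof -
    obtain M where M: "\<forall>m\<ge>M. \<forall>n\<ge>M. norm (X m - X n) < e" using X[OF \<open>e > 0\<close>] by blast
    have "norm (X n - L) \<le> e" if "n \<ge> M" for n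
      by (rule ell2_norm_le) (use tail[OF M that] in \<open>simp add: minus_ell2.rep_eq L\<close>)
    then show ?thesis by blast
  qed
  then show ?thesis by blast
qed

instance ell2 :: cbanach
proof
  fix x y :: ell2 and r :: real and c d :: complex
  show "c *\<^sub>C (x + y) = c *\<^sub>C x + c *\<^sub>C y" "(c + d) *\<^sub>C x = c *\<^sub>C x + d *\<^sub>C x"
    "c *\<^sub>C d *\<^sub>C x = (c * d) *\<^sub>C x"
    by (rule ell2_eqI; simp add: plus_ell2.rep_eq scaleR_ell2_def scaleC_ell2.rep_eq algebra_simps)+
  show "complex_of_real r *\<^sub>C x = r *\<^sub>R x" by (simp add: scaleR_ell2_def)
  show "norm (c *\<^sub>C x) = cmod c * norm x" by (rule ell2_norm_scaleC)
next
  fix X :: "nat \<Rightarrow> ell2"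
  assume "Cauchy X"
  then have "\<exists>M. \<forall>m\<ge>M. \<forall>n\<ge>M. norm (X m - X n) < e" if "e > 0" for e
    using metric_CauchyD[of X e] that unfolding dist_ell2_def by blast
  then obtain L where L: "\<And>e. e > 0 \<Longrightarrow> \<exists>M. \<forall>n\<ge>M. norm (X n - L) \<le> e"
    using ell2_Cauchy_convergent[of X] by blast
  have "\<exists>M. \<forall>n\<ge>M. dist (X n) L < e" if "e > 0" for e
  proof -
    obtain M where M: "\<forall>n\<ge>M. norm (X n - L) \<le> e / 2" using L[of "e / 2"] \<open>e > 0\<close> by auto
    have "dist (X n) L < e" if "n \<ge> M" for n
    proof -
      have "norm (X n - L) \<le> e / 2" using M that by blast
      with \<open>e > 0\<close> show ?thesis unfolding dist_ell2_def by linarith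
    qed
    then show ?thesis by blast
  qed
  then show "convergent X"
    unfolding convergent_def lim_sequentially by blast
qed

instantiation ell2 :: chilbert_space
begin

definition cinner_ell2 :: "ell2 \<Rightarrow> ell2 \<Rightarrow> complex" where
  "cinner_ell2 x y = (\<Sum>n. ell2_nth x n * cnj (ell2_nth y n))"

lemma ell2_cinner_summable: "summable (\<lambda>n. ell2_nth x n * cnj (ell2_nth y n))"
proof (rule summable_comparison_test')
  show "summable (\<lambda>n. (cmod (ell2_nth x n))\<^sup>2 + (cmod (ell2_nth y n))\<^sup>2)"
    by (intro summable_add ell2_summable)
  fix n
  have "2 * (cmod (ell2_nth x n) * cmod (ell2_nth y n))
      \<le> (cmod (ell2_nth x n))\<^sup>2 + (cmod (ell2_nth y n))\<^sup>2"
    using sum_squares_bound[of "cmod (ell2_nth x n)" "cmod (ell2_nth y n)"] by (simp add: mult.assoc)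
  moreover have "0 \<le> cmod (ell2_nth x n) * cmod (ell2_nth y n)" by simp
  ultimately show "norm (ell2_nth x n * cnj (ell2_nth y n))
      \<le> (cmod (ell2_nth x n))\<^sup>2 + (cmod (ell2_nth y n))\<^sup>2"
    unfolding norm_mult complex_mod_cnj by linarith
qed

instance
proof
  fix x y z :: ell2 and c :: complex
  show "cinner (x + y) z = cinner x z + cinner y z"
    by (simp add: cinner_ell2_def plus_ell2.rep_eq distrib_right suminf_add ell2_cinner_summable)
  show "cinner (c *\<^sub>C x) y = c * cinner x y"
    by (simp add: cinner_ell2_def scaleC_ell2.rep_eq mult.assoc suminf_mult ell2_cinner_summable)
  have "(\<lambda>n. cnj (ell2_nth x n * cnj (ell2_nth y n))) sums cnj (cinner x y)"
    unfolding cinner_ell2_def sums_cnj by (rule summable_sums[OF ell2_cinner_summable])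
  then show "cinner y x = cnj (cinner x y)"
    unfolding cinner_ell2_def by (simp add: mult.commute sums_iff)
  have "(\<lambda>n. complex_of_real ((cmod (ell2_nth x n))\<^sup>2)) sums
      complex_of_real (\<Sum>n. (cmod (ell2_nth x n))\<^sup>2)"
    unfolding sums_of_real_iff by (rule summable_sums[OF ell2_summable])
  then show "cinner x x = complex_of_real ((norm x)\<^sup>2)"
    unfolding cinner_ell2_def norm_ell2_def
    by (simp add: sums_iff complex_norm_square suminf_nonneg ell2_summable del: of_real_power)
qed

end


section \<open>Absolutely summing operators\<close>

definition bounded_clinear :: "('a::cbanach \<Rightarrow> 'b::cbanach) \<Rightarrow> bool" where
  "bounded_clinear T \<longleftrightarrow> bounded_linear T \<and> (\<forall>c x. T (c *\<^sub>C x) = c *\<^sub>C T x)"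

definition weak_l1_norm :: "nat \<Rightarrow> (nat \<Rightarrow> 'a::cbanach) \<Rightarrow> real" where
  "weak_l1_norm n e =
    Sup {\<Sum>i<n. cmod (\<phi> (e i)) | \<phi> :: 'a \<Rightarrow> complex. bounded_clinear \<phi> \<and> onorm \<phi> \<le> 1}"

definition summing_bounds :: "('a::cbanach \<Rightarrow> 'b::cbanach) \<Rightarrow> real set" where
  "summing_bounds T =
    {C. 0 \<le> C \<and> (\<forall>n e. (\<Sum>i<n. norm (T (e i))) \<le> C * weak_l1_norm n e)}"

definition absolutely_summing :: "('a::cbanach \<Rightarrow> 'b::cbanach) \<Rightarrow> bool" where
  "absolutely_summing T \<longleftrightarrow> bounded_clinear T \<and> summing_bounds T \<noteq> {}"

definition pi1_norm :: "('a::cbanach \<Rightarrow> 'b::cbanach) \<Rightarrow> real" where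
  "pi1_norm T = Inf (summing_bounds T)"

text \<open>The supremum is over a nonempty bounded set, and the infimum is attained.\<close>

lemma weak_l1_bdd_above:
  fixes e :: "nat \<Rightarrow> 'a::cbanach"
  shows "bdd_above {\<Sum>i<n. cmod (\<phi> (e i)) | \<phi> :: 'a \<Rightarrow> complex. bounded_clinear \<phi> \<and> onorm \<phi> \<le> 1}"
proof (rule bdd_aboveI[where M = "\<Sum>i<n. norm (e i)"], clarify)
  fix \<phi> :: "'a \<Rightarrow> complex"
  assume \<phi>: "bounded_clinear \<phi>" "onorm \<phi> \<le> 1"
  have "cmod (\<phi> x) \<le> norm x" for x
    using onorm[of \<phi> x] \<phi> mult_right_mono[of "onorm \<phi>" 1 "norm x"]
    by (simp add: bounded_clinear_def)
  then show "(\<Sum>i<n. cmod (\<phi> (e i))) \<le> (\<Sum>i<n. norm (e i))" by (simp add: sum_mono)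
qed

lemma bounded_clinear_zero: "bounded_clinear (\<lambda>_::'a::cbanach. 0::complex)"
  by (simp add: bounded_clinear_def scaleC_complex_def bounded_linear_zero)

lemma weak_l1_norm_nonneg: "0 \<le> weak_l1_norm n (e :: nat \<Rightarrow> 'a::cbanach)"
  unfolding weak_l1_norm_def
proof (rule cSup_upper[OF _ weak_l1_bdd_above])
  show "0 \<in> {\<Sum>i<n. cmod (\<phi> (e i)) | \<phi> :: 'a \<Rightarrow> complex. bounded_clinear \<phi> \<and> onorm \<phi> \<le> 1}"
    by (intro CollectI exI[of _ "\<lambda>_. 0"]) (simp add: bounded_clinear_zero onorm_zero)
qed

lemma pi1_norm_least:
  fixes T :: "'a::cbanach \<Rightarrow> 'b::cbanach"
  assumes "absolutely_summing T"
  shows "pi1_norm T \<in> summing_bounds T" and "C \<in> summing_bounds T \<Longrightarrow> pi1_norm T \<le> C"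
proof -
  have ne: "summing_bounds T \<noteq> {}" using assms by (simp add: absolutely_summing_def)
  have bdd: "bdd_below (summing_bounds T)"
    by (rule bdd_belowI[of _ 0]) (simp add: summing_bounds_def)
  show "C \<in> summing_bounds T \<Longrightarrow> pi1_norm T \<le> C"
    unfolding pi1_norm_def by (rule cInf_lower[OF _ bdd])
  have "closed (summing_bounds T)"
    unfolding summing_bounds_def Collect_conj_eq Collect_all_eq
    by (intro closed_Int closed_INT ballI closed_Collect_le continuous_intros)
  then show "pi1_norm T \<in> summing_bounds T"
    unfolding pi1_norm_def by (rule closed_contains_Inf[OF ne bdd])
qed


section \<open>Hilbert spaces with an explicit carrier\<close>

text \<open>
  Types cannot be quantified existentially, so a Hilbert space whose existence is claimed
  is a structure, with its own operations, on a subset of some fixed type. Every separable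
  Hilbert space has an isometric copy on a subset of \<open>nat \<Rightarrow> complex\<close>. For factorizations
  \<open>K \<circ> J\<close> with \<open>K\<close> compact this type loses no generality: \<open>K\<close> vanishes on the complement
  of a separable subspace, onto which \<open>J\<close> can be projected.
\<close>

record 'h hilbert =
  hcarrier :: "'h set"
  hzero :: 'h
  hadd :: "'h \<Rightarrow> 'h \<Rightarrow> 'h"
  hscale :: "complex \<Rightarrow> 'h \<Rightarrow> 'h"
  hinner :: "'h \<Rightarrow> 'h \<Rightarrow> complex"

definition hnorm :: "'h hilbert \<Rightarrow> 'h \<Rightarrow> real" where
  "hnorm H x = sqrt (Re (hinner H x x))"

definition hdist :: "'h hilbert \<Rightarrow> 'h \<Rightarrow> 'h \<Rightarrow> real" where
  "hdist H x y = hnorm H (hadd H x (hscale H (- 1) y))"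

locale hilbert_space =
  fixes H :: "'h hilbert"
  assumes zero_closed: "hzero H \<in> hcarrier H"
    and add_closed: "\<lbrakk>x \<in> hcarrier H; y \<in> hcarrier H\<rbrakk> \<Longrightarrow> hadd H x y \<in> hcarrier H"
    and scale_closed: "x \<in> hcarrier H \<Longrightarrow> hscale H c x \<in> hcarrier H"
    and add_assoc: "\<lbrakk>x \<in> hcarrier H; y \<in> hcarrier H; z \<in> hcarrier H\<rbrakk>
      \<Longrightarrow> hadd H (hadd H x y) z = hadd H x (hadd H y z)"
    and add_commute: "\<lbrakk>x \<in> hcarrier H; y \<in> hcarrier H\<rbrakk> \<Longrightarrow> hadd H x y = hadd H y x"
    and add_zero: "x \<in> hcarrier H \<Longrightarrow> hadd H x (hzero H) = x"
    and add_minus: "x \<in> hcarrier H \<Longrightarrow> hadd H x (hscale H (- 1) x) = hzero H"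
    and scale_add_right: "\<lbrakk>x \<in> hcarrier H; y \<in> hcarrier H\<rbrakk>
      \<Longrightarrow> hscale H c (hadd H x y) = hadd H (hscale H c x) (hscale H c y)"
    and scale_add_left: "x \<in> hcarrier H
      \<Longrightarrow> hscale H (c + d) x = hadd H (hscale H c x) (hscale H d x)"
    and scale_scale: "x \<in> hcarrier H \<Longrightarrow> hscale H c (hscale H d x) = hscale H (c * d) x"
    and scale_one: "x \<in> hcarrier H \<Longrightarrow> hscale H 1 x = x"
    and inner_add_left: "\<lbrakk>x \<in> hcarrier H; y \<in> hcarrier H; z \<in> hcarrier H\<rbrakk>
      \<Longrightarrow> hinner H (hadd H x y) z = hinner H x z + hinner H y z"
    and inner_scale_left: "\<lbrakk>x \<in> hcarrier H; y \<in> hcarrier H\<rbrakk>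
      \<Longrightarrow> hinner H (hscale H c x) y = c * hinner H x y"
    and inner_commute: "\<lbrakk>x \<in> hcarrier H; y \<in> hcarrier H\<rbrakk>
      \<Longrightarrow> hinner H y x = cnj (hinner H x y)"
    and inner_nonneg: "x \<in> hcarrier H \<Longrightarrow> 0 \<le> Re (hinner H x x)"
    and inner_definite: "\<lbrakk>x \<in> hcarrier H; hinner H x x = 0\<rbrakk> \<Longrightarrow> x = hzero H"
    and complete: "\<lbrakk>range X \<subseteq> hcarrier H; \<forall>e>0. \<exists>M. \<forall>m\<ge>M. \<forall>n\<ge>M. hdist H (X m) (X n) < e\<rbrakk>
      \<Longrightarrow> \<exists>L\<in>hcarrier H. (\<lambda>n. hdist H (X n) L) \<longlonglongrightarrow> 0"

definition bounded_clinear_into :: "'h hilbert \<Rightarrow> ('a::cbanach \<Rightarrow> 'h) \<Rightarrow> bool" where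
  "bounded_clinear_into H J \<longleftrightarrow>
    (\<forall>x. J x \<in> hcarrier H) \<and>
    (\<forall>x y. J (x + y) = hadd H (J x) (J y)) \<and>
    (\<forall>c x. J (c *\<^sub>C x) = hscale H c (J x)) \<and>
    (\<exists>B. \<forall>x. hnorm H (J x) \<le> B * norm x)"

definition onorm_into :: "'h hilbert \<Rightarrow> ('a::cbanach \<Rightarrow> 'h) \<Rightarrow> real" where
  "onorm_into H J = (SUP x. hnorm H (J x) / norm x)"

definition bounded_clinear_from :: "'h hilbert \<Rightarrow> ('h \<Rightarrow> 'b::cbanach) \<Rightarrow> bool" where
  "bounded_clinear_from H K \<longleftrightarrow>
    (\<forall>x\<in>hcarrier H. \<forall>y\<in>hcarrier H. K (hadd H x y) = K x + K y) \<and>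
    (\<forall>c. \<forall>x\<in>hcarrier H. K (hscale H c x) = c *\<^sub>C K x) \<and>
    (\<exists>B. \<forall>x\<in>hcarrier H. norm (K x) \<le> B * hnorm H x)"

definition compact_operator_from :: "'h hilbert \<Rightarrow> ('h \<Rightarrow> 'b::cbanach) \<Rightarrow> bool" where
  "compact_operator_from H K \<longleftrightarrow>
    bounded_clinear_from H K \<and> compact (closure (K ` {x \<in> hcarrier H. hnorm H x \<le> 1}))"


section \<open>Schatten classes\<close>

text \<open>
  The index set is an initial segment of the naturals or all of them, for finite and
  infinite sequences. Orthogonal series converge unconditionally, so \<open>has_sum\<close> agrees
  with convergence of the partial sums.
\<close>

definition schatten_rep ::
  "real \<Rightarrow> 'h hilbert \<Rightarrow> ('h \<Rightarrow> 'k::chilbert_space) \<Rightarrow> nat set \<Rightarrow> (nat \<Rightarrow> complex) \<Rightarrow>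
    (nat \<Rightarrow> 'h) \<Rightarrow> (nat \<Rightarrow> 'k) \<Rightarrow> bool" where
  "schatten_rep p H U N \<alpha> e f \<longleftrightarrow>
    (N = UNIV \<or> (\<exists>m. N = {..<m})) \<and>
    e ` N \<subseteq> hcarrier H \<and>
    (\<forall>m\<in>N. \<forall>n\<in>N. hinner H (e m) (e n) = (if m = n then 1 else 0)) \<and>
    (\<forall>m\<in>N. \<forall>n\<in>N. cinner (f m) (f n) = (if m = n then 1 else 0)) \<and>
    (\<lambda>n. cmod (\<alpha> n) powr p) summable_on N \<and>
    (\<forall>x\<in>hcarrier H. ((\<lambda>n. \<alpha> n *\<^sub>C hinner H x (e n) *\<^sub>C f n) has_sum U x) N)"

definition schatten_class :: "real \<Rightarrow> 'h hilbert \<Rightarrow> ('h \<Rightarrow> 'k::chilbert_space) \<Rightarrow> bool" where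
  "schatten_class p H U \<longleftrightarrow> compact_operator_from H U \<and> (\<exists>N \<alpha> e f. schatten_rep p H U N \<alpha> e f)"

definition schatten_norm :: "real \<Rightarrow> 'h hilbert \<Rightarrow> ('h \<Rightarrow> 'k::chilbert_space) \<Rightarrow> real" where
  "schatten_norm p H U =
    (THE s. \<exists>N \<alpha> e f. schatten_rep p H U N \<alpha> e f \<and> s = (\<Sum>\<^sub>\<infinity>n\<in>N. cmod (\<alpha> n) powr p) powr (1 / p))"

text \<open>
  The norm is well defined: the value does not depend on the chosen representation.
\<close>

lemma bounded_linear_cinner: "bounded_linear (cinner (y::'a::chilbert_space))"
proof (rule bounded_linear_intro[where K = "norm y"])
  fix x z :: 'a and r :: real
  show "cinner y (x + z) = cinner y x + cinner y z"
    by (metis cinner_add_left cinner_commute complex_cnj_add)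
  show "cinner y (r *\<^sub>R x) = r *\<^sub>R cinner y x"
    by (metis cinner_scaleC_left cinner_commute complex_cnj_mult complex_cnj_complex_of_real
        scaleC_of_real scaleR_conv_of_real)
  show "norm (cinner y x) \<le> norm x * norm y"
  proof (cases "x = 0")
    case True
    then show ?thesis
      using cinner_scaleC_left[of 0 0 y] cinner_commute[of y x] scaleC_of_real[of 0 "0::'a"]
      by simp
  next
    case False
    define c where "c = - cinner y x / complex_of_real ((norm x)\<^sup>2)"
    have n0: "complex_of_real ((norm x)\<^sup>2) \<noteq> 0" using False by simp
    have lin: "cinner (y + c *\<^sub>C x) z = cinner y z + c * cinner x z" for z
      by (simp add: cinner_add_left cinner_scaleC_left)
    have "cinner (y + c *\<^sub>C x) x = 0"
      unfolding lin unfolding cinner_self c_def using n0 by (simp del: of_real_power)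
    then have "cinner (y + c *\<^sub>C x) (y + c *\<^sub>C x) = cinner (y + c *\<^sub>C x) y"
      by (metis add_cancel_right_right cinner_add_left cinner_commute cinner_scaleC_left complex_cnj_zero
          complex_cnj_cnj mult_zero_right)
    also have "\<dots> = complex_of_real ((norm y)\<^sup>2) - complex_of_real ((cmod (cinner y x))\<^sup>2 / (norm x)\<^sup>2)"
      unfolding lin unfolding cinner_self c_def cinner_commute[of x y]
      by (simp add: complex_norm_square del: of_real_power)
    finally have "complex_of_real ((norm (y + c *\<^sub>C x))\<^sup>2)
        = complex_of_real ((norm y)\<^sup>2 - (cmod (cinner y x))\<^sup>2 / (norm x)\<^sup>2)"
      unfolding cinner_self by simp
    then have "(norm (y + c *\<^sub>C x))\<^sup>2 = (norm y)\<^sup>2 - (cmod (cinner y x))\<^sup>2 / (norm x)\<^sup>2"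
      unfolding of_real_eq_iff .
    then have "(cmod (cinner y x))\<^sup>2 / (norm x)\<^sup>2 \<le> (norm y)\<^sup>2"
      by (metis diff_ge_0_iff_ge zero_le_power2)
    then have "(cmod (cinner y x))\<^sup>2 \<le> (norm x * norm y)\<^sup>2"
      using False by (simp add: divide_le_eq power_mult_distrib mult.commute)
    then show ?thesis by (rule power2_le_imp_le) simp
  qed
qed

lemma cinner_scaleC_right: "cinner y (c *\<^sub>C x) = cnj c * cinner (y::'a::chilbert_space) x"
  by (metis cinner_scaleC_left cinner_commute complex_cnj_mult)

context hilbert_space
begin

lemma Bessel_inequality:
  assumes e: "e ` N \<subseteq> hcarrier H"
    and on: "\<And>m n. m \<in> N \<Longrightarrow> n \<in> N \<Longrightarrow> hinner H (e m) (e n) = (if m = n then 1 else 0)"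
    and g: "g \<in> hcarrier H" and F: "finite F" "F \<subseteq> N"
  shows "(\<Sum>n\<in>F. (cmod (hinner H g (e n)))\<^sup>2) \<le> Re (hinner H g g)"
proof -
  have "\<exists>v\<in>hcarrier H. Re (hinner H v v) = Re (hinner H g g) - (\<Sum>n\<in>F. (cmod (hinner H g (e n)))\<^sup>2)
    \<and> (\<forall>n\<in>N - F. hinner H v (e n) = hinner H g (e n))"
    using F
  proof (induction F rule: finite_induct)
    case empty
    then show ?case using g by auto
  next
    case (insert k F)
    then obtain v where v: "v \<in> hcarrier H"
      "Re (hinner H v v) = Re (hinner H g g) - (\<Sum>n\<in>F. (cmod (hinner H g (e n)))\<^sup>2)"
      "\<And>n. n \<in> N - F \<Longrightarrow> hinner H v (e n) = hinner H g (e n)" by auto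
    define c where "c = hinner H v (e k)"
    define w where "w = hadd H v (hscale H (- c) (e k))"
    have k: "k \<in> N" "e k \<in> hcarrier H" using insert.prems e by auto
    have w: "w \<in> hcarrier H" unfolding w_def using v k by (intro add_closed scale_closed)
    have lin: "hinner H w z = hinner H v z - c * hinner H (e k) z" if "z \<in> hcarrier H" for z
      unfolding w_def using v k that by (simp add: inner_add_left inner_scale_left scale_closed)
    have "hinner H w (e k) = 0" using lin[OF k(2)] on[OF k(1) k(1)] by (simp add: c_def)
    then have "hinner H (e k) w = 0" using inner_commute[OF w k(2)] by simp
    then have "hinner H w w = hinner H v w" using lin[OF w] by simp
    also have "\<dots> = cnj (hinner H w v)" by (rule inner_commute[OF w v(1)])
    also have "\<dots> = cnj (hinner H v v) - cnj c * c"
      using lin[OF v(1)] inner_commute[OF v(1) k(2)] by (simp add: c_def)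
    finally have "Re (hinner H w w) = Re (hinner H v v) - (cmod c)\<^sup>2"
      by (simp add: cmod_power2) (simp add: power2_eq_square)
    moreover have "c = hinner H g (e k)" unfolding c_def using v(3) k insert.hyps by auto
    moreover have "hinner H w (e n) = hinner H g (e n)" if "n \<in> N - insert k F" for n
      using lin[of "e n"] that e on[OF k(1), of n] v(3)[of n] by auto
    ultimately show ?case using w v(2) insert.hyps by (intro bexI[of _ w]) auto
  qed
  then obtain v where "v \<in> hcarrier H"
    "Re (hinner H v v) = Re (hinner H g g) - (\<Sum>n\<in>F. (cmod (hinner H g (e n)))\<^sup>2)" by blast
  with inner_nonneg[of v] show ?thesis by simp
qed

lemma schatten_rep_inner:
  fixes U :: "'h \<Rightarrow> 'k::chilbert_space"
  assumes "schatten_rep p H U N \<alpha> e f" and x: "x \<in> hcarrier H"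
  shows "((\<lambda>n. cnj (\<alpha> n * hinner H x (e n)) * cinner y (f n)) has_sum cinner y (U x)) N"
proof -
  have "((\<lambda>n. \<alpha> n *\<^sub>C hinner H x (e n) *\<^sub>C f n) has_sum U x) N"
    using assms by (simp add: schatten_rep_def)
  from has_sum_bounded_linear[OF bounded_linear_cinner[of y] this]
  show ?thesis by (simp add: cinner_scaleC_right mult.assoc)
qed

lemma schatten_rep_apply:
  fixes U :: "'h \<Rightarrow> 'k::chilbert_space"
  assumes rep: "schatten_rep p H U N \<alpha> e f" and n: "n \<in> N"
  shows "U (e n) = \<alpha> n *\<^sub>C f n"
proof -
  have z: "0 *\<^sub>C x = 0" for x :: 'k using scaleC_of_real[of 0 x] by simp
  have z2: "c *\<^sub>C 0 = (0::'k)" for c using norm_scaleC[of c "0::'k"] by simp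
  have o: "1 *\<^sub>C x = x" for x :: 'k using scaleC_of_real[of 1 x] by simp
  have on: "\<And>m. m \<in> N \<Longrightarrow> hinner H (e n) (e m) = (if n = m then 1 else 0)"
    and "((\<lambda>m. \<alpha> m *\<^sub>C hinner H (e n) (e m) *\<^sub>C f m) has_sum U (e n)) N"
    using rep n by (auto simp: schatten_rep_def)
  moreover have "((\<lambda>m. \<alpha> m *\<^sub>C hinner H (e n) (e m) *\<^sub>C f m) has_sum \<alpha> n *\<^sub>C f n) {n}"
    by (rule has_sum_finiteI) (simp_all add: on n o)
  then have "((\<lambda>m. \<alpha> m *\<^sub>C hinner H (e n) (e m) *\<^sub>C f m) has_sum \<alpha> n *\<^sub>C f n) N"
    by (rule has_sum_cong_neutral[THEN iffD1, rotated -1]) (use n on z z2 in auto)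
  ultimately show ?thesis by (blast intro: has_sum_unique)
qed

lemma schatten_rep_unique_le:
  fixes U :: "'h \<Rightarrow> 'k::chilbert_space"
  assumes rep1: "schatten_rep p H U N \<alpha> e f" and rep2: "schatten_rep p H U M \<beta> g k"
  shows "(\<Sum>\<^sub>\<infinity>n\<in>N. cmod (\<alpha> n) powr p) \<le> (\<Sum>\<^sub>\<infinity>m\<in>M. cmod (\<beta> m) powr p)"
proof -
  note r1 = rep1[unfolded schatten_rep_def] and r2 = rep2[unfolded schatten_rep_def]
  have e: "e n \<in> hcarrier H" if "n \<in> N" for n using r1 that by auto
  have g: "g m \<in> hcarrier H" if "m \<in> M" for m using r2 that by auto
  define q where "q n m = hinner H (e n) (g m)" for n m
  have zero: "((\<lambda>j. h j :: complex) has_sum h n) N" if "n \<in> N" "\<And>j. j \<in> N \<Longrightarrow> j \<noteq> n \<Longrightarrow> h j = 0" for h n N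
  proof -
    have "(h has_sum h n) {n}" by (rule has_sum_finiteI) simp_all
    then show ?thesis by (rule has_sum_cong_neutral[THEN iffD1, rotated -1]) (use that in auto)
  qed
  have eq: "(cmod (\<alpha> n))\<^sup>2 * q n m = (cmod (\<beta> m))\<^sup>2 * q n m" if n: "n \<in> N" and m: "m \<in> M" for n m
  proof -
    have 1: "cinner (U (e n)) (U (g m)) = cnj (\<alpha> n * hinner H (g m) (e n)) * cinner (U (e n)) (f n)"
    proof (rule has_sum_unique[OF schatten_rep_inner[OF rep1 g[OF m]] zero[OF n]])
      fix j assume "j \<in> N" "j \<noteq> n"
      then show "cnj (\<alpha> j * hinner H (g m) (e j)) * cinner (U (e n)) (f j) = 0"
        using r1 n unfolding schatten_rep_apply[OF rep1 n] by (simp add: cinner_scaleC_left)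
    qed
    have "cinner (U (e n)) (f n) = \<alpha> n"
      using r1 n unfolding schatten_rep_apply[OF rep1 n] by (simp add: cinner_scaleC_left)
    with 1 have A: "cinner (U (e n)) (U (g m)) = (cmod (\<alpha> n))\<^sup>2 * q n m"
      unfolding q_def using inner_commute[OF g[OF m] e[OF n]]
      by (simp add: complex_norm_square mult_ac del: of_real_power)
    have 2: "cinner (U (g m)) (U (e n)) = cnj (\<beta> m * q n m) * cinner (U (g m)) (k m)"
      unfolding q_def
    proof (rule has_sum_unique[OF schatten_rep_inner[OF rep2 e[OF n]] zero[OF m]])
      fix j assume "j \<in> M" "j \<noteq> m"
      then show "cnj (\<beta> j * hinner H (e n) (g j)) * cinner (U (g m)) (k j) = 0"
        using r2 m unfolding schatten_rep_apply[OF rep2 m] by (simp add: cinner_scaleC_left)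
    qed
    have "cinner (U (g m)) (k m) = \<beta> m"
      using r2 m unfolding schatten_rep_apply[OF rep2 m] by (simp add: cinner_scaleC_left)
    with 2 have "cinner (U (g m)) (U (e n)) = cnj (\<beta> m * q n m) * \<beta> m" by simp
    then have "cinner (U (e n)) (U (g m)) = (cmod (\<beta> m))\<^sup>2 * q n m"
      unfolding cinner_commute[of "U (e n)" "U (g m)"]
      by (simp add: complex_norm_square mult_ac del: of_real_power)
    with A show ?thesis by metis
  qed
  have abs_eq: "cmod (\<alpha> n) = cmod (\<beta> m)" if "n \<in> N" "m \<in> M" "q n m \<noteq> 0" for n m
  proof -
    have "complex_of_real ((cmod (\<alpha> n))\<^sup>2) = complex_of_real ((cmod (\<beta> m))\<^sup>2)"
      using eq[OF that(1,2)] that(3) by simp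
    then have "(cmod (\<alpha> n))\<^sup>2 = (cmod (\<beta> m))\<^sup>2" unfolding of_real_eq_iff .
    then show ?thesis by (simp add: power2_eq_iff_nonneg)
  qed
  have parseval: "((\<lambda>m. (cmod (q n m))\<^sup>2) has_sum 1) M" if n: "n \<in> N" and a: "\<alpha> n \<noteq> 0" for n
  proof -
    have "((\<lambda>m. cnj (\<beta> m * q n m) * cinner (U (e n)) (k m)) has_sum cinner (U (e n)) (U (e n))) M"
      unfolding q_def by (rule schatten_rep_inner[OF rep2 e[OF n]])
    moreover have "cinner (U (e n)) (k m) = \<beta> m * q n m" if m: "m \<in> M" for m
    proof -
      have "cinner (k m) (U (e n)) = cnj (\<beta> m * hinner H (e n) (g m)) * cinner (k m) (k m)"
      proof (rule has_sum_unique[OF schatten_rep_inner[OF rep2 e[OF n]] zero[OF m]])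
        fix j assume "j \<in> M" "j \<noteq> m"
        then show "cnj (\<beta> j * hinner H (e n) (g j)) * cinner (k m) (k j) = 0" using r2 m by simp
      qed
      then show ?thesis using r2 m unfolding cinner_commute[of "U (e n)" "k m"] by (simp add: q_def)
    qed
    ultimately have "((\<lambda>m. cnj (\<beta> m * q n m) * (\<beta> m * q n m)) has_sum cinner (U (e n)) (U (e n))) M"
      by (simp cong: has_sum_cong)
    moreover have "cinner (U (e n)) (U (e n)) = complex_of_real ((cmod (\<alpha> n))\<^sup>2)"
      using r1 n unfolding schatten_rep_apply[OF rep1 n]
      by (simp add: cinner_scaleC_left cinner_scaleC_right complex_norm_square del: of_real_power)
    ultimately have "((\<lambda>m. cnj (\<beta> m * q n m) * (\<beta> m * q n m)) has_sum complex_of_real ((cmod (\<alpha> n))\<^sup>2)) M"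
      by simp
    moreover have "cnj (\<beta> m * q n m) * (\<beta> m * q n m) = complex_of_real ((cmod (\<alpha> n))\<^sup>2 * (cmod (q n m))\<^sup>2)"
      if "m \<in> M" for m
    proof -
      have "cnj (\<beta> m * q n m) * (\<beta> m * q n m) = complex_of_real ((cmod (\<beta> m * q n m))\<^sup>2)"
        by (simp add: complex_norm_square mult_ac del: of_real_power)
      also have "(cmod (\<beta> m * q n m))\<^sup>2 = (cmod (\<alpha> n))\<^sup>2 * (cmod (q n m))\<^sup>2"
        using abs_eq[OF n that] by (cases "q n m = 0") (auto simp: norm_mult power_mult_distrib)
      finally show ?thesis .
    qed
    ultimately have "((\<lambda>m. complex_of_real ((cmod (\<alpha> n))\<^sup>2 * (cmod (q n m))\<^sup>2)) has_sum
        complex_of_real ((cmod (\<alpha> n))\<^sup>2)) M"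
      by (simp cong: has_sum_cong del: of_real_power of_real_mult)
    then have "((\<lambda>m. (cmod (\<alpha> n))\<^sup>2 * (cmod (q n m))\<^sup>2) has_sum (cmod (\<alpha> n))\<^sup>2) M"
      unfolding has_sum_of_real_iff .
    from has_sum_cmult_right[OF this, of "inverse ((cmod (\<alpha> n))\<^sup>2)"] a
    show ?thesis by (simp add: mult.assoc[symmetric])
  qed
  have row: "((\<lambda>m. cmod (\<beta> m) powr p * (cmod (q n m))\<^sup>2) has_sum cmod (\<alpha> n) powr p) M" if n: "n \<in> N" for n
  proof (cases "\<alpha> n = 0")
    case True
    have "cmod (\<beta> m) powr p * (cmod (q n m))\<^sup>2 = 0" if "m \<in> M" for m
      using abs_eq[OF n that] True by (cases "q n m = 0") auto
    from has_sum_0[OF this] True show ?thesis by simp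
  next
    case False
    have "cmod (\<alpha> n) powr p * (cmod (q n m))\<^sup>2 = cmod (\<beta> m) powr p * (cmod (q n m))\<^sup>2" if "m \<in> M" for m
      using abs_eq[OF n that] by (cases "q n m = 0") auto
    moreover have "((\<lambda>m. cmod (\<alpha> n) powr p * (cmod (q n m))\<^sup>2) has_sum cmod (\<alpha> n) powr p) M"
      using has_sum_cmult_right[OF parseval[OF n False], of "cmod (\<alpha> n) powr p"] by simp
    ultimately show ?thesis by (rule has_sum_cong[THEN iffD1])
  qed
  have sN: "(\<lambda>n. cmod (\<alpha> n) powr p) summable_on N" and sM: "(\<lambda>m. cmod (\<beta> m) powr p) summable_on M"
    using r1 r2 by auto
  have "(\<Sum>n\<in>F. cmod (\<alpha> n) powr p) \<le> (\<Sum>\<^sub>\<infinity>m\<in>M. cmod (\<beta> m) powr p)" if F: "finite F" "F \<subseteq> N" for F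
  proof (rule has_sum_mono[OF _ has_sum_infsum[OF sM]])
    show "((\<lambda>m. \<Sum>n\<in>F. cmod (\<beta> m) powr p * (cmod (q n m))\<^sup>2) has_sum
        (\<Sum>n\<in>F. cmod (\<alpha> n) powr p)) M"
      using F by (induction F rule: finite_induct) (auto intro!: has_sum_add row has_sum_0)
    fix m assume m: "m \<in> M"
    have "cmod (hinner H (g m) (e n)) = cmod (q n m)" if "n \<in> N" for n
      using inner_commute[OF e[OF that] g[OF m]] by (simp add: q_def)
    then have "(\<Sum>n\<in>F. (cmod (q n m))\<^sup>2) = (\<Sum>n\<in>F. (cmod (hinner H (g m) (e n)))\<^sup>2)"
      using F by (intro sum.cong) auto
    also have "\<dots> \<le> Re (hinner H (g m) (g m))"
      using r1 F g[OF m] by (intro Bessel_inequality[of e N]) auto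
    also have "\<dots> = 1" using r2 m by auto
    finally have "cmod (\<beta> m) powr p * (\<Sum>n\<in>F. (cmod (q n m))\<^sup>2) \<le> cmod (\<beta> m) powr p * 1"
      by (intro mult_left_mono) auto
    then show "(\<Sum>n\<in>F. cmod (\<beta> m) powr p * (cmod (q n m))\<^sup>2) \<le> cmod (\<beta> m) powr p"
      by (simp add: sum_distrib_left)
  qed
  then show ?thesis by (intro infsum_le_finite_sums[OF sN]) auto
qed

lemma schatten_norm_eq:
  fixes U :: "'h \<Rightarrow> 'k::chilbert_space"
  assumes "schatten_rep p H U N \<alpha> e f"
  shows "schatten_norm p H U = (\<Sum>\<^sub>\<infinity>n\<in>N. cmod (\<alpha> n) powr p) powr (1 / p)"
  unfolding schatten_norm_def
proof (rule the_equality)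
  fix s
  assume "\<exists>N \<alpha> e f. schatten_rep p H U N \<alpha> e f \<and> s = (\<Sum>\<^sub>\<infinity>n\<in>N. cmod (\<alpha> n) powr p) powr (1 / p)"
  then show "s = (\<Sum>\<^sub>\<infinity>n\<in>N. cmod (\<alpha> n) powr p) powr (1 / p)"
    using schatten_rep_unique_le[OF assms] schatten_rep_unique_le[OF _ assms] by (metis order_antisym)
qed (use assms in blast)

end

end

theory Submission
  imports Defs "HOL-Library.Function_Algebras"
begin

text \<open>
  Write \<open>C = \<pi>\<^sub>1(T)\<close>. By Hahn-Banach there are a positive functional \<open>M\<close> of norm at most \<open>C\<close> on the
  bounded functions on the dual ball, with \<open>\<parallel>T x\<parallel> \<le> M \<bar>x\<bar>\<close> for the function \<open>\<phi> \<mapsto> \<bar>\<phi> x\<bar>\<close>, and a positive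
  functional \<open>f\<close> of norm at most \<open>2 C\<close> on the unitization of the algebra which dominates \<open>M\<close>,
  as \<open>M \<bar>z\<bar> \<le> f m\<close> whenever \<open>z\<close> is self-adjoint and \<open>m \<plusminus> z\<close> are positive. Through the form
  \<open>\<beta>(x, y) = f(y\<^sup>* x + x y\<^sup>*) / 2\<close> the operator \<open>T\<close> factors as \<open>K \<circ> J\<close>. As in Sakai's linear
  Radon-Nikodym theorem, \<open>K\<^sup>* h\<close> is a limit of images \<open>J v\<close> with \<open>\<parallel>v\<parallel> \<le> 2 \<parallel>h\<parallel>\<close>. If \<open>v\<^sub>i\<close> corresponds
  in this way to an orthonormal sequence \<open>h\<^sub>i\<close>, then
  \<open>\<Sum> c\<^sub>i \<parallel>K K\<^sup>* h\<^sub>i\<parallel> \<approx> \<Sum> c\<^sub>i \<parallel>T v\<^sub>i\<parallel> \<le> M (\<Sum> c\<^sub>i \<bar>v\<^sub>i\<bar>) \<lesssim> 2 C \<parallel>c\<parallel>\<^sub>2\<close>, so that the Hilbert-Schmidt norm of \<open>K K\<^sup>*\<close> is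
  at most \<open>2 C\<close>. Since \<open>\<parallel>J\<parallel>\<^sup>2 \<le> 2 C\<close>, rescaling gives \<open>\<sigma>\<^sub>4(K) \<le> 2 C\<close>.
\<close>

section \<open>Unital C*-algebras\<close>

text \<open>No spectral theory is developed. Positive means: a finite sum of squares of self-adjoint
  elements. Roots are binomial series, and the basic norm bounds come from identities a^2 + b^2 = P
  between commuting self-adjoint a and b. The order is measured against multiples of 1, hence the
  unitization. The 2 in the norm of f and the 2 in the bound on v have the same source: an element
  is split into a real and an imaginary part, each contributing 1. The completion of \<beta> comes
  with no separability, whereas the space to be produced consists of sequences. It is therefore
  never formed: vectors in it are replaced by approximants in the algebra, and all that is kept is
  the operator K composed with its adjoint, which acts on \<open>ell2\<close> as a limit of vectors
  T v. The factors are rebuilt from its eigenvectors. Dividing J by sqrt (2 C) multiplies that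
  operator by 2 C, so its Hilbert-Schmidt norm becomes at most (2 C)^2. This norm is the square of
  the fourth Schatten norm of the rescaled K, whence the bound 2 C.\<close>

lemma unimodular_phase:
  obtains c where "cmod c = 1" "c * z = complex_of_real (cmod z)"
proof
  define c where "c = (if z = 0 then 1 else cnj z / cmod z)"
  show "cmod c = 1" by (simp add: c_def norm_divide)
  show "c * z = complex_of_real (cmod z)"
    using complex_norm_square[of z] by (simp add: c_def power2_eq_square field_simps)
qed

lemma scaleC_one [simp]: "1 *\<^sub>C (x::'a::cbanach) = x"
  using scaleC_of_real[of 1 x] by simp

lemma scaleC_zero_left [simp]: "0 *\<^sub>C (x::'a::cbanach) = 0"
  using scaleC_of_real[of 0 x] by simp

lemma scaleC_zero_right [simp]: "c *\<^sub>C (0::'a::cbanach) = 0"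
  using norm_scaleC[of c "0::'a"] by simp

lemma scaleC_minus_left: "(- c) *\<^sub>C (x::'a::cbanach) = - (c *\<^sub>C x)"
  using scaleC_add_left[of c "- c" x] by (simp add: eq_neg_iff_add_eq_0 add.commute)

lemma scaleC_minus_right: "c *\<^sub>C (- x) = - (c *\<^sub>C (x::'a::cbanach))"
  using scaleC_add_right[of c x "- x"] by (simp add: eq_neg_iff_add_eq_0 add.commute)

lemma scaleC_diff_right: "c *\<^sub>C (x - y) = c *\<^sub>C x - c *\<^sub>C (y::'a::cbanach)"
  using scaleC_add_right[of c x "- y"] by (simp add: scaleC_minus_right)

lemma scaleC_scaleR: "c *\<^sub>C (r *\<^sub>R x) = r *\<^sub>R (c *\<^sub>C (x::'a::cbanach))"
  by (metis scaleC_of_real scaleC_scaleC mult.commute)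

lemma star_zero [simp]: "star (0::'a::cstar_algebra) = 0"
  using star_scaleC[of 0 "0::'a"] by simp

lemma star_minus: "star (- x) = - star (x::'a::cstar_algebra)"
  using star_add[of x "- x"] by (simp add: eq_neg_iff_add_eq_0 add.commute)

lemma star_diff: "star (x - y) = star x - star (y::'a::cstar_algebra)"
  using star_add[of x "- y"] by (simp add: star_minus)

lemma star_scaleR: "star (r *\<^sub>R x) = r *\<^sub>R star (x::'a::cstar_algebra)"
  using star_scaleC[of "complex_of_real r" x] by (simp add: scaleC_of_real)

lemma norm_star [simp]: "norm (star x) = norm (x::'a::cstar_algebra)"
proof -
  have le: "norm x \<le> norm (star x)" for x :: 'a
  proof (cases "x = 0")
    case False
    have "norm x * norm x \<le> norm (star x) * norm x"
      using norm_star_mult_self[of x] norm_mult_ineq[of "star x" x] by (simp add: power2_eq_square)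
    with False show ?thesis by simp
  qed simp
  from le[of x] le[of "star x"] show ?thesis by (simp add: star_star)
qed

lemma bounded_linear_star: "bounded_linear (star :: 'a::cstar_algebra \<Rightarrow> 'a)"
  by (rule bounded_linear_intro[where K = 1]) (auto simp: star_add star_scaleR)

lemma star_one [simp]: "star (1::'a::{cstar_algebra, real_normed_algebra_1}) = 1"
  using star_mult[of "star (1::'a)" 1] by (simp add: star_star)

lemma star_power: "star (x ^ n) = star (x::'a::{cstar_algebra, real_normed_algebra_1}) ^ n"
  by (induction n) (simp_all add: star_mult power_commutes)

lemma norm_square_self_adjoint:
  "star a = a \<Longrightarrow> norm (a * a) = (norm (a::'a::cstar_algebra))\<^sup>2"
  using norm_star_mult_self[of a] by simp

text \<open>The C*-identity for the normal element \<open>a + ib\<close>, of which \<open>a\<close> is the real part.\<close>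

lemma norm_square_le_sum_squares:
  fixes a b :: "'a::cstar_algebra"
  assumes "star a = a" "star b = b" "a * b = b * a"
  shows "(norm a)\<^sup>2 \<le> norm (a * a + b * b)"
proof -
  define z where "z = a + \<i> *\<^sub>C b"
  have sz: "star z = a - \<i> *\<^sub>C b"
    using assms by (simp add: z_def star_add star_scaleC scaleC_minus_left)
  have "star z * z = a * a + b * b"
    unfolding sz unfolding z_def using assms(3)
    by (simp add: distrib_left left_diff_distrib scaleC_mult_left scaleC_mult_right scaleC_scaleC
        scaleC_minus_left scaleC_diff_right)
  then have z: "(norm z)\<^sup>2 = norm (a * a + b * b)" using norm_star_mult_self[of z] by simp
  have "z + star z = 2 *\<^sub>R a" unfolding sz unfolding z_def by (simp add: scaleR_2)
  then have "2 * norm a = norm (z + star z)" by simp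
  also have "\<dots> \<le> 2 * norm z" using norm_triangle_ineq[of z "star z"] by simp
  finally have "(norm a)\<^sup>2 \<le> (norm z)\<^sup>2" by (intro power_mono) auto
  with z show ?thesis by simp
qed

section \<open>Fractional powers of \<open>1 - u\<close>\<close>

text \<open>Newton's series for the power (1 - u)^r; the alternating sign belongs to the minus in
  \<open>1 - u\<close>.\<close>

definition binomial_series :: "real \<Rightarrow> 'a \<Rightarrow> 'a::{banach, real_normed_algebra_1}" where
  "binomial_series r u = (\<Sum>k. ((r gchoose k) * (- 1) ^ k) *\<^sub>R u ^ k)"

context
  fixes u :: "'a::{banach, real_normed_algebra_1}"
  assumes u: "norm u < 1"
begin

lemma binomial_series_norm_summable: "summable (\<lambda>k. norm (((r gchoose k) * (- 1) ^ k) *\<^sub>R u ^ k))"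
proof (rule summable_comparison_test')
  have "ereal (norm (norm u)) < conv_radius (\<lambda>k. r gchoose k)"
    using u by (simp add: conv_radius_gchoose)
  from abs_summable_in_conv_radius[OF this]
  show "summable (\<lambda>k. norm ((r gchoose k) * norm u ^ k))" .
  fix k
  show "norm (norm (((r gchoose k) * (- 1) ^ k) *\<^sub>R u ^ k)) \<le> norm ((r gchoose k) * norm u ^ k)"
    by (simp add: abs_mult norm_power_ineq mult_left_mono power_abs)
qed

lemma binomial_series_sums:
  "(\<lambda>k. ((r gchoose k) * (- 1) ^ k) *\<^sub>R u ^ k) sums binomial_series r u"
  unfolding binomial_series_def
  by (rule summable_sums[OF summable_norm_cancel[OF binomial_series_norm_summable]])

text \<open>Law of exponents: the Cauchy product collects the coefficient of each power of
  \<open>u\<close> into a Vandermonde sum.\<close>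

lemma binomial_series_mult:
  "binomial_series r u * binomial_series s u = binomial_series (r + s) u"
proof -
  have "(\<lambda>k. \<Sum>i\<le>k. (((r gchoose i) * (- 1) ^ i) *\<^sub>R u ^ i) *
      (((s gchoose (k - i)) * (- 1) ^ (k - i)) *\<^sub>R u ^ (k - i)))
    sums (binomial_series r u * binomial_series s u)"
    unfolding binomial_series_def by (intro Cauchy_product_sums binomial_series_norm_summable)
  moreover have "(\<Sum>i\<le>k. (((r gchoose i) * (- 1) ^ i) *\<^sub>R u ^ i) *
      (((s gchoose (k - i)) * (- 1) ^ (k - i)) *\<^sub>R u ^ (k - i)))
    = (((r + s) gchoose k) * (- 1) ^ k) *\<^sub>R u ^ k" for k
  proof -
    have "(((r gchoose i) * (- 1) ^ i) *\<^sub>R u ^ i) *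
      (((s gchoose (k - i)) * (- 1) ^ (k - i)) *\<^sub>R u ^ (k - i))
      = ((r gchoose i) * (s gchoose (k - i)) * (- 1) ^ k) *\<^sub>R u ^ k" if "i \<le> k" for i
    proof -
      have "u ^ i * u ^ (k - i) = u ^ k" "(- 1) ^ i * (- 1) ^ (k - i) = ((- 1) ^ k :: real)"
        using that by (simp_all flip: power_add)
      then show ?thesis by (simp add: mult_ac)
    qed
    then have "(\<Sum>i\<le>k. (((r gchoose i) * (- 1) ^ i) *\<^sub>R u ^ i) *
      (((s gchoose (k - i)) * (- 1) ^ (k - i)) *\<^sub>R u ^ (k - i)))
      = (\<Sum>i\<le>k. ((r gchoose i) * (s gchoose (k - i)) * (- 1) ^ k) *\<^sub>R u ^ k)"
      by (intro sum.cong) auto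
    also have "\<dots> = (((r + s) gchoose k) * (- 1) ^ k) *\<^sub>R u ^ k"
      using gbinomial_Vandermonde[of r s k]
      by (simp add: atLeast0AtMost flip: scaleR_left.sum sum_distrib_right)
    finally show ?thesis .
  qed
  ultimately show ?thesis using binomial_series_sums[of "r + s"] by (simp add: sums_unique2)
qed

lemma binomial_series_1: "binomial_series 1 u = 1 - u"
proof -
  have "(\<lambda>k. ((1 gchoose k) * (- 1) ^ k) *\<^sub>R u ^ k) sums (\<Sum>k\<in>{0,1}. (((1::real) gchoose k) * (- 1) ^ k) *\<^sub>R u ^ k)"
  proof (rule sums_finite)
    fix k :: nat assume "k \<notin> {0, 1}"
    then have "k > 1" by auto
    then have "(1 gchoose k :: real) = 0"
      using binomial_gbinomial[of 1 k, where 'a = real] by (simp add: binomial_eq_0)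
    then show "((1 gchoose k) * (- 1 :: real) ^ k) *\<^sub>R u ^ k = 0" by simp
  qed simp
  then show ?thesis using binomial_series_sums[of 1] by (simp add: sums_unique2)
qed

lemma binomial_series_0: "binomial_series 0 u = 1"
proof -
  have "(\<lambda>k. ((0 gchoose k) * (- 1) ^ k) *\<^sub>R u ^ k) sums (\<Sum>k\<in>{0}. (((0::real) gchoose k) * (- 1) ^ k) *\<^sub>R u ^ k)"
  proof (rule sums_finite)
    fix k :: nat assume "k \<notin> {0}"
    then show "((0 gchoose k) * (- 1 :: real) ^ k) *\<^sub>R u ^ k = 0" by (cases k) auto
  qed simp
  then show ?thesis using binomial_series_sums[of 0] by (simp add: sums_unique2)
qed

lemma binomial_series_commute:
  assumes "c * u = u * c"
  shows "c * binomial_series r u = binomial_series r u * c"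
proof -
  have "c * u ^ k = u ^ k * c" for k
    using assms by (induction k) (simp_all add: mult.assoc, metis mult.assoc)
  then have "(\<lambda>k. c * (((r gchoose k) * (- 1) ^ k) *\<^sub>R u ^ k))
      = (\<lambda>k. (((r gchoose k) * (- 1) ^ k) *\<^sub>R u ^ k) * c)" by simp
  with sums_mult[OF binomial_series_sums[of r], of c] sums_mult2[OF binomial_series_sums[of r], of c]
  show ?thesis by (simp add: sums_unique2)
qed

end

lemma star_binomial_series:
  fixes u :: "'a::{cstar_algebra, real_normed_algebra_1}"
  assumes "norm u < 1" "star u = u"
  shows "star (binomial_series r u) = binomial_series r u"
  using bounded_linear.sums[OF bounded_linear_star binomial_series_sums[OF assms(1), of r]]
    binomial_series_sums[OF assms(1), of r] assms(2)
  by (simp add: star_scaleR star_power sums_unique2)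

text \<open>With d = c / sqrt R, the root \<open>s\<close> of 1 - d^2 commutes with \<open>d\<close>
  and s^2 + d^2 = 1, so \<open>s\<close> has norm at most 1. The strict bound on \<open>R\<close>
  puts d^2 where the series converges.\<close>

lemma norm_real_minus_square_le:
  fixes c :: "'a::{cstar_algebra, real_normed_algebra_1}"
  assumes c: "star c = c" and R: "(norm c)\<^sup>2 < R"
  shows "norm (R *\<^sub>R 1 - c * c) \<le> R"
proof -
  have R0: "R > 0" using R zero_le_power2[of "norm c"] by linarith
  define d where "d = (1 / sqrt R) *\<^sub>R c"
  have dd: "d * d = (1 / R) *\<^sub>R (c * c)" using R0 by (simp add: d_def)
  have sd: "star d = d" using c by (simp add: d_def star_scaleR)
  have u: "norm (d * d) < 1" using R R0 norm_square_self_adjoint[OF c] by (simp add: dd)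
  have su: "star (d * d) = d * d" by (simp add: star_mult sd)
  define s where "s = binomial_series (1 / 2) (d * d)"
  have ss: "s * s = 1 - d * d"
    using binomial_series_mult[OF u, of "1/2" "1/2"] binomial_series_1[OF u] by (simp add: s_def)
  have "star s = s" unfolding s_def by (rule star_binomial_series[OF u su])
  moreover have "s * d = d * s"
    unfolding s_def using binomial_series_commute[OF u, of d] by (simp add: mult.assoc)
  ultimately have "(norm s)\<^sup>2 \<le> norm (s * s + d * d)" by (intro norm_square_le_sum_squares sd)
  then have "norm (s * s) \<le> 1" using norm_mult_ineq[of s s] ss by (simp add: power2_eq_square)
  moreover have "R *\<^sub>R 1 - c * c = R *\<^sub>R (s * s)" using R0 by (simp add: ss dd algebra_simps)
  ultimately show ?thesis using R0 by simp
qed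

text \<open>Spectrally, the two bounds confine \<open>a\<close> to [-r, r]. In place of a spectrum:
  for t = r + e, the elements t + a and t - a are R (1 - u) and R (1 - v), and the product
  \<open>w\<close> of their roots satisfies a^2 + w^2 = t^2. The extra \<open>e\<close> makes
  \<open>u\<close> and \<open>v\<close> shorter than 1.\<close>

lemma norm_le_of_shifted_norms:
  fixes a :: "'a::{cstar_algebra, real_normed_algebra_1}"
  assumes a: "star a = a" and S: "0 \<le> S" and r: "0 \<le> r"
    and le: "norm (S *\<^sub>R 1 + a) \<le> S + r" "norm (S *\<^sub>R 1 - a) \<le> S + r"
  shows "norm a \<le> r"
proof (rule field_le_epsilon)
  fix e :: real assume e: "e > 0"
  define R where "R = S + r + e"
  have R: "R > 0" using S r e by (simp add: R_def)
  define u where "u = (1 / R) *\<^sub>R (S *\<^sub>R 1 - a)"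
  define v where "v = (1 / R) *\<^sub>R (S *\<^sub>R 1 + a)"
  have un: "norm u < 1" and vn: "norm v < 1"
    using le e R unfolding u_def v_def by (auto simp: R_def)
  have su: "star u = u" and sv: "star v = v"
    using a by (simp_all add: u_def v_def star_scaleR star_diff star_add)
  define g where "g = binomial_series (1 / 2) u"
  define k where "k = binomial_series (1 / 2) v"
  have gg: "g * g = 1 - u" and kk: "k * k = 1 - v"
    using binomial_series_mult[OF un, of "1/2" "1/2"] binomial_series_1[OF un]
      binomial_series_mult[OF vn, of "1/2" "1/2"] binomial_series_1[OF vn] by (simp_all add: g_def k_def)
  have uv: "v * u = u * v" by (simp add: u_def v_def algebra_simps)
  have gk: "k * g = g * k"
    unfolding g_def k_def
    by (rule binomial_series_commute[OF un, symmetric, THEN sym])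
      (rule binomial_series_commute[OF vn, symmetric], simp add: uv)
  have av: "a * v = v * a" "a * u = u * a" by (simp_all add: u_def v_def algebra_simps)
  have ag: "a * g = g * a" and ak: "a * k = k * a"
    unfolding g_def k_def using binomial_series_commute[OF un av(2)] binomial_series_commute[OF vn av(1)] by auto
  define w where "w = R *\<^sub>R (g * k)"
  have "star w = w"
    using star_binomial_series[OF un su] star_binomial_series[OF vn sv] gk
    by (simp add: w_def star_scaleR star_mult g_def k_def)
  moreover have "a * w = w * a" by (simp add: w_def) (metis ag ak mult.assoc)
  ultimately have "(norm a)\<^sup>2 \<le> norm (a * a + w * w)" by (intro norm_square_le_sum_squares a)
  also have "w * w = (R * R) *\<^sub>R ((g * g) * (k * k))"
    by (simp add: w_def) (metis gk mult.assoc)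
  also have "\<dots> = (R *\<^sub>R (1 - u)) * (R *\<^sub>R (1 - v))" by (simp add: gg kk)
  also have "\<dots> = ((r + e) *\<^sub>R 1 + a) * ((r + e) *\<^sub>R 1 - a)"
    using R by (simp add: u_def v_def scaleR_diff_right) (simp add: R_def algebra_simps)
  also have "a * a + (c *\<^sub>R 1 + a) * (c *\<^sub>R 1 - a) = (c * c) *\<^sub>R 1" for c
    by (simp add: algebra_simps)
  finally have "(norm a)\<^sup>2 \<le> (r + e)\<^sup>2" using r e by (simp add: power2_eq_square)
  then show "norm a \<le> r + e" using r e by (simp add: abs_le_square_iff[symmetric])
qed

section \<open>The positive cone\<close>

text \<open>These play the part of the positive elements. Closure under addition is built in; the
  relation of this order to the norm is established in
  \<open>norm_le_of_sum_squares\<close>.\<close>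

inductive_set sum_squares :: "'a::cstar_algebra set" where
  zero: "0 \<in> sum_squares"
| add_square: "x \<in> sum_squares \<Longrightarrow> star b = b \<Longrightarrow> x + b * b \<in> sum_squares"

lemma square_in_sum_squares: "star b = b \<Longrightarrow> b * b \<in> sum_squares"
  using sum_squares.add_square[OF sum_squares.zero] by simp

lemma sum_squares_add:
  assumes "x \<in> sum_squares" "y \<in> sum_squares"
  shows "x + y \<in> sum_squares"
  using assms(2)
  by induction (auto simp: assms(1) add.assoc[symmetric] intro: sum_squares.add_square)

lemma sum_squares_scaleR:
  assumes "x \<in> sum_squares" "r \<ge> 0"
  shows "r *\<^sub>R x \<in> sum_squares"
  using assms(1)
proof induction
  case (add_square x b)
  have "r *\<^sub>R x + (sqrt r *\<^sub>R b) * (sqrt r *\<^sub>R b) \<in> sum_squares"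
    using add_square by (intro sum_squares.add_square) (simp_all add: star_scaleR)
  then show ?case using \<open>r \<ge> 0\<close> by (simp add: scaleR_add_right)
qed (simp add: sum_squares.zero)

lemma star_sum_squares: "x \<in> sum_squares \<Longrightarrow> star x = x"
  by (induction rule: sum_squares.induct) (simp_all add: star_add star_mult)

text \<open>Each square has such an \<open>R\<close> by \<open>norm_real_minus_square_le\<close>,
  where the 1 in \<open>Q\<close> provides strictness, and the constants add up along the
  sum.\<close>

lemma sum_squares_norm:
  fixes x :: "'a::{cstar_algebra, real_normed_algebra_1}"
  assumes "x \<in> sum_squares"
  obtains R where "R \<ge> 0" "norm (R *\<^sub>R 1 - x) \<le> R"
proof -
  have "\<exists>R\<ge>0. norm (R *\<^sub>R 1 - x) \<le> R" using assms
  proof induction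
    case zero
    show ?case by (intro exI[of _ 0]) simp
  next
    case (add_square x b)
    then obtain R where R: "R \<ge> 0" "norm (R *\<^sub>R 1 - x) \<le> R" by blast
    define Q where "Q = (norm b)\<^sup>2 + 1"
    have Q: "norm (Q *\<^sub>R 1 - b * b) \<le> Q"
      using add_square.hyps by (intro norm_real_minus_square_le) (auto simp: Q_def)
    have "norm ((R + Q) *\<^sub>R 1 - (x + b * b)) \<le> R + Q"
      using norm_triangle_mono[OF R(2) Q] by (simp add: algebra_simps)
    moreover have "R + Q \<ge> 0" using R(1) by (simp add: Q_def)
    ultimately show ?case by blast
  qed
  then show ?thesis using that by blast
qed

text \<open>With \<open>Q\<close> and \<open>R\<close> the constants of the two sums, S + a = (R -
  (P - a)) + (Q + P), and similarly for S - a; so both shifted norms are at most S + norm P. This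
  bounds the Hahn-Banach data in \<open>dominating_positive_functional\<close>.\<close>

lemma norm_le_of_sum_squares:
  fixes a P :: "'a::{cstar_algebra, real_normed_algebra_1}"
  assumes plus: "P + a \<in> sum_squares" and minus: "P - a \<in> sum_squares"
  shows "norm a \<le> norm P"
proof -
  obtain Q where Q: "Q \<ge> 0" "norm (Q *\<^sub>R 1 - (P + a)) \<le> Q" using sum_squares_norm[OF plus] .
  obtain R where R: "R \<ge> 0" "norm (R *\<^sub>R 1 - (P - a)) \<le> R" using sum_squares_norm[OF minus] .
  define S where "S = Q + R"
  have "2 *\<^sub>R a = (P + a) - (P - a)" by (simp add: scaleR_2)
  then have "star (2 *\<^sub>R a) = 2 *\<^sub>R a"
    using star_diff[of "P + a" "P - a"] star_sum_squares[OF plus] star_sum_squares[OF minus] by simp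
  then have sa: "star a = a" by (simp add: star_scaleR)
  show ?thesis
  proof (rule norm_le_of_shifted_norms[OF sa])
    show "0 \<le> S" using Q R by (simp add: S_def)
    have "S *\<^sub>R 1 + a = (R *\<^sub>R 1 - (P - a)) + (Q *\<^sub>R 1 + P)" by (simp add: S_def algebra_simps)
    also have "norm \<dots> \<le> R + (Q + norm P)"
      using Q R by (intro norm_triangle_mono) (auto intro: order_trans[OF norm_triangle_ineq])
    finally show "norm (S *\<^sub>R 1 + a) \<le> S + norm P" by (simp add: S_def)
    have "S *\<^sub>R 1 - a = (Q *\<^sub>R 1 - (P + a)) + (R *\<^sub>R 1 + P)" by (simp add: S_def algebra_simps)
    also have "norm \<dots> \<le> Q + (R + norm P)"
      using Q R by (intro norm_triangle_mono) (auto intro: order_trans[OF norm_triangle_ineq])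
    finally show "norm (S *\<^sub>R 1 - a) \<le> S + norm P" by (simp add: S_def)
  qed simp
qed

text \<open>
  With \<open>q = (z\<^sup>2 + d\<^sup>2)\<^bsup>-1/2\<^esup>\<close>, the element \<open>z q\<close> is a smoothed sign of \<open>z\<close> and
  \<open>q (z\<^sup>2 + d\<^sup>2)\<close> is a smoothed absolute value.
\<close>

lemma smoothed_absolute_value:
  fixes z :: "'a::{cstar_algebra, real_normed_algebra_1}"
  assumes z: "star z = z" and d: "d > 0"
  obtains q m where "star q = q" "q * z = z * q" "norm (z * q) \<le> 1"
    "m + z \<in> sum_squares" "m - z \<in> sum_squares" "norm (m - z * q * z) \<le> d"
proof -
  \<comment> \<open>\<open>r ^ 4\<close> exceeds (norm z)^2 + d^2, and being a fourth power it
    leaves the factor 1 / r in the power -1/4 below.\<close>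
  define r where "r = 1 + norm z + d"
  have r1: "r \<ge> 1" using d by (simp add: r_def)
  have r4: "(norm z)\<^sup>2 + d\<^sup>2 < r ^ 4"
  proof -
    have "0 \<le> norm z * d" using d by simp
    then have "(norm z)\<^sup>2 + d\<^sup>2 < r ^ 2" using d unfolding r_def
      by (simp add: power2_eq_square algebra_simps add_pos_nonneg)
    also have "r ^ 2 \<le> r ^ 4" using r1 by (intro power_increasing) auto
    finally show ?thesis .
  qed
  define D where "D = z * z + d\<^sup>2 *\<^sub>R 1"
  define u where "u = 1 - (1 / r ^ 4) *\<^sub>R D"
  have u: "norm u < 1"
  proof -
    have "norm ((r ^ 4 - d\<^sup>2) *\<^sub>R 1 - z * z) \<le> r ^ 4 - d\<^sup>2"
      using r4 by (intro norm_real_minus_square_le z) simp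
    moreover have "u = (1 / r ^ 4) *\<^sub>R ((r ^ 4 - d\<^sup>2) *\<^sub>R 1 - z * z)"
      using r1 by (simp add: u_def D_def algebra_simps)
    ultimately have "norm u \<le> (r ^ 4 - d\<^sup>2) / r ^ 4" using r1 by (simp add: divide_right_mono)
    also have "\<dots> < 1" using r1 d by simp
    finally show ?thesis .
  qed
  have su: "star u = u" by (simp add: u_def D_def star_diff star_add star_mult star_scaleR z)
  \<comment> \<open>Since \<open>1 - u\<close> is \<open>D\<close> divided by r^4, this
    \<open>n\<close> is \<open>D\<close> to the power -1/4; hence \<open>q\<close> is D^(-1/2) and
    the later \<open>m\<close> is D^(1/2).\<close>
  define n where "n = (1 / r) *\<^sub>R binomial_series (- 1 / 4) u"
  have sn: "star n = n" by (simp add: n_def star_scaleR star_binomial_series[OF u su])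
  have "z * u = u * z" by (simp add: u_def D_def algebra_simps)
  from binomial_series_commute[OF u this] have nz: "n * z = z * n" by (simp add: n_def)
  define q where "q = n * n"
  have sq: "star q = q" by (simp add: q_def star_mult sn)
  have qz: "q * z = z * q" unfolding q_def by (metis nz mult.assoc)
  have nq: "n * q = q * n" by (simp add: q_def mult.assoc)
  have "q * q * D = 1"
  proof -
    have q: "q = (1 / r\<^sup>2) *\<^sub>R binomial_series (- 1 / 2) u"
      using binomial_series_mult[OF u, of "-1/4" "-1/4"] by (simp add: q_def n_def power2_eq_square)
    then have "q * q = (1 / r ^ 4) *\<^sub>R binomial_series (- 1) u"
      using binomial_series_mult[OF u, of "-1/2" "-1/2"] by (simp add: flip: power_add)
    moreover have "D = r ^ 4 *\<^sub>R binomial_series 1 u"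
      unfolding binomial_series_1[OF u] using r1 by (simp add: u_def)
    ultimately show ?thesis
      using binomial_series_mult[OF u, of "-1" 1] binomial_series_0[OF u] r1 by simp
  qed
  define m where "m = q * D"
  have qD: "q * D = D * q" by (simp add: D_def algebra_simps) (metis qz mult.assoc)
  have qm: "q * m = 1" using \<open>q * q * D = 1\<close> by (simp add: m_def mult.assoc)
  have mq: "m * q = 1" using qm unfolding m_def by (metis qD mult.assoc)
  have zD: "z * D = D * z" by (simp add: D_def algebra_simps)
  have mz: "m * z = z * m" unfolding m_def by (metis zD qz mult.assoc)
  have "star D = D" by (simp add: D_def star_add star_mult star_scaleR z)
  then have sm: "star m = m" by (simp add: m_def star_mult sq qD)
  have nD: "n * D = D * n" by (simp add: D_def algebra_simps) (metis nz mult.assoc)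
  have nm: "n * m = m * n" unfolding m_def by (metis nD nq mult.assoc)
  have m_eq: "m = z * q * z + d\<^sup>2 *\<^sub>R q" by (simp add: m_def D_def algebra_simps) (metis qz mult.assoc)
  \<comment> \<open>To be used for w = z and w = -z. From q m = 1 and q w^2 + d^2 q = m follows q (m
    + w)^2 + d^2 q = 2 (m + w), and the left side is the sum of the squares of n (m + w) and d
    n.\<close>
  have half: "m + w \<in> sum_squares" if w: "star w = w" "n * w = w * n" "m * w = w * m" "q * w = w * q" "w * w = z * z" for w
  proof -
    have sq1: "(n * (m + w)) * (n * (m + w)) = q * ((m + w) * (m + w))"
      using nm w(2) unfolding q_def by (simp add: distrib_left distrib_right) (metis mult.assoc)
    have "q * ((m + w) * (m + w)) + d\<^sup>2 *\<^sub>R q = (q * m) * m + (q * m) * w + q * (w * m) + q * (w * w) + d\<^sup>2 *\<^sub>R q"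
      by (simp add: algebra_simps)
    also have "q * (w * m) = (q * m) * w" using w(3) by (simp add: mult.assoc)
    also have "q * (w * w) = z * q * z" unfolding w(5) by (metis qz mult.assoc)
    also have "(q * m) * m + (q * m) * w + (q * m) * w + z * q * z + d\<^sup>2 *\<^sub>R q
        = m + w + w + (z * q * z + d\<^sup>2 *\<^sub>R q)"
      by (simp add: qm add.assoc)
    also have "\<dots> = 2 *\<^sub>R (m + w)" unfolding m_eq[symmetric] by (simp add: scaleR_2)
    finally have "(n * (m + w)) * (n * (m + w)) + (d *\<^sub>R n) * (d *\<^sub>R n) = 2 *\<^sub>R (m + w)"
      by (simp add: sq1 q_def power2_eq_square)
    moreover have "star (n * (m + w)) = n * (m + w)"
      using nm w by (simp add: star_mult star_add sn sm distrib_left distrib_right)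
    then have "(n * (m + w)) * (n * (m + w)) + (d *\<^sub>R n) * (d *\<^sub>R n) \<in> sum_squares"
      by (intro sum_squares.add_square square_in_sum_squares) (simp_all add: star_scaleR sn)
    ultimately have "2 *\<^sub>R (m + w) \<in> sum_squares" by simp
    from sum_squares_scaleR[OF this, of "1 / 2"] show ?thesis by simp
  qed
  have szq: "star (z * q) = z * q" by (simp add: star_mult z sq qz)
  \<comment> \<open>z q and d q behave like sine and cosine, so both have norm at most 1. The second
    bound makes m - z q z = d^2 q of norm at most d.\<close>
  have 1: "(z * q) * (z * q) + (d *\<^sub>R q) * (d *\<^sub>R q) = 1"
  proof -
    have "(z * q) * (z * q) = q * (z * q * z)" by (metis qz mult.assoc)
    then have "(z * q) * (z * q) + (d *\<^sub>R q) * (d *\<^sub>R q) = q * m"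
      unfolding m_eq by (simp add: distrib_left power2_eq_square)
    then show ?thesis by (simp add: qm)
  qed
  have comm: "(z * q) * (d *\<^sub>R q) = (d *\<^sub>R q) * (z * q)" by simp (metis qz mult.assoc)
  show ?thesis
  proof
    have "(norm (z * q))\<^sup>2 \<le> norm ((z * q) * (z * q) + (d *\<^sub>R q) * (d *\<^sub>R q))"
      by (intro norm_square_le_sum_squares szq comm) (simp add: star_scaleR sq)
    then show "norm (z * q) \<le> 1" unfolding 1 by (simp add: power_le_one_iff abs_square_le_1)
    have "(norm (d *\<^sub>R q))\<^sup>2 \<le> norm ((d *\<^sub>R q) * (d *\<^sub>R q) + (z * q) * (z * q))"
      by (intro norm_square_le_sum_squares szq comm[symmetric]) (simp add: star_scaleR sq)
    then have "norm (d *\<^sub>R q) \<le> 1"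
      using 1 by (simp add: add.commute power_le_one_iff abs_square_le_1)
    then have "norm (d *\<^sub>R (d *\<^sub>R q)) \<le> d" using d by simp
    moreover have "m - z * q * z = d *\<^sub>R (d *\<^sub>R q)" unfolding m_eq by (simp add: power2_eq_square)
    ultimately show "norm (m - z * q * z) \<le> d" by metis
    show "m + z \<in> sum_squares" by (rule half) (simp_all add: z nz mz qz)
    show "m - z \<in> sum_squares" using half[of "- z"] by (simp add: z nz mz qz star_minus)
  qed (fact sq qz)+
qed

section \<open>Unitization\<close>

text \<open>
  The norm of \<open>(x, c)\<close> is the larger of \<open>\<bar>c\<bar>\<close> and the norm of left multiplication by \<open>x + c\<close> on the
  algebra; the first entry is needed because the algebra may already have a unit, or be trivial.
\<close>

typedef 'a unitization = "UNIV :: ('a \<times> complex) set" ..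

setup_lifting type_definition_unitization

lift_definition upart :: "'a unitization \<Rightarrow> 'a" is fst .
lift_definition uscalar :: "'a unitization \<Rightarrow> complex" is snd .
lift_definition unitize :: "'a \<Rightarrow> complex \<Rightarrow> 'a unitization" is Pair .

lemma unitize_simps [simp]: "upart (unitize x c) = x" "uscalar (unitize x c) = c"
  by (transfer, simp)+

lemma unitization_eqI: "upart X = upart Y \<Longrightarrow> uscalar X = uscalar Y \<Longrightarrow> X = Y"
  by transfer (auto simp: prod_eq_iff)

definition left_mult :: "'a::cstar_algebra unitization \<Rightarrow> 'a \<Rightarrow> 'a" where
  "left_mult X y = upart X * y + uscalar X *\<^sub>C y"

lemma bounded_linear_left_mult: "bounded_linear (left_mult X)"
proof (rule bounded_linear_intro[where K = "norm (upart X) + cmod (uscalar X)"])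
  fix x y :: 'a and r :: real
  show "left_mult X (x + y) = left_mult X x + left_mult X y"
    by (simp add: left_mult_def distrib_left scaleC_add_right)
  show "left_mult X (r *\<^sub>R x) = r *\<^sub>R left_mult X x"
    by (simp add: left_mult_def scaleC_scaleR scaleR_add_right)
  show "norm (left_mult X x) \<le> norm x * (norm (upart X) + cmod (uscalar X))"
    using norm_triangle_ineq[of "upart X * x" "uscalar X *\<^sub>C x"] norm_mult_ineq[of "upart X" x]
    by (simp add: left_mult_def norm_scaleC algebra_simps)
qed

instantiation unitization :: (cstar_algebra) "{real_normed_algebra_1, scaleC}"
begin

definition "0 = unitize 0 0"
definition "X + Y = unitize (upart X + upart Y) (uscalar X + uscalar Y)"
definition "- X = unitize (- upart X) (- uscalar X)"
definition "X - Y = unitize (upart X - upart Y) (uscalar X - uscalar Y)"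
definition "c *\<^sub>C X = unitize (c *\<^sub>C upart X) (c * uscalar X)"
definition "r *\<^sub>R X = unitize (r *\<^sub>R upart X) (r *\<^sub>R uscalar X)"
definition "1 = unitize 0 1"
definition "X * Y = unitize (upart X * upart Y + uscalar X *\<^sub>C upart Y + uscalar Y *\<^sub>C upart X) (uscalar X * uscalar Y)"
definition "norm X = max (cmod (uscalar X)) (onorm (left_mult X))"
definition dist_unitization :: "'a unitization \<Rightarrow> 'a unitization \<Rightarrow> real" where
  "dist_unitization X Y = norm (X - Y)"
definition sgn_unitization :: "'a unitization \<Rightarrow> 'a unitization" where
  "sgn_unitization X = inverse (norm X) *\<^sub>R X"
definition uniformity_unitization :: "('a unitization \<times> 'a unitization) filter" where
  "uniformity_unitization = (INF e\<in>{0 <..}. principal {(x, y). dist x y < e})"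
definition open_unitization :: "'a unitization set \<Rightarrow> bool" where
  "open_unitization U = (\<forall>x\<in>U. \<forall>\<^sub>F (x', y) in uniformity. x' = x \<longrightarrow> y \<in> U)"

lemmas unitization_ops = zero_unitization_def plus_unitization_def uminus_unitization_def
  minus_unitization_def scaleC_unitization_def scaleR_unitization_def one_unitization_def
  times_unitization_def

lemma upart_simps [simp]:
  "upart 0 = (0::'a)" "upart 1 = (0::'a)" "upart (X + Y) = upart X + (upart Y :: 'a)"
  "upart (X - Y) = upart X - (upart Y :: 'a)" "upart (- X) = - (upart X :: 'a)"
  "upart (c *\<^sub>C X) = c *\<^sub>C (upart X :: 'a)" "upart (r *\<^sub>R X) = r *\<^sub>R (upart X :: 'a)"
  "upart (X * Y) = upart X * upart Y + uscalar X *\<^sub>C upart Y + uscalar Y *\<^sub>C (upart X :: 'a)"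
  by (simp_all add: unitization_ops)

lemma uscalar_simps [simp]:
  fixes X Y :: "'a unitization"
  shows "uscalar (0 :: 'a unitization) = 0" "uscalar (1 :: 'a unitization) = 1"
  "uscalar (X + Y) = uscalar X + uscalar Y"
  "uscalar (X - Y) = uscalar X - uscalar Y" "uscalar (- X) = - uscalar X"
  "uscalar (c *\<^sub>C X) = c * uscalar X" "uscalar (r *\<^sub>R X) = r *\<^sub>R uscalar X"
  "uscalar (X * Y) = uscalar X * uscalar Y"
  by (simp_all add: unitization_ops)

lemma left_mult_mult: "left_mult (X * Y) = left_mult X \<circ> (left_mult Y :: 'a \<Rightarrow> 'a)"
  by (simp add: fun_eq_iff left_mult_def distrib_left distrib_right scaleC_mult_left
      scaleC_mult_right scaleC_add_right scaleC_scaleC algebra_simps)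

lemma norm_left_mult_le: "norm (left_mult X y) \<le> norm X * norm (y :: 'a)"
  using onorm[OF bounded_linear_left_mult, of X y] mult_right_mono[of "onorm (left_mult X)" "norm X" "norm y"]
  by (simp add: norm_unitization_def)

lemma norm_unitization_le:
  assumes "cmod (uscalar X) \<le> B" "\<And>y. norm (left_mult X (y :: 'a)) \<le> B * norm y"
  shows "norm X \<le> B"
  using assms(1) onorm_bound[of B "left_mult X"] order_trans[OF norm_ge_zero assms(1)] assms(2)
  by (simp add: norm_unitization_def)

lemma cmod_uscalar_le: "cmod (uscalar (X :: 'a unitization)) \<le> norm X"
  by (simp add: norm_unitization_def)

lemma scaleR_eq_scaleC_unitization: "r *\<^sub>R X = complex_of_real r *\<^sub>C (X :: 'a unitization)"
  by (rule unitization_eqI) (simp_all add: scaleC_of_real scaleR_conv_of_real[where 'a = complex])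

lemma norm_scaleC_unitization: "norm (c *\<^sub>C X) = cmod c * norm (X :: 'a unitization)"
proof -
  have le: "norm (c *\<^sub>C X) \<le> cmod c * norm X" for c and X :: "'a unitization"
  proof (rule norm_unitization_le)
    show "cmod (uscalar (c *\<^sub>C X)) \<le> cmod c * norm X"
      by (simp add: norm_mult mult_left_mono cmod_uscalar_le)
    fix y :: 'a
    have "left_mult (c *\<^sub>C X) y = c *\<^sub>C left_mult X y"
      by (simp add: left_mult_def scaleC_add_right scaleC_scaleC scaleC_mult_left)
    then show "norm (left_mult (c *\<^sub>C X) y) \<le> cmod c * norm X * norm y"
      using norm_left_mult_le[of X y] by (simp add: norm_scaleC mult.assoc mult_left_mono)
  qed
  show ?thesis
  proof (cases "c = 0")
    case True
    then show ?thesis using le[of c X] cmod_uscalar_le[of "c *\<^sub>C X"] by simp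
  next
    case False
    have "inverse c *\<^sub>C c *\<^sub>C X = X" using False by (intro unitization_eqI) (simp_all add: scaleC_scaleC)
    then have "norm X \<le> cmod (inverse c) * norm (c *\<^sub>C X)" using le[of "inverse c" "c *\<^sub>C X"] by simp
    then have "norm X \<le> norm (c *\<^sub>C X) / cmod c" by (simp add: norm_inverse divide_inverse mult.commute)
    then have "cmod c * norm X \<le> norm (c *\<^sub>C X)" using False by (simp add: field_simps)
    then show ?thesis using le[of c X] by simp
  qed
qed

instance
proof
  fix X Y Z :: "'a unitization" and a b :: real
  show "X + Y + Z = X + (Y + Z)" "X + Y = Y + X" "0 + X = X" "- X + X = 0" "X - Y = X + - Y"
    "a *\<^sub>R (X + Y) = a *\<^sub>R X + a *\<^sub>R Y" "(a + b) *\<^sub>R X = a *\<^sub>R X + b *\<^sub>R X"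
    "a *\<^sub>R b *\<^sub>R X = (a * b) *\<^sub>R X" "1 *\<^sub>R X = X"
    by (rule unitization_eqI; simp add: algebra_simps)+
  show "X * Y * Z = X * (Y * Z)"
    by (rule unitization_eqI)
      (simp_all add: distrib_left distrib_right scaleC_mult_left scaleC_mult_right scaleC_add_right
        scaleC_scaleC mult.assoc mult.commute add_ac)
  show "(X + Y) * Z = X * Z + Y * Z" "X * (Y + Z) = X * Y + X * Z"
    by (rule unitization_eqI; simp add: distrib_left distrib_right scaleC_add_right scaleC_add_left)+
  show "a *\<^sub>R X * Y = a *\<^sub>R (X * Y)" "X * a *\<^sub>R Y = a *\<^sub>R (X * Y)"
    by (rule unitization_eqI; simp add: scaleR_conv_of_real[where 'a = complex] scaleC_add_right
        scaleC_of_real[symmetric] scaleC_scaleC scaleC_mult_left scaleC_mult_right mult_ac)+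
  show "1 * X = X" "X * 1 = X" by (rule unitization_eqI; simp)+
  show "(0 :: 'a unitization) \<noteq> 1"
    by (metis uscalar_simps(1,2) zero_neq_one)
  show "dist X Y = norm (X - Y)" by (rule dist_unitization_def)
  show "sgn X = inverse (norm X) *\<^sub>R X" by (rule sgn_unitization_def)
  show "uniformity = (INF e\<in>{0 <..}. principal {(x, y::'a unitization). dist x y < e})"
    by (rule uniformity_unitization_def)
  show "open U = (\<forall>x\<in>U. \<forall>\<^sub>F (x', y) in uniformity. x' = x \<longrightarrow> y \<in> U)" for U :: "'a unitization set"
    by (rule open_unitization_def)
  show "norm X = 0 \<longleftrightarrow> X = 0"
  proof
    assume 0: "norm X = 0"
    then have s: "uscalar X = 0" using cmod_uscalar_le[of X] by simp
    have "norm (left_mult X (star (upart X))) \<le> 0" using norm_left_mult_le[of X "star (upart X)"] 0 by simp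
    then have "star (star (upart X)) * star (upart X) = 0" by (simp add: left_mult_def s star_star)
    then have "upart X = 0" using norm_star_mult_self[of "star (upart X)"] by simp
    with s show "X = 0" by (intro unitization_eqI) simp_all
  next
    assume "X = 0"
    then show "norm X = 0" by (simp add: norm_unitization_def left_mult_def[abs_def] onorm_zero)
  qed
  show "norm (X + Y) \<le> norm X + norm Y"
  proof (rule norm_unitization_le)
    show "cmod (uscalar (X + Y)) \<le> norm X + norm Y"
      using norm_triangle_mono[OF cmod_uscalar_le cmod_uscalar_le] by simp
    fix y :: 'a
    have "left_mult (X + Y) y = left_mult X y + left_mult Y y"
      by (simp add: left_mult_def distrib_right scaleC_add_left)
    then show "norm (left_mult (X + Y) y) \<le> (norm X + norm Y) * norm y"
      using norm_triangle_mono[OF norm_left_mult_le[of X y] norm_left_mult_le[of Y y]]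
      by (simp add: distrib_right)
  qed
  show "norm (a *\<^sub>R X) = \<bar>a\<bar> * norm X" by (simp add: scaleR_eq_scaleC_unitization norm_scaleC_unitization)
  show "norm (X * Y) \<le> norm X * norm Y"
  proof (rule norm_unitization_le)
    show "cmod (uscalar (X * Y)) \<le> norm X * norm Y"
      by (simp add: norm_mult mult_mono cmod_uscalar_le order_trans[OF norm_ge_zero cmod_uscalar_le])
    fix y :: 'a
    have "norm (left_mult (X * Y) y) \<le> norm X * norm (left_mult Y y)"
      using norm_left_mult_le[of X "left_mult Y y"] by (simp add: left_mult_mult)
    also have "\<dots> \<le> norm X * (norm Y * norm y)"
      by (intro mult_left_mono norm_left_mult_le order_trans[OF norm_ge_zero cmod_uscalar_le])
    finally show "norm (left_mult (X * Y) y) \<le> norm X * norm Y * norm y" by (simp add: mult.assoc)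
  qed
  show "norm (1 :: 'a unitization) = 1"
  proof (rule antisym)
    show "norm (1 :: 'a unitization) \<le> 1" by (rule norm_unitization_le) (simp_all add: left_mult_def)
    show "1 \<le> norm (1 :: 'a unitization)" using cmod_uscalar_le[of "1 :: 'a unitization"] by simp
  qed
qed

end

abbreviation emb :: "'a::cstar_algebra \<Rightarrow> 'a unitization" where "emb x \<equiv> unitize x 0"

text \<open>Left multiplication by \<open>x\<close> attains the norm of \<open>x\<close> on
  \<open>star x\<close>, so the operator norm extends the given norm.\<close>

lemma norm_embed [simp]: "norm (emb x) = norm (x::'a::cstar_algebra)"
proof (rule antisym)
  show "norm (emb x) \<le> norm x"
    by (rule norm_unitization_le) (simp_all add: left_mult_def norm_mult_ineq)
  have "norm x * norm x \<le> norm (emb x) * norm x"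
    using norm_left_mult_le[of "emb x" "star x"] norm_star_mult_self[of "star x"]
    by (simp add: left_mult_def star_star power2_eq_square)
  then show "norm x \<le> norm (emb x)" by (cases "x = 0") auto
qed

lemma embed_simps:
  "emb 0 = 0" "emb (x + y) = emb x + emb y" "emb (x - y) = emb x - emb y"
  "emb (- x) = - emb x" "emb (x * y) = emb x * emb y" "emb (r *\<^sub>R x) = r *\<^sub>R emb x"
  by (auto intro!: unitization_eqI)

instance unitization :: (cstar_algebra) cbanach
proof
  fix X Y :: "'a unitization" and c d :: complex and r :: real
  show "c *\<^sub>C (X + Y) = c *\<^sub>C X + c *\<^sub>C Y" "(c + d) *\<^sub>C X = c *\<^sub>C X + d *\<^sub>C X"
    "c *\<^sub>C d *\<^sub>C X = (c * d) *\<^sub>C X"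
    by (rule unitization_eqI; simp add: scaleC_add_right scaleC_add_left scaleC_scaleC algebra_simps)+
  show "complex_of_real r *\<^sub>C X = r *\<^sub>R X" by (rule scaleR_eq_scaleC_unitization[symmetric])
  show "norm (c *\<^sub>C X) = cmod c * norm X" by (rule norm_scaleC_unitization)
next
  fix X :: "nat \<Rightarrow> 'a unitization"
  assume X: "Cauchy X"
  have norm_scal: "norm (unitize 0 c :: 'a unitization) \<le> cmod c" for c
    by (rule norm_unitization_le) (simp_all add: left_mult_def norm_scaleC)
  \<comment> \<open>Splitting off the scalar costs a factor 2; so both components of a Cauchy
    sequence are Cauchy, and limits can be taken componentwise.\<close>
  have part: "norm (upart Y) \<le> 2 * norm Y" for Y :: "'a unitization"
  proof -
    have "emb (upart Y) = Y - unitize 0 (uscalar Y)" by (rule unitization_eqI) simp_all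
    then have "norm (upart Y) = norm (Y - unitize 0 (uscalar Y))" using norm_embed[of "upart Y"] by simp
    also have "\<dots> \<le> norm Y + cmod (uscalar Y)"
      using norm_triangle_ineq4[of Y "unitize 0 (uscalar Y)"] norm_scal[of "uscalar Y"] by linarith
    finally show ?thesis using cmod_uscalar_le[of Y] by linarith
  qed
  have "Cauchy (\<lambda>n. uscalar (X n))"
  proof (rule metric_CauchyI)
    fix e :: real assume "e > 0"
    then obtain M where M: "\<And>m n. m \<ge> M \<Longrightarrow> n \<ge> M \<Longrightarrow> norm (X m - X n) < e"
      using CauchyD[OF X, of e] by blast
    have "dist (uscalar (X m)) (uscalar (X n)) < e" if "m \<ge> M" "n \<ge> M" for m n
      using cmod_uscalar_le[of "X m - X n"] M[OF that] by (simp add: dist_norm)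
    then show "\<exists>M. \<forall>m\<ge>M. \<forall>n\<ge>M. dist (uscalar (X m)) (uscalar (X n)) < e" by blast
  qed
  then obtain c where c: "(\<lambda>n. uscalar (X n)) \<longlonglongrightarrow> c"
    unfolding Cauchy_convergent_iff convergent_def by blast
  have "Cauchy (\<lambda>n. upart (X n))"
  proof (rule metric_CauchyI)
    fix e :: real assume "e > 0"
    then obtain M where M: "\<And>m n. m \<ge> M \<Longrightarrow> n \<ge> M \<Longrightarrow> norm (X m - X n) < e / 2"
      using CauchyD[OF X, of "e / 2"] by auto
    have "dist (upart (X m)) (upart (X n)) < e" if "m \<ge> M" "n \<ge> M" for m n
      using part[of "X m - X n"] M[OF that] by (simp add: dist_norm)
    then show "\<exists>M. \<forall>m\<ge>M. \<forall>n\<ge>M. dist (upart (X m)) (upart (X n)) < e" by blast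
  qed
  then obtain x where x: "(\<lambda>n. upart (X n)) \<longlonglongrightarrow> x"
    unfolding Cauchy_convergent_iff convergent_def by blast
  have lim: "(\<lambda>n. norm (upart (X n) - x) + cmod (uscalar (X n) - c)) \<longlonglongrightarrow> 0"
    using tendsto_add[OF tendsto_norm_zero[OF LIM_zero[OF x]] tendsto_norm_zero[OF LIM_zero[OF c]]] by simp
  have le': "norm (X n - unitize x c) \<le> norm (upart (X n) - x) + cmod (uscalar (X n) - c)" for n
  proof -
    have "X n - unitize x c = emb (upart (X n) - x) + unitize 0 (uscalar (X n) - c)"
      by (rule unitization_eqI) simp_all
    also have "norm \<dots> \<le> norm (emb (upart (X n) - x)) + cmod (uscalar (X n) - c)"
      by (rule norm_triangle_mono[OF order_refl norm_scal])
    finally show ?thesis by simp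
  qed
  have "(\<lambda>n. X n - unitize x c) \<longlonglongrightarrow> 0"
    by (rule Lim_null_comparison[OF _ lim]) (simp add: le')
  then have "X \<longlonglongrightarrow> unitize x c" by (rule LIM_zero_cancel)
  then show "convergent X" by (auto simp: convergent_def)
qed

instantiation unitization :: (cstar_algebra) cstar_algebra
begin

definition "star X = unitize (star (upart X)) (cnj (uscalar X))"

lemma star_unitization_simps [simp]:
  "upart (star X) = star (upart X :: 'a)" "uscalar (star (X :: 'a unitization)) = cnj (uscalar X)"
  by (simp_all add: star_unitization_def)

instance
proof
  fix X Y :: "'a unitization" and c :: complex
  show "c *\<^sub>C X * Y = c *\<^sub>C (X * Y)" "X * c *\<^sub>C Y = c *\<^sub>C (X * Y)"
    by (rule unitization_eqI; simp add: scaleC_mult_left scaleC_mult_right scaleC_add_right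
        scaleC_scaleC mult_ac)+
  show "star (X + Y) = star X + star Y" "star (c *\<^sub>C X) = cnj c *\<^sub>C star X"
    "star (X * Y) = star Y * star X" "star (star X) = X"
    by (rule unitization_eqI; simp add: star_add star_scaleC star_mult star_star add_ac mult.commute)+
  \<comment> \<open>For y in the algebra, the square of the norm of X y is the norm of y adjoint
    times \<open>star X * X\<close> times y. The reverse inequality follows at the end from
    submultiplicativity and the isometry of \<open>star\<close>.\<close>
  have ge: "(norm X)\<^sup>2 \<le> norm (star X * X)" for X :: "'a unitization"
  proof -
    have "cmod (uscalar X) \<le> sqrt (norm (star X * X))"
      using cmod_uscalar_le[of "star X * X"] by (intro real_le_rsqrt) (simp add: norm_mult power2_eq_square)
    moreover have "norm (left_mult X y) \<le> sqrt (norm (star X * X)) * norm y" for y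
    proof -
      have "star (left_mult X y) * left_mult X y = star y * left_mult (star X * X) y"
        by (simp add: left_mult_def star_add star_mult star_scaleC distrib_left distrib_right
            scaleC_mult_left scaleC_mult_right scaleC_add_right scaleC_scaleC mult.assoc algebra_simps)
      then have "(norm (left_mult X y))\<^sup>2 = norm (star y * left_mult (star X * X) y)"
        using norm_star_mult_self[of "left_mult X y"] by simp
      also have "\<dots> \<le> norm y * (norm (star X * X) * norm y)"
        by (rule order_trans[OF norm_mult_ineq]) (simp add: mult_left_mono norm_left_mult_le)
      also have "\<dots> = (sqrt (norm (star X * X)) * norm y)\<^sup>2"
        by (simp add: power_mult_distrib power2_eq_square mult_ac)
      finally show ?thesis by (rule power2_le_imp_le) simp
    qed
    ultimately have "norm X \<le> sqrt (norm (star X * X))" by (rule norm_unitization_le)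
    then have "(norm X)\<^sup>2 \<le> (sqrt (norm (star X * X)))\<^sup>2" by (intro power_mono) auto
    then show ?thesis by simp
  qed
  have le: "norm X \<le> norm (star X)" for X :: "'a unitization"
  proof (cases "X = 0")
    case False
    have "norm X * norm X \<le> norm (star X) * norm X"
      using order_trans[OF ge[of X] norm_mult_ineq] by (simp add: power2_eq_square)
    with False show ?thesis by simp
  qed simp
  have ss: "star (star X) = X" by (rule unitization_eqI) (simp_all add: star_star)
  have "norm (star X) = norm X" using le[of X] le[of "star X"] unfolding ss by (rule antisym[rotated])
  then have "norm (star X * X) \<le> norm X * norm X" using norm_mult_ineq[of "star X" X] by simp
  then show "norm (star X * X) = (norm X)\<^sup>2" using ge[of X] by (simp add: power2_eq_square)
qed

end

lemma star_embed: "star (emb x) = emb (star x)"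
  by (rule unitization_eqI) simp_all

section \<open>Sublinear functionals\<close>

text \<open>Relative to a subspace, because the functionals on bounded functions will live inside a
  type of all functions.\<close>

definition sublinear_on :: "'v::real_vector set \<Rightarrow> ('v \<Rightarrow> real) \<Rightarrow> bool" where
  "sublinear_on V p \<longleftrightarrow> (\<forall>x\<in>V. \<forall>y\<in>V. p (x + y) \<le> p x + p y) \<and> (\<forall>x\<in>V. \<forall>r\<ge>0. p (r *\<^sub>R x) = r * p x)"

lemma sublinear_onI:
  assumes V: "subspace V" and add: "\<And>x y. x \<in> V \<Longrightarrow> y \<in> V \<Longrightarrow> p (x + y) \<le> p x + p y"
    and scale: "\<And>r x. x \<in> V \<Longrightarrow> r > 0 \<Longrightarrow> p (r *\<^sub>R x) \<le> r * p x" and zero: "p 0 = 0"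
  shows "sublinear_on V p"
  unfolding sublinear_on_def
proof (intro conjI ballI allI impI add)
  fix x and r :: real assume x: "x \<in> V" and r: "0 \<le> r"
  show "p (r *\<^sub>R x) = r * p x"
  proof (cases "r = 0")
    case False
    with r have r: "r > 0" by simp
    have "p (inverse r *\<^sub>R (r *\<^sub>R x)) \<le> inverse r * p (r *\<^sub>R x)"
      using r by (intro scale subspace_scale[OF V x]) simp
    then have "r * p x \<le> p (r *\<^sub>R x)" using r by (simp add: field_simps)
    then show ?thesis using scale[OF x r] by simp
  qed (simp add: zero)
qed

lemma sublinear_on_add: "sublinear_on V p \<Longrightarrow> x \<in> V \<Longrightarrow> y \<in> V \<Longrightarrow> p (x + y) \<le> p x + p y"
  unfolding sublinear_on_def by blast

lemma sublinear_on_scale: "sublinear_on V p \<Longrightarrow> x \<in> V \<Longrightarrow> r \<ge> 0 \<Longrightarrow> p (r *\<^sub>R x) = r * p x"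
  unfolding sublinear_on_def by blast

lemma sublinear_on_zero: "sublinear_on V p \<Longrightarrow> x \<in> V \<Longrightarrow> p 0 = 0"
  using sublinear_on_scale[of V p x 0] by simp

text \<open>Zorn's lemma with pointwise infima as bounds of chains. The infimum is finite because
  -p(-x) lies below every member, and subadditive because of two members of a chain the smaller one
  serves for both arguments.\<close>

lemma sublinear_on_minimal:
  fixes V :: "'v::real_vector set"
  assumes V: "subspace V" and p: "sublinear_on V p"
  obtains q where "sublinear_on V q" "\<And>x. x \<in> V \<Longrightarrow> q x \<le> p x"
    "\<And>q' x. sublinear_on V q' \<Longrightarrow> (\<And>x. x \<in> V \<Longrightarrow> q' x \<le> q x) \<Longrightarrow> x \<in> V \<Longrightarrow> q' x = q x"
proof -
  \<comment> \<open>The value 0 outside \<open>V\<close> leaves only the values on \<open>V\<close>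
    to be minimized. \<open>P q r\<close> puts \<open>r\<close> below \<open>q\<close>, so that an
    element maximal for \<open>P\<close> is a minimal functional.\<close>
  define S where "S = {q. sublinear_on V q \<and> (\<forall>x\<in>V. q x \<le> p x) \<and> (\<forall>x. x \<notin> V \<longrightarrow> q x = 0)}"
  define P where "P = (\<lambda>(q :: 'v \<Rightarrow> real) r. \<forall>x. r x \<le> q x)"
  have V0: "0 \<in> V" and Va: "\<And>x y. x \<in> V \<Longrightarrow> y \<in> V \<Longrightarrow> x + y \<in> V"
    and Vs: "\<And>r x. x \<in> V \<Longrightarrow> r *\<^sub>R x \<in> V" and Vm: "\<And>x. x \<in> V \<Longrightarrow> - x \<in> V"
    using V by (auto simp: subspace_def intro: subspace_neg[OF V])
  have lower: "- p (- x) \<le> q x" if "q \<in> S" "x \<in> V" for q x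
  proof -
    have q: "sublinear_on V q" and le: "q (- x) \<le> p (- x)" using that Vm unfolding S_def by auto
    have "q (0 *\<^sub>R x) = 0 * q x" using q \<open>x \<in> V\<close> unfolding sublinear_on_def by blast
    moreover have "q (x + - x) \<le> q x + q (- x)" using q that Vm unfolding sublinear_on_def by blast
    ultimately show ?thesis using le by simp
  qed
  have "\<exists>m\<in>S. \<forall>a\<in>S. P m a \<longrightarrow> a = m"
  proof (rule predicate_Zorn)
    show "partial_order_on S (relation_of P S)"
      by (rule partial_order_on_relation_ofI) (auto simp: P_def fun_eq_iff intro: order_trans antisym)
    fix C assume C: "C \<in> Chains (relation_of P S)"
    have CS: "C \<subseteq> S" using C by (rule Chains_relation_of)
    have chain: "P q r \<or> P r q" if "q \<in> C" "r \<in> C" for q r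
      using C that unfolding Chains_def relation_of_def by auto
    show "\<exists>u\<in>S. \<forall>a\<in>C. P a u"
    proof (cases "C = {}")
      case True
      have "(\<lambda>x. if x \<in> V then p x else 0) \<in> S"
        using p Va Vs unfolding S_def sublinear_on_def by auto
      with True show ?thesis by blast
    next
      case False
      define u where "u x = (if x \<in> V then INF q\<in>C. q x else 0)" for x
      have bdd: "bdd_below ((\<lambda>q. q x) ` C)" if "x \<in> V" for x
        using lower[OF _ that] CS by (intro bdd_belowI2[of _ "- p (- x)"]) auto
      have le: "u x \<le> q x" if "q \<in> C" "x \<in> V" for q x
        unfolding u_def using cINF_lower[OF bdd[OF that(2)] that(1)] that(2) by simp
      have ge: "c \<le> u x" if "x \<in> V" "\<And>q. q \<in> C \<Longrightarrow> c \<le> q x" for x c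
        unfolding u_def using that False by (auto intro!: cINF_greatest)
      have sub: "u (x + y) \<le> u x + u y" if x: "x \<in> V" and y: "y \<in> V" for x y
      proof -
        have "u (x + y) \<le> q x + r y" if q: "q \<in> C" and r: "r \<in> C" for q r
        proof -
          obtain s where s: "s \<in> C" "s x \<le> q x" "s y \<le> r y"
            using chain[OF q r] q r unfolding P_def by blast
          have "u (x + y) \<le> s (x + y)" using le[OF s(1)] Va x y by blast
          also have "\<dots> \<le> s x + s y" using s(1) CS x y unfolding S_def sublinear_on_def by blast
          finally show ?thesis using s by linarith
        qed
        then have "u (x + y) - r y \<le> u x" if "r \<in> C" for r
          using that by (intro ge[OF x]) (simp add: algebra_simps)
        then have "u (x + y) - u x \<le> u y" by (intro ge[OF y]) (simp add: algebra_simps)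
        then show ?thesis by simp
      qed
      have le_scale: "u (r *\<^sub>R x) \<le> r * u x" if x: "x \<in> V" and r: "r > 0" for x r
      proof -
        have "u (r *\<^sub>R x) / r \<le> q x" if q: "q \<in> C" for q
        proof -
          have "u (r *\<^sub>R x) \<le> q (r *\<^sub>R x)" using le[OF q] Vs x by blast
          also have "\<dots> = r * q x" using q CS x r unfolding S_def sublinear_on_def by auto
          finally show ?thesis using r by (simp add: field_simps)
        qed
        then have "u (r *\<^sub>R x) / r \<le> u x" by (rule ge[OF x])
        then show ?thesis using r by (simp add: field_simps)
      qed
      have "q 0 = 0" if "q \<in> C" for q
        using sublinear_on_zero[OF _ V0, of q] that CS unfolding S_def by blast
      then have "(\<lambda>q. q 0) ` C = {0}" using False by force
      then have "u 0 = 0" unfolding u_def by simp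
      with sub le_scale have "sublinear_on V u" by (intro sublinear_onI V)
      moreover have "u x \<le> p x" if "x \<in> V" for x
      proof -
        obtain q where "q \<in> C" using False by blast
        then show ?thesis using le[OF _ that, of q] CS that unfolding S_def by force
      qed
      ultimately have "u \<in> S" unfolding S_def by (auto simp: u_def)
      moreover have "P q u" if "q \<in> C" for q
      proof -
        have "u x \<le> q x" for x
          using le[OF that, of x] CS that unfolding S_def by (cases "x \<in> V") (auto simp: u_def)
        then show ?thesis by (simp add: P_def)
      qed
      ultimately show ?thesis by blast
    qed
  qed
  then obtain q where q: "q \<in> S" "\<And>a. a \<in> S \<Longrightarrow> P q a \<Longrightarrow> a = q" by blast
  show ?thesis
  proof
    show "sublinear_on V q" "\<And>x. x \<in> V \<Longrightarrow> q x \<le> p x" using q(1) unfolding S_def by auto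
    fix q' x assume q': "sublinear_on V q'" "\<And>x. x \<in> V \<Longrightarrow> q' x \<le> q x" and x: "x \<in> V"
    define a where "a x = (if x \<in> V then q' x else 0)" for x
    have "sublinear_on V a"
      using q'(1) Va Vs unfolding a_def sublinear_on_def by simp
    moreover have "a x \<le> p x" if "x \<in> V" for x
      using q'(2)[OF that] q(1) that unfolding S_def a_def by (auto intro: order_trans)
    ultimately have "a \<in> S" unfolding S_def by (simp add: a_def)
    moreover have "P q a" using q' q(1) unfolding P_def a_def S_def by auto
    ultimately have "a = q" by (rule q(2))
    then have "a x = q x" by simp
    then show "q' x = q x" using x unfolding a_def by simp
  qed
qed

text \<open>The infimum of p (x + d) - s over \<open>D\<close> turns lower constraints into an upper
  bound: a linear L below \<open>w\<close> lies below \<open>p\<close> by the pair (0, 0), and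
  satisfies s <= L d by evaluation at x = -d.\<close>

lemma sublinear_on_lower:
  assumes V: "subspace V" and p: "sublinear_on V p"
    and DV: "\<And>d s. (d, s) \<in> D \<Longrightarrow> d \<in> V \<and> s \<le> p d" and D0: "(0, 0) \<in> D"
    and Da: "\<And>d s e t. (d, s) \<in> D \<Longrightarrow> (e, t) \<in> D \<Longrightarrow> (d + e, s + t) \<in> D"
    and Ds: "\<And>d s r. (d, s) \<in> D \<Longrightarrow> r \<ge> 0 \<Longrightarrow> (r *\<^sub>R d, r * s) \<in> D"
  obtains w where "sublinear_on V w" "\<And>x d s. x \<in> V \<Longrightarrow> (d, s) \<in> D \<Longrightarrow> w x \<le> p (x + d) - s"
proof -
  note Va = subspace_add[OF V] and Vs = subspace_scale[OF V] and Vm = subspace_neg[OF V]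
    and pa = sublinear_on_add[OF p] and ps = sublinear_on_scale[OF p]
  define w where "w x = (INF z\<in>D. p (x + fst z) - snd z)" for x
  have bdd: "bdd_below ((\<lambda>z. p (x + fst z) - snd z) ` D)" if x: "x \<in> V" for x
  proof (rule bdd_belowI2[of _ "- p (- x)"])
    fix z assume z: "z \<in> D"
    have zV: "fst z \<in> V" "snd z \<le> p (fst z)" using DV[of "fst z" "snd z"] z by auto
    have "p (fst z) \<le> p (x + fst z) + p (- x)"
      using pa[of "x + fst z" "- x"] x zV Va Vm by simp
    then show "- p (- x) \<le> p (x + fst z) - snd z" using zV by simp
  qed
  have le: "w x \<le> p (x + d) - s" if "x \<in> V" "(d, s) \<in> D" for x d s
    unfolding w_def using cINF_lower[OF bdd[OF that(1)] that(2)] by simp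
  have ge: "c \<le> w x" if "\<And>d s. (d, s) \<in> D \<Longrightarrow> c \<le> p (x + d) - s" for c x
    unfolding w_def using that D0 by (intro cINF_greatest) auto
  have "sublinear_on V w"
  proof (rule sublinear_onI[OF V])
    fix x y assume x: "x \<in> V" and y: "y \<in> V"
    have "w (x + y) \<le> (p (x + d) - s) + (p (y + e) - t)" if D: "(d, s) \<in> D" "(e, t) \<in> D" for d s e t
    proof -
      have "w (x + y) \<le> p ((x + y) + (d + e)) - (s + t)"
        using le[OF Va[OF x y] Da[OF D]] by simp
      also have "(x + y) + (d + e) = (x + d) + (y + e)" by (simp add: algebra_simps)
      also have "p \<dots> \<le> p (x + d) + p (y + e)" using pa x y DV D Va by simp
      finally show ?thesis by (simp add: algebra_simps)
    qed
    then have "w (x + y) - (p (y + e) - t) \<le> w x" if "(e, t) \<in> D" for e t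
      using that by (intro ge) (simp add: algebra_simps)
    then have "w (x + y) - w x \<le> w y" by (intro ge) (simp add: algebra_simps)
    then show "w (x + y) \<le> w x + w y" by simp
  next
    fix r :: real and x assume x: "x \<in> V" and r: "r > 0"
    have "w (r *\<^sub>R x) / r \<le> w x"
    proof (rule ge)
      fix d s assume D: "(d, s) \<in> D"
      have "p (r *\<^sub>R x + r *\<^sub>R d) = r * p (x + d)"
        using ps[OF Va[OF x], of d r] DV[OF D] r by (simp add: algebra_simps)
      then show "w (r *\<^sub>R x) / r \<le> p (x + d) - s"
        using le[OF Vs[OF x, of r] Ds[OF D, of r]] r by (simp add: field_simps)
    qed
    then show "w (r *\<^sub>R x) \<le> r * w x" using r by (simp add: field_simps)
  next
    have V0: "0 \<in> V" by (rule subspace_0[OF V])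
    have "0 \<le> w 0" using DV by (intro ge) simp
    moreover have "w 0 \<le> 0" using le[OF V0 D0] sublinear_on_zero[OF p V0] by simp
    ultimately show "w 0 = 0" by simp
  qed
  then show ?thesis using le by (rule that)
qed

text \<open>A minimal \<open>q\<close> is linear: lowering it along the ray of h, with the values t
  q(h) as constraints, cannot change it, and t = 1 then yields q(g) + q(h) <= q(g + h).\<close>

lemma sublinear_on_dominates_linear:
  assumes V: "subspace V" and p: "sublinear_on V p"
  obtains L where "\<And>x y. x \<in> V \<Longrightarrow> y \<in> V \<Longrightarrow> L (x + y) = L x + L y"
    "\<And>x r. x \<in> V \<Longrightarrow> L (r *\<^sub>R x) = r * L x" "\<And>x. x \<in> V \<Longrightarrow> L x \<le> p x"
proof -
  note V0 = subspace_0[OF V] and Vs = subspace_scale[OF V] and Vm = subspace_neg[OF V]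
  obtain q where q: "sublinear_on V q" "\<And>x. x \<in> V \<Longrightarrow> q x \<le> p x"
    "\<And>q' x. sublinear_on V q' \<Longrightarrow> (\<And>x. x \<in> V \<Longrightarrow> q' x \<le> q x) \<Longrightarrow> x \<in> V \<Longrightarrow> q' x = q x"
    using sublinear_on_minimal[OF V p] by blast
  note qs = sublinear_on_scale[OF q(1)] and q0 = sublinear_on_zero[OF q(1) V0]
  have super: "q g + q h \<le> q (g + h)" if g: "g \<in> V" and h: "h \<in> V" for g h
  proof -
    define D where "D = {(t *\<^sub>R h, t * q h) | t. t \<ge> 0}"
    have DI: "(t *\<^sub>R h, t * q h) \<in> D" if "t \<ge> 0" for t using that unfolding D_def by blast
    obtain w where w: "sublinear_on V w" "\<And>x d s. x \<in> V \<Longrightarrow> (d, s) \<in> D \<Longrightarrow> w x \<le> q (x + d) - s"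
    proof (rule sublinear_on_lower[OF V q(1), of D])
      show "d \<in> V \<and> s \<le> q d" if "(d, s) \<in> D" for d s
        using that h Vs qs unfolding D_def by auto
      show "(0, 0) \<in> D" using DI[of 0] by simp
      show "(d + e, s + t) \<in> D" if D: "(d, s) \<in> D" "(e, t) \<in> D" for d s e t
      proof -
        obtain a b where "a \<ge> 0" "b \<ge> 0" "d = a *\<^sub>R h" "e = b *\<^sub>R h" "s = a * q h" "t = b * q h"
          using D unfolding D_def by blast
        then show ?thesis using DI[of "a + b"] by (simp add: algebra_simps)
      qed
      show "(r *\<^sub>R d, r * s) \<in> D" if D: "(d, s) \<in> D" and r: "r \<ge> 0" for d s r
      proof -
        obtain a where "a \<ge> 0" "d = a *\<^sub>R h" "s = a * q h" using D unfolding D_def by blast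
        then show ?thesis using DI[of "r * a"] r by (simp add: mult.assoc)
      qed
    qed blast
    have "w x \<le> q x" if "x \<in> V" for x using w(2)[OF that DI[of 0]] by simp
    from q(3)[OF w(1) this g] have "q g = w g" by simp
    also have "\<dots> \<le> q (g + h) - q h" using w(2)[OF g DI[of 1]] by simp
    finally show ?thesis by simp
  qed
  have add: "q (x + y) = q x + q y" if "x \<in> V" "y \<in> V" for x y
    using sublinear_on_add[OF q(1) that] super[OF that] by (rule antisym)
  have minus: "q (- x) = - q x" if "x \<in> V" for x using add[OF that Vm[OF that]] q0 by simp
  show ?thesis
  proof
    fix x r assume x: "x \<in> V"
    show "q (r *\<^sub>R x) = r * q x"
    proof (cases "r \<ge> 0")
      case False
      then show ?thesis using qs[OF x, of "- r"] minus[OF Vs[OF x, of r]] by simp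
    qed (use qs x in blast)
  qed (use add q in blast)+
qed

text \<open>A cone of lower constraints is compatible with \<open>p\<close> as soon as each single
  constraint is. The cone will come from the summing inequality in \<open>Pietsch_domination\<close>
  and from the order of the unitization in \<open>dominating_positive_functional\<close>.\<close>

lemma sublinear_on_sandwich:
  assumes V: "subspace V" and p: "sublinear_on V p"
    and DV: "\<And>d s. (d, s) \<in> D \<Longrightarrow> d \<in> V \<and> s \<le> p d" and D0: "(0, 0) \<in> D"
    and Da: "\<And>d s e t. (d, s) \<in> D \<Longrightarrow> (e, t) \<in> D \<Longrightarrow> (d + e, s + t) \<in> D"
    and Ds: "\<And>d s r. (d, s) \<in> D \<Longrightarrow> r \<ge> 0 \<Longrightarrow> (r *\<^sub>R d, r * s) \<in> D"
  obtains L where "\<And>x y. x \<in> V \<Longrightarrow> y \<in> V \<Longrightarrow> L (x + y) = L x + L y"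
    "\<And>x r. x \<in> V \<Longrightarrow> L (r *\<^sub>R x) = r * L x" "\<And>x. x \<in> V \<Longrightarrow> L x \<le> p x"
    "\<And>d s. (d, s) \<in> D \<Longrightarrow> s \<le> L d"
proof -
  obtain w where w: "sublinear_on V w" "\<And>x d s. x \<in> V \<Longrightarrow> (d, s) \<in> D \<Longrightarrow> w x \<le> p (x + d) - s"
    using sublinear_on_lower[OF V p DV D0 Da Ds] by blast
  obtain L where L: "\<And>x y. x \<in> V \<Longrightarrow> y \<in> V \<Longrightarrow> L (x + y) = L x + L y"
    "\<And>x r. x \<in> V \<Longrightarrow> L (r *\<^sub>R x) = r * L x" "\<And>x. x \<in> V \<Longrightarrow> L x \<le> w x"
    using sublinear_on_dominates_linear[OF V w(1)] by blast
  show ?thesis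
  proof (rule that[of L])
    show "L x \<le> p x" if "x \<in> V" for x using L(3)[OF that] w(2)[OF that D0] by simp
    show "s \<le> L d" if D: "(d, s) \<in> D" for d s
    proof -
      have d: "d \<in> V" using DV[OF D] by simp
      have "L (- d) = - L d" using L(2)[OF d, of "-1"] by simp
      moreover have "L (- d) \<le> p (- d + d) - s"
        using L(3) w(2)[OF _ D] subspace_neg[OF V d] by (meson order_trans)
      ultimately show ?thesis using sublinear_on_zero[OF p d] by simp
    qed
  qed (use L in auto)
qed

section \<open>Approximate Riesz representation\<close>

lemma discriminant_bound:
  fixes a b c :: real
  assumes "\<And>s. 0 \<le> a + 2 * s * b + s\<^sup>2 * c" and c: "0 \<le> c"
  shows "b\<^sup>2 \<le> a * c"
proof (cases "c = 0")
  case True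
  have "b = 0"
  proof (rule ccontr)
    assume "b \<noteq> 0"
    then show False using assms(1)[of "- (a + 1) / (2 * b)"] True by (simp add: field_simps)
  qed
  with True show ?thesis by simp
next
  case False
  have "0 \<le> a + 2 * (- b / c) * b + (- b / c)\<^sup>2 * c" by (rule assms(1))
  also have "\<dots> = a - b\<^sup>2 / c" using False by (simp add: field_simps power2_eq_square)
  finally show ?thesis using False c by (simp add: field_simps)
qed

text \<open>The form may be degenerate and the space incomplete. Neither a quotient nor a completion
  is taken, hence the approximate statements below.\<close>

locale semi_inner =
  fixes \<beta> :: "'v::real_vector \<Rightarrow> 'v \<Rightarrow> real"
  assumes add_left: "\<beta> (x + y) z = \<beta> x z + \<beta> y z"
    and scale_left: "\<beta> (r *\<^sub>R x) y = r * \<beta> x y"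
    and commute: "\<beta> x y = \<beta> y x"
    and self_nonneg: "0 \<le> \<beta> x x"
begin

definition snorm :: "'v \<Rightarrow> real" where "snorm x = sqrt (\<beta> x x)"

lemma add_right: "\<beta> z (x + y) = \<beta> z x + \<beta> z y"
  by (metis add_left commute)

lemma scale_right: "\<beta> x (r *\<^sub>R y) = r * \<beta> x y"
  by (metis scale_left commute)

lemma minus_left: "\<beta> (- x) y = - \<beta> x y"
  using scale_left[of "-1" x y] by simp

lemma diff_left: "\<beta> (x - y) z = \<beta> x z - \<beta> y z"
  using add_left[of x "- y" z] minus_left by simp

lemma diff_right: "\<beta> z (x - y) = \<beta> z x - \<beta> z y"
  by (metis diff_left commute)

lemma snorm_nonneg [simp]: "0 \<le> snorm x"
  by (simp add: snorm_def self_nonneg)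

lemma snorm_square: "(snorm x)\<^sup>2 = \<beta> x x"
  by (simp add: snorm_def self_nonneg)

lemma Cauchy_Schwarz: "\<bar>\<beta> x y\<bar> \<le> snorm x * snorm y"
proof -
  have "0 \<le> \<beta> x x + 2 * s * \<beta> x y + s\<^sup>2 * \<beta> y y" for s
    using self_nonneg[of "x + s *\<^sub>R y"] commute[of y x]
    by (simp add: add_left add_right scale_left scale_right power2_eq_square algebra_simps)
  then have "(\<beta> x y)\<^sup>2 \<le> \<beta> x x * \<beta> y y" by (rule discriminant_bound) (rule self_nonneg)
  also have "\<dots> = (snorm x * snorm y)\<^sup>2" by (simp add: power_mult_distrib snorm_square)
  finally show ?thesis by (simp add: abs_le_square_iff[symmetric])
qed

text \<open>Variational argument: \<open>w\<close> nearly maximizes 2 \<tau> x - \<beta> x x. A move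
  by s u gains at most \<eta>^2, and the discriminant of this quadratic inequality in s is the
  claim.\<close>

lemma approximate_Riesz:
  assumes add: "\<And>x y. \<tau> (x + y) = \<tau> x + \<tau> y" and scale: "\<And>r x. \<tau> (r *\<^sub>R x) = r * \<tau> x"
    and bound: "\<And>x. \<tau> x \<le> R * snorm x" and \<eta>: "\<eta> > 0"
  obtains w where "\<And>x. \<bar>\<tau> x - \<beta> w x\<bar> \<le> \<eta> * snorm x"
proof -
  define \<Phi> where "\<Phi> x = 2 * \<tau> x - \<beta> x x" for x
  have le: "\<Phi> x \<le> R\<^sup>2" for x
  proof -
    have "\<Phi> x \<le> 2 * (R * snorm x) - (snorm x)\<^sup>2" using bound[of x] by (simp add: \<Phi>_def snorm_square)
    also have "\<dots> \<le> R\<^sup>2" using zero_le_power2[of "R - snorm x"] by (simp add: power2_diff)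
    finally show ?thesis .
  qed
  then have bdd: "bdd_above (range \<Phi>)" by (intro bdd_aboveI2)
  obtain w where w: "(SUP x. \<Phi> x) - \<eta>\<^sup>2 < \<Phi> w"
    using less_cSUP_iff[OF _ bdd, of "(SUP x. \<Phi> x) - \<eta>\<^sup>2"] \<eta> by auto
  show ?thesis
  proof
    fix u
    have "0 \<le> \<eta>\<^sup>2 + 2 * s * - (\<tau> u - \<beta> w u) + s\<^sup>2 * \<beta> u u" for s
    proof -
      have "\<Phi> (w + s *\<^sub>R u) \<le> \<Phi> w + \<eta>\<^sup>2" using cSUP_upper[OF UNIV_I bdd, of "w + s *\<^sub>R u"] w by simp
      moreover have "\<Phi> (w + s *\<^sub>R u) = \<Phi> w + 2 * s * (\<tau> u - \<beta> w u) - s\<^sup>2 * \<beta> u u"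
        unfolding \<Phi>_def using commute[of u w]
        by (simp add: add scale add_left add_right scale_left scale_right power2_eq_square algebra_simps)
      ultimately show ?thesis by (simp add: algebra_simps)
    qed
    then have "(- (\<tau> u - \<beta> w u))\<^sup>2 \<le> \<eta>\<^sup>2 * \<beta> u u" by (rule discriminant_bound) (rule self_nonneg)
    also have "\<dots> = (\<eta> * snorm u)\<^sup>2" by (simp add: power_mult_distrib snorm_square)
    finally show "\<bar>\<tau> u - \<beta> w u\<bar> \<le> \<eta> * snorm u"
      using \<eta> by (simp add: abs_le_square_iff[symmetric] power2_commute)
  qed
qed

text \<open>
  In the completion \<open>\<tau>\<close> is represented by a vector, and by the Hahn-Banach theorem the last
  hypothesis places that vector in the closure of \<open>D\<close>. The completion is avoided by combining an
  approximate representing vector with an approximate nearest point of \<open>D\<close>.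
\<close>

lemma approximate_Riesz_in_convex:
  assumes add: "\<And>x y. \<tau> (x + y) = \<tau> x + \<tau> y" and scale: "\<And>r x. \<tau> (r *\<^sub>R x) = r * \<tau> x"
    and D: "convex D" "\<And>d. d \<in> D \<Longrightarrow> snorm d \<le> R"
    and sup: "\<And>x \<eta>. \<eta> > 0 \<Longrightarrow> \<exists>d\<in>D. \<tau> x \<le> \<beta> d x + \<eta>" and \<delta>: "\<delta> > 0"
  obtains d where "d \<in> D" "\<And>x. \<bar>\<tau> x - \<beta> d x\<bar> \<le> \<delta> * snorm x"
proof -
  have bound: "\<tau> x \<le> R * snorm x" for x
  proof (rule field_le_epsilon)
    fix \<eta> :: real assume "\<eta> > 0"
    then obtain d where d: "d \<in> D" "\<tau> x \<le> \<beta> d x + \<eta>" using sup by blast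
    have "\<beta> d x \<le> snorm d * snorm x" using Cauchy_Schwarz[of d x] by simp
    also have "\<dots> \<le> R * snorm x" using D(2)[OF d(1)] by (intro mult_right_mono) auto
    finally show "\<tau> x \<le> R * snorm x + \<eta>" using d by simp
  qed
  \<comment> \<open>Budget for \<delta>: one share for replacing \<tau> by \<open>w\<close>, two for
    the distance from \<open>w\<close> to the chosen point of \<open>D\<close>.\<close>
  define \<kappa> where "\<kappa> = \<delta> / 3"
  have \<kappa>: "\<kappa> > 0" using \<delta> by (simp add: \<kappa>_def)
  obtain w where w: "\<And>x. \<bar>\<tau> x - \<beta> w x\<bar> \<le> \<kappa> * snorm x"
    using approximate_Riesz[OF add scale bound \<kappa>] by blast
  have ne: "D \<noteq> {}" using sup[of 1] by auto
  define m where "m = (INF d\<in>D. snorm (w - d))"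
  have bdd: "bdd_below ((\<lambda>d. snorm (w - d)) ` D)" by (rule bdd_belowI2[of _ 0]) simp
  have m_le: "m \<le> snorm (w - d)" if "d \<in> D" for d
    unfolding m_def by (rule cINF_lower[OF bdd that])
  have m0: "0 \<le> m" unfolding m_def using ne by (intro cINF_greatest) auto
  have near: "\<exists>d\<in>D. snorm (w - d) < m + e" if "e > 0" for e
    using cINF_less_iff[OF ne bdd, of "m + e"] that by (auto simp: m_def)
  \<comment> \<open>If the distance exceeded \<kappa>, then \<open>sup\<close> in the direction x =
    w - d would give a point d' of \<open>D\<close> for which \<beta> (d' - d) x is at least (snorm
    x)^2 - \<kappa> snorm x - \<theta>. A step of proportion \<theta> from d towards d' would come
    closer to \<open>w\<close> than the infimum m.\<close>
  have "m \<le> \<kappa>"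
  proof (rule ccontr)
    assume "\<not> m \<le> \<kappa>"
    then have mk: "m > \<kappa>" by simp
    \<comment> \<open>\<open>L\<close> collects the second-order terms in \<theta>: 2 m + 1 from (m
      + \<theta>^2)^2, 4 R^2 from the length of d' - d, and 2 from the slack \<theta> in the choice
      of d'.\<close>
    define L where "L = 3 + 2 * m + 4 * R\<^sup>2"
    have Lpos: "L > 0" unfolding L_def using m0 by (intro add_pos_nonneg) auto
    define \<theta> where "\<theta> = min 1 (m * (m - \<kappa>) / L)"
    have \<theta>: "0 < \<theta>" "\<theta> \<le> 1" "\<theta> * L \<le> m * (m - \<kappa>)"
      using Lpos mk \<kappa> by (auto simp: \<theta>_def min_def field_simps)
    obtain d where d: "d \<in> D" "snorm (w - d) < m + \<theta>\<^sup>2" using near[of "\<theta>\<^sup>2"] \<theta> by auto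
    define x where "x = w - d"
    obtain d' where d': "d' \<in> D" "\<tau> x \<le> \<beta> d' x + \<theta>" using sup \<theta>(1) by blast
    define e where "e = d' - d"
    have "(1 - \<theta>) *\<^sub>R d + \<theta> *\<^sub>R d' \<in> D"
      using D(1) d d' \<theta> by (intro convexD) auto
    moreover have "w - ((1 - \<theta>) *\<^sub>R d + \<theta> *\<^sub>R d') = x - \<theta> *\<^sub>R e"
      by (simp add: x_def e_def algebra_simps)
    ultimately have "m \<le> snorm (x - \<theta> *\<^sub>R e)" using m_le by metis
    then have "m\<^sup>2 \<le> (snorm (x - \<theta> *\<^sub>R e))\<^sup>2" using m0 by (intro power_mono)
    also have "\<dots> = \<beta> x x - 2 * \<theta> * \<beta> e x + \<theta>\<^sup>2 * \<beta> e e"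
      unfolding snorm_square using commute[of x e]
      by (simp add: diff_left diff_right scale_left scale_right power2_eq_square algebra_simps)
    also have "\<beta> e e \<le> 4 * R\<^sup>2"
    proof -
      have "\<beta> e e = \<beta> d' d' - 2 * \<beta> d' d + \<beta> d d"
        unfolding e_def using commute[of d d'] by (simp add: diff_left diff_right)
      moreover have "\<bar>\<beta> a b\<bar> \<le> R\<^sup>2" if "a \<in> D" "b \<in> D" for a b
        using order_trans[OF Cauchy_Schwarz mult_mono[OF D(2)[OF that(1)] D(2)[OF that(2)]]]
          order_trans[OF snorm_nonneg D(2)[OF that(1)]] by (simp add: power2_eq_square)
      then have "\<beta> d' d' \<le> R\<^sup>2" "\<beta> d d \<le> R\<^sup>2" "- \<beta> d' d \<le> R\<^sup>2"
        using d(1) d'(1) by (metis abs_le_D1 abs_le_D2)+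
      ultimately show ?thesis by simp
    qed
    finally have 1: "m\<^sup>2 \<le> (snorm x)\<^sup>2 - 2 * \<theta> * \<beta> e x + \<theta>\<^sup>2 * (4 * R\<^sup>2)"
      using \<theta> by (simp add: mult_left_mono snorm_square)
    have "(snorm x)\<^sup>2 - \<kappa> * snorm x - \<theta> \<le> \<beta> e x"
    proof -
      have "\<beta> e x = \<beta> d' x - \<beta> d x" by (simp add: e_def diff_left)
      moreover have "(snorm x)\<^sup>2 = \<beta> w x - \<beta> d x" unfolding snorm_square
        by (simp add: x_def diff_left)
      ultimately show ?thesis using d'(2) w[of x] by (simp add: abs_le_iff)
    qed
    then have "2 * \<theta> * ((snorm x)\<^sup>2 - \<kappa> * snorm x - \<theta>) \<le> 2 * \<theta> * \<beta> e x"
      using \<theta> by (intro mult_left_mono) auto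
    moreover have "(snorm x)\<^sup>2 \<le> m\<^sup>2 + \<theta>\<^sup>2 * (2 * m + 1)"
    proof -
      have "\<theta>\<^sup>2 \<le> 1" using \<theta> by (simp add: power_le_one)
      then have "\<theta>\<^sup>2 * \<theta>\<^sup>2 \<le> \<theta>\<^sup>2 * 1" by (intro mult_left_mono) auto
      moreover have "(snorm x)\<^sup>2 \<le> (m + \<theta>\<^sup>2)\<^sup>2" using d(2) by (intro power_mono) (auto simp: x_def)
      ultimately show ?thesis by (simp add: power2_sum algebra_simps power2_eq_square)
    qed
    ultimately have "2 * \<theta> * ((snorm x)\<^sup>2 - \<kappa> * snorm x - \<theta>) \<le> \<theta>\<^sup>2 * (2 * m + 1 + 4 * R\<^sup>2)"
      using 1 by (simp add: algebra_simps)
    then have "\<theta> * (2 * ((snorm x)\<^sup>2 - \<kappa> * snorm x)) \<le> \<theta> * (\<theta> * L)"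
      by (simp add: L_def algebra_simps power2_eq_square)
    then have "2 * ((snorm x)\<^sup>2 - \<kappa> * snorm x) \<le> m * (m - \<kappa>)"
      using \<theta> by simp
    moreover have "m * (m - \<kappa>) \<le> snorm x * (snorm x - \<kappa>)"
      using m_le[OF d(1)] m0 mk unfolding x_def by (intro mult_mono) auto
    moreover have "0 < m * (m - \<kappa>)" using mk \<kappa> by (intro mult_pos_pos) auto
    ultimately show False by (simp add: power2_eq_square algebra_simps)
  qed
  then obtain d where d: "d \<in> D" "snorm (w - d) < 2 * \<kappa>" using near[of \<kappa>] \<kappa> by fastforce
  show ?thesis
  proof (rule that[OF d(1)])
    fix x
    have "\<bar>\<beta> (w - d) x\<bar> \<le> snorm (w - d) * snorm x" by (rule Cauchy_Schwarz)
    also have "\<dots> \<le> 2 * \<kappa> * snorm x" using d(2) by (intro mult_right_mono) auto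
    finally have "\<bar>\<beta> w x - \<beta> d x\<bar> \<le> 2 * (\<kappa> * snorm x)" by (simp add: diff_left)
    moreover have "\<delta> * snorm x = 3 * (\<kappa> * snorm x)" by (simp add: \<kappa>_def)
    ultimately show "\<bar>\<tau> x - \<beta> d x\<bar> \<le> \<delta> * snorm x" using w[of x] by linarith
  qed
qed

end

section \<open>Dominating functionals\<close>

instantiation "fun" :: (type, real_vector) real_vector
begin
definition scaleR_fun :: "real \<Rightarrow> ('a \<Rightarrow> 'b) \<Rightarrow> 'a \<Rightarrow> 'b" where "scaleR_fun r f = (\<lambda>x. r *\<^sub>R f x)"
instance by standard (auto simp: scaleR_fun_def fun_eq_iff scaleR_add_right scaleR_add_left)
end

lemma bounded_clinear_add: "bounded_clinear \<phi> \<Longrightarrow> \<phi> (x + y) = \<phi> x + \<phi> y"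
  by (simp add: bounded_clinear_def linear_simps)

lemma bounded_clinear_scaleC: "bounded_clinear \<phi> \<Longrightarrow> \<phi> (c *\<^sub>C x) = c *\<^sub>C \<phi> x"
  by (simp add: bounded_clinear_def)

lemma bounded_clinear_scaleR: "bounded_clinear \<phi> \<Longrightarrow> \<phi> (r *\<^sub>R x) = r *\<^sub>R \<phi> x"
  by (simp add: bounded_clinear_def linear_simps)

lemma bounded_clinear_diff: "bounded_clinear \<phi> \<Longrightarrow> \<phi> (x - y) = \<phi> x - \<phi> y"
  by (simp add: bounded_clinear_def linear_simps)

lemma bounded_clinear_0: "bounded_clinear \<phi> \<Longrightarrow> \<phi> 0 = 0"
  by (simp add: bounded_clinear_def linear_simps)

lemma bounded_clinear_sum: "bounded_clinear \<phi> \<Longrightarrow> \<phi> (\<Sum>i\<in>I. f i) = (\<Sum>i\<in>I. \<phi> (f i))"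
  by (simp add: bounded_clinear_def bounded_linear.linear linear_sum)

definition dual_ball :: "('a::cbanach \<Rightarrow> complex) set" where
  "dual_ball = {\<phi>. bounded_clinear \<phi> \<and> onorm \<phi> \<le> 1}"

lemma dual_ball_linear: "\<phi> \<in> dual_ball \<Longrightarrow> bounded_clinear \<phi>"
  by (simp add: dual_ball_def)

lemma dual_ball_le: "\<phi> \<in> dual_ball \<Longrightarrow> cmod (\<phi> x) \<le> norm x"
  using onorm[of \<phi> x] mult_right_mono[of "onorm \<phi>" 1 "norm x"]
  by (simp add: dual_ball_def bounded_clinear_def)

lemma zero_in_dual_ball: "(\<lambda>_. 0) \<in> dual_ball"
  by (simp add: dual_ball_def bounded_clinear_zero onorm_zero)

text \<open>Functions are compared on the dual ball only; their values elsewhere are irrelevant.\<close>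

definition dual_bounded :: "(('a::cbanach \<Rightarrow> complex) \<Rightarrow> real) set" where
  "dual_bounded = {g. \<exists>b. \<forall>\<phi>\<in>dual_ball. \<bar>g \<phi>\<bar> \<le> b}"

lemma dual_boundedI: "(\<And>\<phi>. \<phi> \<in> dual_ball \<Longrightarrow> \<bar>g \<phi>\<bar> \<le> b) \<Longrightarrow> g \<in> dual_bounded"
  unfolding dual_bounded_def by blast

lemma subspace_dual_bounded: "subspace dual_bounded"
  unfolding subspace_def
proof (intro conjI ballI allI)
  show "0 \<in> dual_bounded" by (rule dual_boundedI[of _ 0]) simp
  fix f g :: "('a \<Rightarrow> complex) \<Rightarrow> real" and r :: real
  assume "f \<in> dual_bounded"
  then obtain b where b: "\<And>\<phi>. \<phi> \<in> dual_ball \<Longrightarrow> \<bar>f \<phi>\<bar> \<le> b" unfolding dual_bounded_def by blast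
  show "r *\<^sub>R f \<in> dual_bounded"
    by (rule dual_boundedI[of _ "\<bar>r\<bar> * b"]) (simp add: scaleR_fun_def abs_mult mult_left_mono b)
  assume "g \<in> dual_bounded"
  then obtain c where c: "\<And>\<phi>. \<phi> \<in> dual_ball \<Longrightarrow> \<bar>g \<phi>\<bar> \<le> c" unfolding dual_bounded_def by blast
  show "f + g \<in> dual_bounded"
  proof (rule dual_boundedI[of _ "b + c"])
    fix \<phi> :: "'a \<Rightarrow> complex" assume "\<phi> \<in> dual_ball"
    then show "\<bar>(f + g) \<phi>\<bar> \<le> b + c"
      using b[of \<phi>] c[of \<phi>] abs_triangle_ineq[of "f \<phi>" "g \<phi>"] by simp
  qed
qed

lemmas dual_bounded_add = subspace_add[OF subspace_dual_bounded]
  and dual_bounded_scaleR = subspace_scale[OF subspace_dual_bounded]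
  and dual_bounded_0 = subspace_0[OF subspace_dual_bounded]

lemma bdd_above_dual_bounded: "g \<in> dual_bounded \<Longrightarrow> bdd_above (g ` dual_ball)"
  unfolding dual_bounded_def by (force intro: bdd_aboveI2 dest: abs_le_D1)

lemma weak_l1_norm_eq: "weak_l1_norm n e = (SUP \<phi>\<in>dual_ball. \<Sum>i<n. cmod (\<phi> (e i)))"
  unfolding weak_l1_norm_def dual_ball_def by (rule arg_cong[where f = Sup]) auto

text \<open>
  Pietsch domination. The dominating measure on the dual ball is only needed as a positive
  functional on bounded functions, so no topology on the dual ball is involved.
\<close>

locale dominating_mean =
  fixes C :: real and M :: "(('a::cbanach \<Rightarrow> complex) \<Rightarrow> real) \<Rightarrow> real"
  assumes C_nonneg: "C \<ge> 0"
    and M_add: "f \<in> dual_bounded \<Longrightarrow> g \<in> dual_bounded \<Longrightarrow> M (f + g) = M f + M g"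
    and M_scale: "g \<in> dual_bounded \<Longrightarrow> M (r *\<^sub>R g) = r * M g"
    and M_le: "g \<in> dual_bounded \<Longrightarrow> (\<And>\<phi>. \<phi> \<in> dual_ball \<Longrightarrow> g \<phi> \<le> b) \<Longrightarrow> M g \<le> C * b"

lemma Pietsch_domination:
  fixes T :: "'a::cbanach \<Rightarrow> 'b::cbanach"
  assumes T: "absolutely_summing T"
  obtains M where "dominating_mean (pi1_norm T) M"
    "\<And>x. norm (T x) \<le> M (\<lambda>\<phi>. cmod (\<phi> x))"
proof -
  define C where "C = pi1_norm T"
  have C: "0 \<le> C" "\<And>n e. (\<Sum>i<n. norm (T (e i))) \<le> C * weak_l1_norm n e"
    using pi1_norm_least(1)[OF T] unfolding C_def summing_bounds_def by auto
  have Tl: "bounded_clinear T" using T by (simp add: absolutely_summing_def)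
  define p where "p g = C * (SUP \<phi>\<in>dual_ball. g \<phi>)" for g :: "('a \<Rightarrow> complex) \<Rightarrow> real"
  have ne: "dual_ball \<noteq> ({} :: ('a \<Rightarrow> complex) set)" using zero_in_dual_ball by blast
  have p: "sublinear_on dual_bounded p"
  proof (rule sublinear_onI[OF subspace_dual_bounded])
    fix f g :: "('a \<Rightarrow> complex) \<Rightarrow> real" and r :: real
    assume f: "f \<in> dual_bounded"
    note upper = cSUP_upper[OF _ bdd_above_dual_bounded]
    show "p (r *\<^sub>R f) \<le> r * p f" if r: "0 < r"
    proof -
      have "(SUP \<phi>\<in>dual_ball. (r *\<^sub>R f) \<phi>) \<le> r * (SUP \<phi>\<in>dual_ball. f \<phi>)"
        using r upper[OF _ f] by (intro cSUP_least[OF ne]) (simp add: scaleR_fun_def)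
      then show ?thesis using C(1) mult_left_mono by (fastforce simp: p_def mult.left_commute)
    qed
    assume g: "g \<in> dual_bounded"
    have "(SUP \<phi>\<in>dual_ball. (f + g) \<phi>) \<le> (SUP \<phi>\<in>dual_ball. f \<phi>) + (SUP \<phi>\<in>dual_ball. g \<phi>)"
      by (intro cSUP_least[OF ne]) (simp add: add_mono upper f g)
    then show "p (f + g) \<le> p f + p g" using C(1) by (simp add: p_def mult_left_mono flip: distrib_left)
  next
    show "p 0 = 0" using ne by (simp add: p_def)
  qed
  \<comment> \<open>Concatenation of sequences makes these pairs a cone, and their lying below
    \<open>p\<close> is exactly the summing inequality.\<close>
  define D where "D = {(g, s). \<exists>(n::nat) e. (\<forall>\<phi>\<in>dual_ball. g \<phi> = (\<Sum>i<n. cmod (\<phi> (e i)))) \<and> s = (\<Sum>i<n. norm (T (e i)))}"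
  have DI: "(g, s) \<in> D" if "\<And>\<phi>. \<phi> \<in> dual_ball \<Longrightarrow> g \<phi> = (\<Sum>i<n. cmod (\<phi> (e i)))" "s = (\<Sum>i<n. norm (T (e i)))" for g s e and n :: nat
    unfolding D_def using that by (auto intro!: exI[of _ n] exI[of _ e])
  obtain M where M: "\<And>f g. f \<in> dual_bounded \<Longrightarrow> g \<in> dual_bounded \<Longrightarrow> M (f + g) = M f + M g"
    "\<And>g r. g \<in> dual_bounded \<Longrightarrow> M (r *\<^sub>R g) = r * M g" "\<And>g. g \<in> dual_bounded \<Longrightarrow> M g \<le> p g"
    "\<And>g s. (g, s) \<in> D \<Longrightarrow> s \<le> M g"
  proof (rule sublinear_on_sandwich[OF subspace_dual_bounded p, of D])
    fix g s assume "(g, s) \<in> D"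
    then obtain n :: nat and e where g: "\<And>\<phi>. \<phi> \<in> dual_ball \<Longrightarrow> g \<phi> = (\<Sum>i<n. cmod (\<phi> (e i)))"
      and s: "s = (\<Sum>i<n. norm (T (e i)))" unfolding D_def by blast
    have "g \<in> dual_bounded"
      by (rule dual_boundedI[of _ "\<Sum>i<n. norm (e i)"]) (simp add: g sum_nonneg sum_mono dual_ball_le)
    moreover have "(SUP \<phi>\<in>dual_ball. g \<phi>) = weak_l1_norm n e"
      unfolding weak_l1_norm_eq by (intro SUP_cong) (simp_all add: g)
    then have "s \<le> p g" using C(2)[where n = n and e = e] by (simp add: p_def s)
    ultimately show "g \<in> dual_bounded \<and> s \<le> p g" ..
  next
    show "(0, 0) \<in> D" by (rule DI[where n = 0]) simp_all
  next
    fix f s g t assume "(f, s) \<in> D" "(g, t) \<in> D"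
    then obtain n m :: nat and e d where f: "\<And>\<phi>. \<phi> \<in> dual_ball \<Longrightarrow> f \<phi> = (\<Sum>i<n. cmod (\<phi> (e i)))"
      and s: "s = (\<Sum>i<n. norm (T (e i)))" and g: "\<And>\<phi>. \<phi> \<in> dual_ball \<Longrightarrow> g \<phi> = (\<Sum>i<m. cmod (\<phi> (d i)))"
      and t: "t = (\<Sum>i<m. norm (T (d i)))" unfolding D_def by blast
    have split: "(\<Sum>i<n + (m::nat). h (if i < n then e i else d (i - n))) = (\<Sum>i<n. h (e i)) + (\<Sum>i<m. h (d i))"
      for h :: "'a \<Rightarrow> real" by (induction m) simp_all
    show "(f + g, s + t) \<in> D"
      by (rule DI[where n = "n + m" and e = "\<lambda>i. if i < n then e i else d (i - n)"])
        (simp_all only: split[of "\<lambda>x. cmod (_ x)"] split[of "\<lambda>x. norm (T x)"] plus_fun_apply f g s t)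
  next
    fix f s and r :: real assume D: "(f, s) \<in> D" and r: "r \<ge> 0"
    from D obtain n :: nat and e where f: "\<And>\<phi>. \<phi> \<in> dual_ball \<Longrightarrow> f \<phi> = (\<Sum>i<n. cmod (\<phi> (e i)))"
      and s: "s = (\<Sum>i<n. norm (T (e i)))" unfolding D_def by blast
    show "(r *\<^sub>R f, r * s) \<in> D"
      by (rule DI[where n = n and e = "\<lambda>i. r *\<^sub>R e i"])
        (simp_all add: r f s scaleR_fun_def bounded_clinear_scaleR[OF dual_ball_linear]
          bounded_clinear_scaleR[OF Tl] sum_distrib_left)
  qed blast
  show ?thesis
  proof (rule that[of M])
    show "dominating_mean (pi1_norm T) M"
    proof
      show "M g \<le> pi1_norm T * b" if "g \<in> dual_bounded" "\<And>\<phi>. \<phi> \<in> dual_ball \<Longrightarrow> g \<phi> \<le> b" for g b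
      proof -
        have "(SUP \<phi>\<in>dual_ball. g \<phi>) \<le> b" by (rule cSUP_least[OF ne that(2)])
        then have "p g \<le> pi1_norm T * b" using C(1) unfolding p_def C_def by (rule mult_left_mono)
        then show ?thesis using M(3)[OF that(1)] by simp
      qed
    qed (use M C in \<open>auto simp: C_def\<close>)
    show "norm (T x) \<le> M (\<lambda>\<phi>. cmod (\<phi> x))" for x
      by (rule M(4)) (rule DI[where n = 1 and e = "\<lambda>_. x"], simp_all)
  qed
qed

context dominating_mean
begin

abbreviation "absval x \<equiv> (\<lambda>\<phi>. cmod (\<phi> x))"

lemma absval_bounded: "absval x \<in> dual_bounded"
  by (rule dual_boundedI[of _ "norm x"]) (simp add: dual_ball_le)

text \<open>Positivity is the case b = 0 of \<open>M_le\<close>, applied to f - g.\<close>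

lemma M_mono:
  assumes "f \<in> dual_bounded" "g \<in> dual_bounded" "\<And>\<phi>. \<phi> \<in> dual_ball \<Longrightarrow> f \<phi> \<le> g \<phi>"
  shows "M f \<le> M g"
proof -
  have g: "(- 1) *\<^sub>R g \<in> dual_bounded" by (rule dual_bounded_scaleR[OF assms(2)])
  have "f + (- 1) *\<^sub>R g \<in> dual_bounded" by (rule dual_bounded_add[OF assms(1) g])
  moreover have "M (f + (- 1) *\<^sub>R g) = M f - M g"
    unfolding M_add[OF assms(1) g] M_scale[OF assms(2)] by simp
  moreover have "(f + (- 1) *\<^sub>R g) \<phi> \<le> 0" if "\<phi> \<in> dual_ball" for \<phi>
    using assms(3)[OF that] by (simp add: scaleR_fun_def)
  ultimately show ?thesis using M_le[of "f + (- 1) *\<^sub>R g" 0] by simp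
qed

lemma dual_bounded_sum: "(\<And>i. i \<in> I \<Longrightarrow> f i \<in> dual_bounded) \<Longrightarrow> (\<Sum>i\<in>I. f i) \<in> dual_bounded"
  by (rule subspace_sum[OF subspace_dual_bounded])

lemma M_0: "M 0 = 0"
  using M_scale[OF dual_bounded_0, of 0] by simp

lemma M_sum: "(\<And>i. i \<in> I \<Longrightarrow> f i \<in> dual_bounded) \<Longrightarrow> M (\<Sum>i\<in>I. f i) = (\<Sum>i\<in>I. M (f i))"
proof (induction I rule: infinite_finite_induct)
  case (insert i I)
  then show ?case using M_add[of "f i" "\<Sum>i\<in>I. f i"] dual_bounded_sum[of I f]
    by (simp del: plus_fun_apply)
qed (simp_all add: M_0)

end

section \<open>The functional and the form on a C*-algebra\<close>

text \<open>A convex combination of m + z and m - z with weights (1 + r) / 2 and (1 - r) /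
  2.\<close>

lemma sum_squares_scaled_interval:
  fixes z :: "'a::cstar_algebra"
  assumes plus: "m + emb z \<in> sum_squares" and minus: "m - emb z \<in> sum_squares" and r: "\<bar>r\<bar> \<le> 1"
  shows "m + emb (r *\<^sub>R z) \<in> sum_squares"
proof -
  have "((1 + r) / 2) *\<^sub>R (m + emb z) + ((1 - r) / 2) *\<^sub>R (m - emb z) \<in> sum_squares"
    using r by (intro sum_squares_add sum_squares_scaleR plus minus) (auto simp: abs_le_iff)
  also have "((1 + r) / 2) *\<^sub>R (m + emb z) + ((1 - r) / 2) *\<^sub>R (m - emb z)
      = ((1 + r) / 2 + (1 - r) / 2) *\<^sub>R m + ((1 + r) / 2 - (1 - r) / 2) *\<^sub>R emb z"
    unfolding scaleR_add_right scaleR_diff_right scaleR_add_left scaleR_diff_left by simp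
  also have "(1 + r) / 2 + (1 - r) / 2 = 1" by (simp add: field_simps)
  also have "(1 + r) / 2 - (1 - r) / 2 = r" by (simp add: field_simps)
  finally show ?thesis by (simp add: embed_simps)
qed


locale cstar_dominating_mean = dominating_mean C M
  for C :: real and M :: "(('a::cstar_algebra \<Rightarrow> complex) \<Rightarrow> real) \<Rightarrow> real"
begin

text \<open>Sandwich theorem for the pairs (m, M g), where at each \<phi> the value of g is Re
  \<phi> (a + i b) with a and b between -m and m. Letting a and b depend on \<phi> admits g =
  |\<phi> z|, which equals Re \<phi> (c z) for a phase c depending on \<phi>, and the pairs still
  form a cone. The two parts cost norm a + norm b <= 2 norm m; this is the 2 in 2 C.\<close>

lemma dominating_positive_functional:
  obtains f :: "'a unitization \<Rightarrow> real" where
    "\<And>X Y. f (X + Y) = f X + f Y" "\<And>r X. f (r *\<^sub>R X) = r * f X"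
    "\<And>X. f (star X) = f X" "\<And>X. f X \<le> 2 * C * norm X"
    "\<And>X. X \<in> sum_squares \<Longrightarrow> 0 \<le> f X"
    "\<And>m z. m + emb z \<in> sum_squares \<Longrightarrow> m - emb z \<in> sum_squares \<Longrightarrow> M (absval z) \<le> f m"
proof -
  define E where "E m g \<phi> \<longleftrightarrow> (\<exists>a b. m + emb a \<in> sum_squares \<and> m - emb a \<in> sum_squares \<and>
    m + emb b \<in> sum_squares \<and> m - emb b \<in> sum_squares \<and> g = Re (\<phi> (a + \<i> *\<^sub>C b)))"
    for m and g :: real and \<phi> :: "'a \<Rightarrow> complex"
  have EI: "E m g \<phi>" if "m + emb a \<in> sum_squares" "m - emb a \<in> sum_squares"
    "m + emb b \<in> sum_squares" "m - emb b \<in> sum_squares" "g = Re (\<phi> (a + \<i> *\<^sub>C b))" for m a b g \<phi>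
    unfolding E_def using that by blast
  define D where "D = {(m, s). \<exists>g. g \<in> dual_bounded \<and> (\<forall>\<phi>\<in>dual_ball. E m (g \<phi>) \<phi>) \<and> s = M g}"
  have E_le: "g \<le> 2 * norm m" if "E m g \<phi>" and \<phi>: "\<phi> \<in> dual_ball" for m g \<phi>
  proof -
    obtain a b where ab: "m + emb a \<in> sum_squares" "m - emb a \<in> sum_squares"
      "m + emb b \<in> sum_squares" "m - emb b \<in> sum_squares" and g: "g = Re (\<phi> (a + \<i> *\<^sub>C b))"
      using \<open>E m g \<phi>\<close> unfolding E_def by blast
    have "g \<le> cmod (\<phi> (a + \<i> *\<^sub>C b))" unfolding g by (rule complex_Re_le_cmod)
    also have "\<dots> \<le> norm (a + \<i> *\<^sub>C b)" by (rule dual_ball_le[OF \<phi>])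
    also have "\<dots> \<le> norm (emb a) + norm (emb b)"
      using norm_triangle_ineq[of a "\<i> *\<^sub>C b"] by (simp add: norm_scaleC)
    also have "\<dots> \<le> 2 * norm m"
      using norm_le_of_sum_squares[OF ab(1,2)] norm_le_of_sum_squares[OF ab(3,4)] by simp
    finally show ?thesis .
  qed
  have p: "sublinear_on UNIV (\<lambda>X :: 'a unitization. 2 * C * norm X)"
    unfolding sublinear_on_def
    using mult_left_mono[OF norm_triangle_ineq] C_nonneg by (auto simp: distrib_left[symmetric])
  obtain f where f: "\<And>X Y :: 'a unitization. f (X + Y) = f X + f Y" "\<And>X r. f (r *\<^sub>R X) = r * f X"
    "\<And>X. f X \<le> 2 * C * norm X" "\<And>m s. (m, s) \<in> D \<Longrightarrow> s \<le> f m"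
  proof (rule sublinear_on_sandwich[OF subspace_UNIV p, of D])
    fix m s assume "(m, s) \<in> D"
    then obtain g where g: "g \<in> dual_bounded" "\<And>\<phi>. \<phi> \<in> dual_ball \<Longrightarrow> E m (g \<phi>) \<phi>" "s = M g"
      unfolding D_def by blast
    have "s \<le> C * (2 * norm m)" unfolding g(3) using E_le g(2) by (intro M_le g(1)) blast
    then show "m \<in> UNIV \<and> s \<le> 2 * C * norm m" by simp
  next
    have "E 0 (0 \<phi>) \<phi>" if "\<phi> \<in> dual_ball" for \<phi>
      using bounded_clinear_0[OF dual_ball_linear[OF that]]
      by (intro EI[where a = 0 and b = 0]) (simp_all add: embed_simps sum_squares.zero)
    then show "(0, 0) \<in> D" unfolding D_def using dual_bounded_0 M_0 by (auto intro!: exI[of _ 0])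
  next
    fix m s n t assume "(m, s) \<in> D" "(n, t) \<in> D"
    then obtain g h where g: "g \<in> dual_bounded" "\<And>\<phi>. \<phi> \<in> dual_ball \<Longrightarrow> E m (g \<phi>) \<phi>" "s = M g"
      and h: "h \<in> dual_bounded" "\<And>\<phi>. \<phi> \<in> dual_ball \<Longrightarrow> E n (h \<phi>) \<phi>" "t = M h"
      unfolding D_def by blast
    have "E (m + n) ((g + h) \<phi>) \<phi>" if \<phi>: "\<phi> \<in> dual_ball" for \<phi>
    proof -
      obtain a b where ab: "m + emb a \<in> sum_squares" "m - emb a \<in> sum_squares"
        "m + emb b \<in> sum_squares" "m - emb b \<in> sum_squares" "g \<phi> = Re (\<phi> (a + \<i> *\<^sub>C b))"
        using g(2)[OF \<phi>] unfolding E_def by blast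
      obtain c d where cd: "n + emb c \<in> sum_squares" "n - emb c \<in> sum_squares"
        "n + emb d \<in> sum_squares" "n - emb d \<in> sum_squares" "h \<phi> = Re (\<phi> (c + \<i> *\<^sub>C d))"
        using h(2)[OF \<phi>] unfolding E_def by blast
      have eq: "(m + n) + emb (x + y) = (m + emb x) + (n + emb y)"
        "(m + n) - emb (x + y) = (m - emb x) + (n - emb y)" for x y
        by (simp_all add: embed_simps algebra_simps)
      have "(a + c) + \<i> *\<^sub>C (b + d) = (a + \<i> *\<^sub>C b) + (c + \<i> *\<^sub>C d)"
        by (simp add: scaleC_add_right algebra_simps)
      then have "(g + h) \<phi> = Re (\<phi> ((a + c) + \<i> *\<^sub>C (b + d)))"
        using ab(5) cd(5) bounded_clinear_add[OF dual_ball_linear[OF \<phi>]] by simp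
      then show ?thesis
        by (intro EI[where a = "a + c" and b = "b + d"]) (simp_all only: eq sum_squares_add ab cd)
    qed
    moreover have "s + t = M (g + h)" using M_add[OF g(1) h(1)] g(3) h(3) by simp
    ultimately show "(m + n, s + t) \<in> D"
      unfolding D_def using dual_bounded_add[OF g(1) h(1)] by blast
  next
    fix m s and r :: real assume "(m, s) \<in> D" and r: "r \<ge> 0"
    then obtain g where g: "g \<in> dual_bounded" "\<And>\<phi>. \<phi> \<in> dual_ball \<Longrightarrow> E m (g \<phi>) \<phi>" "s = M g"
      unfolding D_def by blast
    have "E (r *\<^sub>R m) ((r *\<^sub>R g) \<phi>) \<phi>" if \<phi>: "\<phi> \<in> dual_ball" for \<phi>
    proof -
      obtain a b where ab: "m + emb a \<in> sum_squares" "m - emb a \<in> sum_squares"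
        "m + emb b \<in> sum_squares" "m - emb b \<in> sum_squares" "g \<phi> = Re (\<phi> (a + \<i> *\<^sub>C b))"
        using g(2)[OF \<phi>] unfolding E_def by blast
      have eq: "r *\<^sub>R m + emb (r *\<^sub>R x) = r *\<^sub>R (m + emb x)" "r *\<^sub>R m - emb (r *\<^sub>R x) = r *\<^sub>R (m - emb x)" for x
        by (simp_all add: embed_simps algebra_simps)
      have "r *\<^sub>R a + \<i> *\<^sub>C (r *\<^sub>R b) = r *\<^sub>R (a + \<i> *\<^sub>C b)" by (simp add: scaleC_scaleR scaleR_add_right)
      then have "(r *\<^sub>R g) \<phi> = Re (\<phi> (r *\<^sub>R a + \<i> *\<^sub>C (r *\<^sub>R b)))"
        using ab(5) bounded_clinear_scaleR[OF dual_ball_linear[OF \<phi>]] by (simp add: scaleR_fun_def)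
      then show ?thesis
        by (intro EI[where a = "r *\<^sub>R a" and b = "r *\<^sub>R b"]) (simp_all only: eq sum_squares_scaleR ab r)
    qed
    moreover have "r * s = M (r *\<^sub>R g)" using M_scale[OF g(1)] g(3) by simp
    ultimately show "(r *\<^sub>R m, r * s) \<in> D"
      unfolding D_def using dual_bounded_scaleR[OF g(1)] by blast
  qed blast
  have f_pos: "0 \<le> f X" if X: "X \<in> sum_squares" for X
  proof (rule f(4))
    have "E X (0 \<phi>) \<phi>" if "\<phi> \<in> dual_ball" for \<phi>
      using bounded_clinear_0[OF dual_ball_linear[OF that]] X
      by (intro EI[where a = 0 and b = 0]) (simp_all add: embed_simps)
    then show "(X, 0) \<in> D" unfolding D_def using dual_bounded_0 M_0 by (auto intro!: exI[of _ 0])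
  qed
  have f_dom: "M (absval z) \<le> f m" if z: "m + emb z \<in> sum_squares" "m - emb z \<in> sum_squares" for m z
  proof (rule f(4))
    have z': "m + emb (r *\<^sub>R z) \<in> sum_squares" "m - emb (r *\<^sub>R z) \<in> sum_squares" if "\<bar>r\<bar> \<le> 1" for r
      using sum_squares_scaled_interval[OF z that] sum_squares_scaled_interval[OF z, of "- r"] that
      by (simp_all add: embed_simps)
    have "E m (cmod (\<phi> z)) \<phi>" if \<phi>: "\<phi> \<in> dual_ball" for \<phi>
    proof -
      \<comment> \<open>The phase is split as c = Re c + i Im c with coefficients in [-1, 1], so
        that both parts of c z stay between -m and m.\<close>
      obtain c where c: "cmod c = 1" "c * \<phi> z = complex_of_real (cmod (\<phi> z))" by (rule unimodular_phase)
      have r: "\<bar>Re c\<bar> \<le> 1" "\<bar>Im c\<bar> \<le> 1"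
        using c(1) abs_Re_le_cmod[of c] abs_Im_le_cmod[of c] by linarith+
      have "Re c *\<^sub>R z + \<i> *\<^sub>C (Im c *\<^sub>R z) = c *\<^sub>C z"
        unfolding scaleC_of_real[symmetric] scaleC_scaleC scaleC_add_left[symmetric]
        by (simp flip: complex_eq)
      with c(2) have "cmod (\<phi> z) = Re (\<phi> (Re c *\<^sub>R z + \<i> *\<^sub>C (Im c *\<^sub>R z)))"
        using bounded_clinear_scaleC[OF dual_ball_linear[OF \<phi>]] by (simp add: scaleC_complex_def)
      then show ?thesis by (rule EI[OF z'[OF r(1)] z'[OF r(2)]])
    qed
    then show "(m, M (absval z)) \<in> D" unfolding D_def using absval_bounded by blast
  qed
  \<comment> \<open>Averaging over \<open>star\<close> gives invariance and leaves the values at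
    self-adjoint elements, in particular on the cone, unchanged.\<close>
  define h where "h X = (f X + f (star X)) / 2" for X
  show ?thesis
  proof (rule that[of h])
    show "h (X + Y) = h X + h Y" "h (r *\<^sub>R X) = r * h X" "h (star X) = h X" for X Y r
      by (simp_all add: h_def f star_add star_scaleR star_star field_simps)
    show "h X \<le> 2 * C * norm X" for X using f(3)[of X] f(3)[of "star X"] by (simp add: h_def)
    show "0 \<le> h X" if "X \<in> sum_squares" for X
      using f_pos[OF that] star_sum_squares[OF that] by (simp add: h_def)
    show "M (absval z) \<le> h m" if z: "m + emb z \<in> sum_squares" "m - emb z \<in> sum_squares" for m z
    proof -
      have "(m + emb z) + (m - emb z) = 2 *\<^sub>R m" by (simp add: scaleR_2)
      then have "star (2 *\<^sub>R m) = 2 *\<^sub>R m" using star_sum_squares[OF sum_squares_add[OF z]] by simp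
      then have "star m = m" by (simp add: star_scaleR)
      then show ?thesis using f_dom[OF z] by (simp add: h_def)
    qed
  qed
qed

text \<open>
  The linear Radon-Nikodym idea of Sakai: testing the form against a smoothed sign of a
  self-adjoint element recovers the dominating functional on its absolute value.
\<close>

lemma dominating_form:
  obtains \<beta> :: "'a \<Rightarrow> 'a \<Rightarrow> real" where "semi_inner \<beta>"
    "\<And>c x y. \<beta> (c *\<^sub>C x) y = \<beta> x (cnj c *\<^sub>C y)" "\<And>x. \<beta> x x \<le> 2 * C * (norm x)\<^sup>2"
    "\<And>x \<delta>. \<delta> > 0 \<Longrightarrow> \<exists>v. norm v \<le> 2 \<and> M (absval x) \<le> \<beta> v x + \<delta>"
proof -
  obtain f :: "'a unitization \<Rightarrow> real" where f_add: "\<And>X Y. f (X + Y) = f X + f Y"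
    and f_scale: "\<And>r X. f (r *\<^sub>R X) = r * f X"
    and f_star: "\<And>X. f (star X) = f X" and f_le: "\<And>X. f X \<le> 2 * C * norm X"
    and f_pos: "\<And>X. X \<in> sum_squares \<Longrightarrow> 0 \<le> f X"
    and f_dom: "\<And>m z. m + emb z \<in> sum_squares \<Longrightarrow> m - emb z \<in> sum_squares \<Longrightarrow> M (absval z) \<le> f m"
    using dominating_positive_functional by blast
  have f_minus: "f (- X) = - f X" for X using f_scale[of "-1" X] by simp
  define \<beta> where "\<beta> x y = f (emb (star y * x + x * star y)) / 2" for x y
  have sa_embed: "star x = x \<Longrightarrow> star (emb x) = emb x" for x :: 'a by (simp add: star_embed)
  interpret semi_inner \<beta>
  proof
    fix x y z :: 'a and r :: real
    show "\<beta> (x + y) z = \<beta> x z + \<beta> y z"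
      unfolding \<beta>_def by (simp add: embed_simps f_add distrib_left distrib_right field_simps)
    have "star z * (r *\<^sub>R x) + (r *\<^sub>R x) * star z = r *\<^sub>R (star z * x + x * star z)" for z
      by (simp add: scaleR_add_right)
    then show "\<beta> (r *\<^sub>R x) y = r * \<beta> x y"
      unfolding \<beta>_def by (simp only: embed_simps(6) f_scale times_divide_eq_right)
    have "star (star y * x + x * star y) = star x * y + y * star x"
      by (simp add: star_add star_mult star_star)
    then show "\<beta> x y = \<beta> y x" unfolding \<beta>_def by (metis f_star star_embed)
    \<comment> \<open>\<open>p\<close> is twice the real part of \<open>x\<close> and
      \<open>q\<close> is minus twice the imaginary part. As \<beta> averages both orders of
      multiplication, p^2 + q^2 becomes twice the element defining \<beta> x x.\<close>
    define p where "p = x + star x"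
    define q where "q = \<i> *\<^sub>C (x - star x)"
    have sp: "star p = p" and sq: "star q = q"
      by (simp_all add: p_def q_def star_add star_star star_scaleC star_diff scaleC_minus_left
          scaleC_diff_right add.commute)
    have "q * q = - ((x - star x) * (x - star x))"
      by (simp add: q_def scaleC_mult_left scaleC_mult_right scaleC_scaleC scaleC_minus_left)
    then have "p * p + q * q = 2 *\<^sub>R (star x * x + x * star x)"
      by (simp add: p_def scaleR_2 algebra_simps)
    then have "emb p * emb p + emb q * emb q = 2 *\<^sub>R emb (star x * x + x * star x)"
      by (metis embed_simps(2,5,6))
    then have "f (emb p * emb p + emb q * emb q) = 4 * \<beta> x x"
      unfolding \<beta>_def by (simp add: f_scale)
    moreover have "emb p * emb p + emb q * emb q \<in> sum_squares"
      by (intro sum_squares_add square_in_sum_squares sa_embed sp sq)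
    ultimately show "0 \<le> \<beta> x x" using f_pos by force
  qed
  have cx: "\<beta> (c *\<^sub>C x) y = \<beta> x (cnj c *\<^sub>C y)" for c x y
    by (simp add: \<beta>_def star_scaleC scaleC_mult_left scaleC_mult_right)
  have bound: "\<beta> x x \<le> 2 * C * (norm x)\<^sup>2" for x
  proof -
    have "f (emb (star x * x + x * star x)) \<le> 2 * C * norm (star x * x + x * star x)"
      using f_le[of "emb (star x * x + x * star x)"] by simp
    also have "norm (star x * x + x * star x) \<le> norm (star x * x) + norm (x * star x)"
      by (rule norm_triangle_ineq)
    also have "\<dots> = 2 * (norm x)\<^sup>2"
      using norm_star_mult_self[of x] norm_star_mult_self[of "star x"] by (simp add: star_star)
    finally show ?thesis using C_nonneg by (simp add: \<beta>_def mult_left_mono)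
  qed
  \<comment> \<open>Self-adjoint and skew elements are orthogonal: the symmetrized product
    \<open>y\<close> is skew, and f is invariant under \<open>star\<close>.\<close>
  have zero: "\<beta> u (\<i> *\<^sub>C w) = 0" if "star u = u" "star w = w" for u w
  proof -
    define y where "y = star (\<i> *\<^sub>C w) * u + u * star (\<i> *\<^sub>C w)"
    have "star y = - y" using that
      by (simp add: y_def star_add star_diff star_minus star_mult star_scaleC scaleC_mult_left
          scaleC_mult_right scaleC_minus_left)
    then have "f (emb y) = - f (emb y)" using f_star[of "emb y"] f_minus[of "emb y"]
      by (simp add: star_embed embed_simps)
    then show ?thesis by (simp add: \<beta>_def y_def)
  qed
  \<comment> \<open>\<open>v\<close> is the smoothed sign a q. Then \<beta> v a = f (a q a) differs
    by at most 2 C d from f m, which dominates M |a|.\<close>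
  have sa: "\<exists>v. star v = v \<and> norm v \<le> 1 \<and> M (absval a) \<le> \<beta> v a + \<delta>" if a: "star a = a" and \<delta>: "\<delta> > 0" for a \<delta>
  proof -
    define d where "d = \<delta> / (2 * C + 1)"
    have d: "d > 0" "2 * C * d \<le> \<delta>" using \<delta> C_nonneg by (auto simp: d_def field_simps)
    obtain q m where qm: "star q = q" "q * emb a = emb a * q" "norm (emb a * q) \<le> 1"
      "m + emb a \<in> sum_squares" "m - emb a \<in> sum_squares" "norm (m - emb a * q * emb a) \<le> d"
      using smoothed_absolute_value[OF sa_embed[OF a] d(1)] by blast
    \<comment> \<open>A product with \<open>emb a\<close> has scalar part 0, so the smoothed sign
      lies in the algebra itself.\<close>
    define v where "v = upart (emb a * q)"
    have v: "emb v = emb a * q" by (rule unitization_eqI) (simp_all add: v_def)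
    have "emb (star v) = emb v"
      using v qm(1,2) by (simp flip: star_embed add: star_mult sa_embed[OF a])
    then have sv: "star v = v" by (metis unitize_simps(1))
    have "emb (v * a) = emb a * q * emb a" "emb (a * v) = emb a * q * emb a"
      using qm(2) by (simp_all add: embed_simps v mult.assoc)
    then have \<beta>v: "\<beta> v a = f (emb a * q * emb a)"
      by (simp add: \<beta>_def a embed_simps f_add flip: embed_simps(5))
    have "m = emb a * q * emb a + (m - emb a * q * emb a)" by simp
    then have "f m = \<beta> v a + f (m - emb a * q * emb a)" unfolding \<beta>v by (metis f_add)
    moreover have "f (m - emb a * q * emb a) \<le> 2 * C * d"
      using f_le[of "m - emb a * q * emb a"] mult_left_mono[OF qm(6), of "2 * C"] C_nonneg by simp
    ultimately have "M (absval a) \<le> \<beta> v a + \<delta>" using f_dom[OF qm(4,5)] d(2) by linarith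
    moreover have "norm v \<le> 1" using qm(3) norm_embed[of v] v by simp
    ultimately show ?thesis using sv by blast
  qed
  \<comment> \<open>Real and imaginary part are tested separately. In \<beta> (v + i w) (a + i b)
    the mixed terms vanish by \<open>zero\<close>, and the two norms add up to 2.\<close>
  have "\<exists>v. norm v \<le> 2 \<and> M (absval x) \<le> \<beta> v x + \<delta>" if \<delta>: "\<delta> > 0" for x \<delta>
  proof -
    define a where "a = (1 / 2) *\<^sub>R (x + star x)"
    define b where "b = (- \<i> / 2) *\<^sub>C (x - star x)"
    have sab: "star a = a" "star b = b"
      by (simp_all add: a_def b_def star_add star_star star_scaleC star_diff star_scaleR add.commute
          scaleC_minus_left scaleC_diff_right)
    have x: "x = a + \<i> *\<^sub>C b"
    proof -
      have "\<i> *\<^sub>C b = (1 / 2) *\<^sub>R (x - star x)"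
        using scaleC_of_real[of "1 / 2" "x - star x"] by (simp add: b_def scaleC_scaleC)
      then show ?thesis by (simp add: a_def flip: scaleR_add_right)
    qed
    obtain v where v: "star v = v" "norm v \<le> 1" "M (absval a) \<le> \<beta> v a + \<delta> / 2"
      using sa[OF sab(1), of "\<delta> / 2"] \<delta> by auto
    obtain w where w: "star w = w" "norm w \<le> 1" "M (absval b) \<le> \<beta> w b + \<delta> / 2"
      using sa[OF sab(2), of "\<delta> / 2"] \<delta> by auto
    have "M (absval x) \<le> M (absval a + absval b)"
    proof (rule M_mono[OF absval_bounded dual_bounded_add[OF absval_bounded absval_bounded]])
      fix \<phi> :: "'a \<Rightarrow> complex" assume \<phi>: "\<phi> \<in> dual_ball"
      have "\<phi> x = \<phi> a + \<i> * \<phi> b"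
        unfolding x bounded_clinear_add[OF dual_ball_linear[OF \<phi>]]
          bounded_clinear_scaleC[OF dual_ball_linear[OF \<phi>]] by (simp add: scaleC_complex_def)
      then show "cmod (\<phi> x) \<le> (absval a + absval b) \<phi>"
        using norm_triangle_ineq[of "\<phi> a" "\<i> * \<phi> b"] by (simp add: norm_mult)
    qed
    also have "\<dots> = M (absval a) + M (absval b)" by (intro M_add absval_bounded)
    finally have le: "M (absval x) \<le> \<beta> v a + \<beta> w b + \<delta>" using v(3) w(3) by simp
    have "\<beta> (\<i> *\<^sub>C w) a = 0" using zero[OF sab(1) w(1)] commute by metis
    moreover have "\<beta> (\<i> *\<^sub>C w) (\<i> *\<^sub>C b) = \<beta> w b" by (simp add: cx scaleC_scaleC)
    ultimately have "\<beta> (v + \<i> *\<^sub>C w) x = \<beta> v a + \<beta> w b"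
      unfolding x by (simp add: add_left add_right zero[OF v(1) sab(2)])
    moreover have "norm (v + \<i> *\<^sub>C w) \<le> 2"
      using norm_triangle_ineq[of v "\<i> *\<^sub>C w"] v(2) w(2) by (simp add: norm_scaleC)
    ultimately show ?thesis using le by (intro exI[of _ "v + \<i> *\<^sub>C w"]) simp
  qed
  with cx bound show ?thesis by (intro that[of \<beta>] semi_inner_axioms) auto
qed

end

section \<open>Complex inner products\<close>

lemma cinner_add_right: "cinner x (y + z) = cinner x y + cinner x (z::'a::chilbert_space)"
  by (metis cinner_add_left cinner_commute complex_cnj_add)

lemma cinner_zero_left [simp]: "cinner 0 (y::'a::chilbert_space) = 0"
  using cinner_scaleC_left[of 0 0 y] by simp

lemma cinner_zero_right [simp]: "cinner (y::'a::chilbert_space) 0 = 0"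
  using cinner_scaleC_right[of y 0 0] by simp

lemma cinner_minus_left: "cinner (- x) y = - cinner x (y::'a::chilbert_space)"
  using cinner_add_left[of x "- x" y] by (simp add: eq_neg_iff_add_eq_0 add.commute)

lemma cinner_minus_right: "cinner x (- y) = - cinner x (y::'a::chilbert_space)"
  using cinner_add_right[of x y "- y"] by (simp add: eq_neg_iff_add_eq_0 add.commute)

lemma cinner_diff_left: "cinner (x - z) y = cinner x y - cinner z (y::'a::chilbert_space)"
  using cinner_add_left[of x "- z" y] by (simp add: cinner_minus_left)

lemma cinner_diff_right: "cinner x (y - z) = cinner x y - cinner x (z::'a::chilbert_space)"
  using cinner_add_right[of x y "- z"] by (simp add: cinner_minus_right)

lemma cinner_scaleR_left: "cinner (r *\<^sub>R x) y = r * cinner x (y::'a::chilbert_space)"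
  using cinner_scaleC_left[of "complex_of_real r" x y] by (simp add: scaleC_of_real)

lemma cinner_scaleR_right: "cinner x (r *\<^sub>R y) = r * cinner x (y::'a::chilbert_space)"
  using cinner_scaleC_right[of x "complex_of_real r" y] by (simp add: scaleC_of_real)

lemma cinner_sum_left: "cinner (\<Sum>i\<in>I. f i) y = (\<Sum>i\<in>I. cinner (f i) (y::'a::chilbert_space))"
  by (induction I rule: infinite_finite_induct) (simp_all add: cinner_add_left)

lemma cinner_sum_right: "cinner y (\<Sum>i\<in>I. f i) = (\<Sum>i\<in>I. cinner (y::'a::chilbert_space) (f i))"
  by (induction I rule: infinite_finite_induct) (simp_all add: cinner_add_right)

lemma Re_cinner_self: "Re (cinner x x) = (norm (x::'a::chilbert_space))\<^sup>2"
  by (simp add: cinner_self)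

lemma semi_inner_Re_cinner: "semi_inner (\<lambda>x y :: 'a::chilbert_space. Re (cinner x y))"
proof
  fix x y :: 'a
  show "Re (cinner x y) = Re (cinner y x)" using cinner_commute[of x y] by simp
qed (simp_all add: cinner_add_left cinner_scaleR_left cinner_self)

lemma cmod_cinner_le: "cmod (cinner x y) \<le> norm x * norm (y::'a::chilbert_space)"
proof -
  interpret semi_inner "\<lambda>x y :: 'a. Re (cinner x y)" by (rule semi_inner_Re_cinner)
  obtain c where c: "cmod c = 1" "c * cinner x y = complex_of_real (cmod (cinner x y))"
    by (rule unimodular_phase)
  then have "cmod (cinner x y) = Re (cinner (c *\<^sub>C x) y)" by (simp add: cinner_scaleC_left)
  also have "\<dots> \<le> norm (c *\<^sub>C x) * norm y"
    using Cauchy_Schwarz[of "c *\<^sub>C x" y] by (simp add: snorm_def Re_cinner_self)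
  finally show ?thesis by (simp add: norm_scaleC c)
qed

lemma Re_cinner_le: "\<bar>Re (cinner x y)\<bar> \<le> norm x * norm (y::'a::chilbert_space)"
  using abs_Re_le_cmod[of "cinner x y"] cmod_cinner_le[of x y] by linarith

definition orthonormal :: "'i set \<Rightarrow> ('i \<Rightarrow> 'a::chilbert_space) \<Rightarrow> bool" where
  "orthonormal I f \<longleftrightarrow> (\<forall>i\<in>I. \<forall>j\<in>I. cinner (f i) (f j) = (if i = j then 1 else 0))"

lemma orthonormal_subset: "orthonormal I f \<Longrightarrow> J \<subseteq> I \<Longrightarrow> orthonormal J f"
  unfolding orthonormal_def by blast

lemma orthonormal_cinner_sum:
  assumes "orthonormal I f" "finite J" "J \<subseteq> I" "i \<in> I"
  shows "cinner (\<Sum>j\<in>J. c j *\<^sub>C f j) (f i) = (if i \<in> J then c i else 0)"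
proof -
  have "cinner (\<Sum>j\<in>J. c j *\<^sub>C f j) (f i) = (\<Sum>j\<in>J. if j = i then c j else 0)"
    unfolding cinner_sum_left using assms
    by (intro sum.cong) (auto simp: orthonormal_def cinner_scaleC_left)
  then show ?thesis using assms(2) by (simp add: sum.delta)
qed

lemma orthonormal_norm_sum:
  assumes "orthonormal I f" "finite J" "J \<subseteq> I"
  shows "(norm (\<Sum>j\<in>J. c j *\<^sub>C f j))\<^sup>2 = (\<Sum>j\<in>J. (cmod (c j))\<^sup>2)"
proof -
  define x where "x = (\<Sum>j\<in>J. c j *\<^sub>C f j)"
  have "cinner x x = (\<Sum>j\<in>J. cnj (c j) * cinner x (f j))"
    by (subst (2) x_def) (simp add: cinner_sum_right cinner_scaleC_right)
  also have "\<dots> = (\<Sum>j\<in>J. cnj (c j) * c j)"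
  proof (intro sum.cong refl)
    fix j assume "j \<in> J"
    then show "cnj (c j) * cinner x (f j) = cnj (c j) * c j"
      unfolding x_def using orthonormal_cinner_sum[OF assms, of j c] assms(3) by auto
  qed
  also have "\<dots> = (\<Sum>j\<in>J. complex_of_real ((cmod (c j))\<^sup>2))"
    by (intro sum.cong refl) (simp add: complex_norm_square mult.commute del: of_real_power)
  finally have "Re (cinner x x) = (\<Sum>j\<in>J. (cmod (c j))\<^sup>2)" by (simp del: of_real_power)
  then show ?thesis by (simp add: x_def Re_cinner_self)
qed

lemma orthonormal_norm_diff_projection:
  assumes "orthonormal I f" "finite J" "J \<subseteq> I"
  shows "(norm (x - (\<Sum>j\<in>J. cinner x (f j) *\<^sub>C f j)))\<^sup>2 = (norm x)\<^sup>2 - (\<Sum>j\<in>J. (cmod (cinner x (f j)))\<^sup>2)"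
proof -
  define y where "y = (\<Sum>j\<in>J. cinner x (f j) *\<^sub>C f j)"
  have "cinner x y = (\<Sum>j\<in>J. complex_of_real ((cmod (cinner x (f j)))\<^sup>2))"
    unfolding y_def cinner_sum_right cinner_scaleC_right
    by (intro sum.cong refl) (simp add: complex_norm_square mult.commute del: of_real_power)
  then have xy: "Re (cinner x y) = (\<Sum>j\<in>J. (cmod (cinner x (f j)))\<^sup>2)" by (simp del: of_real_power)
  have "Re (cinner y x) = Re (cinner x y)" using cinner_commute[of x y] by simp
  moreover have "Re (cinner y y) = (\<Sum>j\<in>J. (cmod (cinner x (f j)))\<^sup>2)"
    unfolding Re_cinner_self y_def by (rule orthonormal_norm_sum[OF assms])
  ultimately have "Re (cinner (x - y) (x - y)) = Re (cinner x x) - (\<Sum>j\<in>J. (cmod (cinner x (f j)))\<^sup>2)"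
    using xy by (simp add: cinner_diff_left cinner_diff_right)
  then show ?thesis by (simp add: Re_cinner_self y_def)
qed

lemma Bessel:
  assumes "orthonormal I f" "finite J" "J \<subseteq> I"
  shows "(\<Sum>j\<in>J. (cmod (cinner x (f j)))\<^sup>2) \<le> (norm x)\<^sup>2"
  using orthonormal_norm_diff_projection[OF assms, of x] zero_le_power2 by (metis diff_ge_0_iff_ge)

section \<open>Domination of a summing operator\<close>

text \<open>With finitely many phases, the unimodular sequences considered in
  \<open>gram_orthonormal_sum\<close> form a finite set, over which correction terms can be
  summed.\<close>

lemma circle_net:
  assumes "e > 0"
  obtains Z :: "complex set" where "finite Z" "Z \<subseteq> sphere 0 1" "\<And>u. cmod u = 1 \<Longrightarrow> \<exists>z\<in>Z. cmod (z - u) < e"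
proof -
  have "seq_compact (sphere (0::complex) 1)" by (simp add: compact_imp_seq_compact)
  from seq_compact_imp_totally_bounded[OF this, rule_format, OF assms]
  obtain Z where Z: "finite Z" "Z \<subseteq> sphere 0 1" and cover: "sphere (0::complex) 1 \<subseteq> (\<Union>x\<in>Z. ball x e)"
    by (elim exE conjE)
  have "\<exists>z\<in>Z. cmod (z - u) < e" if "cmod u = 1" for u
  proof -
    have "u \<in> sphere 0 1" using that by simp
    then have "u \<in> (\<Union>x\<in>Z. ball x e)" by (rule subsetD[OF cover])
    then show ?thesis by (simp add: dist_norm)
  qed
  with Z show ?thesis by (rule that)
qed

locale dominated_operator = cstar_dominating_mean C M + semi_inner \<beta>
  for C and M :: "(('a::cstar_algebra \<Rightarrow> complex) \<Rightarrow> real) \<Rightarrow> real" and \<beta> :: "'a \<Rightarrow> 'a \<Rightarrow> real" +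
  fixes T :: "'a \<Rightarrow> 'b::chilbert_space"
  assumes T_linear: "bounded_clinear T" and T_le_M: "norm (T x) \<le> M (absval x)"
    and form_scaleC: "\<beta> (c *\<^sub>C x) y = \<beta> x (cnj c *\<^sub>C y)"
    and form_le: "\<beta> x x \<le> 2 * C * (norm x)\<^sup>2"
    and form_sup: "\<delta> > 0 \<Longrightarrow> \<exists>v. norm v \<le> 2 \<and> M (absval x) \<le> \<beta> v x + \<delta>"
begin

text \<open>By \<open>form_le\<close>, \<open>snorm\<close> is at most sqrt (2 C) times the norm;
  the 2 is the norm of the test vectors in \<open>form_sup\<close>. So \<kappa> bounds the seminorm
  of these vectors, and through them \<open>T\<close> with respect to \<open>snorm\<close>.\<close>

definition \<kappa> :: real where "\<kappa> = 2 * sqrt (2 * C)"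

lemma \<kappa>_nonneg: "0 \<le> \<kappa>" using C_nonneg by (simp add: \<kappa>_def)

lemma snorm_le: "2 * snorm v \<le> \<kappa> * norm v"
proof -
  have "snorm v \<le> sqrt (2 * C * (norm v)\<^sup>2)" unfolding snorm_def using form_le[of v] by simp
  then show ?thesis using C_nonneg by (simp add: \<kappa>_def real_sqrt_mult)
qed

lemma snorm_scaleC: "snorm (c *\<^sub>C x) = cmod c * snorm x"
proof -
  have "\<beta> (c *\<^sub>C x) (c *\<^sub>C x) = \<beta> x ((cmod c)\<^sup>2 *\<^sub>R x)"
    unfolding form_scaleC scaleC_scaleC
    by (simp add: complex_norm_square[symmetric] mult.commute scaleC_of_real del: of_real_power)
  then show ?thesis by (simp add: snorm_def scale_right real_sqrt_mult)
qed

lemma M_absval_le: "M (absval x) \<le> \<kappa> * snorm x"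
proof (rule field_le_epsilon)
  fix e :: real assume "e > 0"
  then obtain v where v: "norm v \<le> 2" "M (absval x) \<le> \<beta> v x + e" using form_sup by blast
  have "\<beta> v x \<le> snorm v * snorm x" using Cauchy_Schwarz[of v x] by simp
  also have "snorm v \<le> \<kappa>" using snorm_le[of v] mult_left_mono[OF v(1) \<kappa>_nonneg] by simp
  finally show "M (absval x) \<le> \<kappa> * snorm x + e" using v(2) by (simp add: mult_right_mono)
qed

lemma T_le: "norm (T x) \<le> \<kappa> * snorm x"
  using T_le_M[of x] M_absval_le[of x] by simp

text \<open>\<open>v\<close> approximates the image of \<open>h\<close> under the adjoint of \<open>T\<close> as a map on the completion of \<open>\<beta>\<close>.\<close>

definition adj_approx :: "'b \<Rightarrow> real \<Rightarrow> 'a \<Rightarrow> bool" where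
  "adj_approx h \<delta> v \<longleftrightarrow> (\<forall>x. \<bar>Re (cinner (T x) h) - \<beta> x v\<bar> \<le> \<delta> * snorm x)"

text \<open>The convex set is the ball of radius 2 norm h: Re <T x, h> is at most norm h times M
  |x|, and \<open>form_sup\<close> nearly reaches this by \<beta> (norm h v) x. The bound holds in
  the norm of the algebra, not just in the seminorm, so the dual ball can be evaluated on the
  approximants in \<open>gram_orthonormal_sum\<close>.\<close>

lemma adj_approx_exists:
  assumes "\<delta> > 0"
  obtains v where "norm v \<le> 2 * norm h" "adj_approx h \<delta> v"
proof -
  have sup: "\<exists>v\<in>cball 0 (2 * norm h). Re (cinner (T x) h) \<le> \<beta> v x + \<eta>" if "\<eta> > 0" for x \<eta>
  proof -
    have pos: "norm h + 1 > 0" using norm_ge_zero[of h] by linarith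
    obtain v where v: "norm v \<le> 2" "M (absval x) \<le> \<beta> v x + \<eta> / (norm h + 1)"
      using form_sup[of "\<eta> / (norm h + 1)" x] \<open>\<eta> > 0\<close> pos by auto
    have "Re (cinner (T x) h) \<le> norm h * norm (T x)"
      using Re_cinner_le[of "T x" h] by (simp add: mult.commute)
    also have "\<dots> \<le> norm h * (\<beta> v x + \<eta> / (norm h + 1))"
      using T_le_M[of x] v(2) by (intro mult_left_mono) auto
    also have "\<dots> = \<beta> (norm h *\<^sub>R v) x + \<eta> * (norm h / (norm h + 1))"
      by (simp add: scale_left distrib_left)
    also have "\<dots> \<le> \<beta> (norm h *\<^sub>R v) x + \<eta> * 1"
      using \<open>\<eta> > 0\<close> pos by (intro add_mono mult_left_mono) auto
    finally have "Re (cinner (T x) h) \<le> \<beta> (norm h *\<^sub>R v) x + \<eta>" by simp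
    moreover have "norm (norm h *\<^sub>R v) \<le> 2 * norm h"
      using mult_left_mono[OF v(1) norm_ge_zero[of h]] by simp
    ultimately show ?thesis by (intro bexI[of _ "norm h *\<^sub>R v"]) auto
  qed
  have bound: "snorm v \<le> \<kappa> * norm h" if "v \<in> cball 0 (2 * norm h)" for v
    using snorm_le[of v] mult_left_mono[of "norm v" "2 * norm h" \<kappa>] \<kappa>_nonneg that by simp
  obtain v where "v \<in> cball 0 (2 * norm h)"
    "\<And>x. \<bar>Re (cinner (T x) h) - \<beta> v x\<bar> \<le> \<delta> * snorm x"
    by (rule approximate_Riesz_in_convex[OF _ _ convex_cball bound sup assms])
      (auto simp: bounded_clinear_add[OF T_linear] bounded_clinear_scaleR[OF T_linear]
        cinner_add_left cinner_scaleR_left)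
  then show ?thesis using that[of v] by (simp add: adj_approx_def commute)
qed

lemma adj_approx_mono: "adj_approx h \<delta> v \<Longrightarrow> \<delta> \<le> \<epsilon> \<Longrightarrow> adj_approx h \<epsilon> v"
  unfolding adj_approx_def by (meson mult_right_mono order_trans snorm_nonneg)

lemma adj_approx_add:
  assumes "adj_approx h \<delta> v" "adj_approx k \<epsilon> w"
  shows "adj_approx (h + k) (\<delta> + \<epsilon>) (v + w)"
  unfolding adj_approx_def
proof
  fix x
  show "\<bar>Re (cinner (T x) (h + k)) - \<beta> x (v + w)\<bar> \<le> (\<delta> + \<epsilon>) * snorm x"
    using assms[unfolded adj_approx_def, rule_format, of x]
    by (simp add: cinner_add_right add_right distrib_right)
qed

lemma adj_approx_scaleC:
  assumes "adj_approx h \<delta> v"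
  shows "adj_approx (c *\<^sub>C h) (cmod c * \<delta>) (c *\<^sub>C v)"
  unfolding adj_approx_def
proof
  fix x
  have "cinner (T (cnj c *\<^sub>C x)) h = cinner (T x) (c *\<^sub>C h)"
    by (simp add: bounded_clinear_scaleC[OF T_linear] cinner_scaleC_left cinner_scaleC_right)
  moreover have "\<beta> (cnj c *\<^sub>C x) v = \<beta> x (c *\<^sub>C v)" by (simp add: form_scaleC)
  ultimately show "\<bar>Re (cinner (T x) (c *\<^sub>C h)) - \<beta> x (c *\<^sub>C v)\<bar> \<le> cmod c * \<delta> * snorm x"
    using assms[unfolded adj_approx_def, rule_format, of "cnj c *\<^sub>C x"]
    by (simp add: snorm_scaleC mult_ac)
qed

lemma adj_approx_zero: "adj_approx 0 \<delta> v \<Longrightarrow> \<delta> \<ge> 0 \<Longrightarrow> snorm v \<le> \<delta>"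
proof -
  assume "adj_approx 0 \<delta> v" and \<delta>: "\<delta> \<ge> 0"
  then have "\<bar>- \<beta> v v\<bar> \<le> \<delta> * snorm v" unfolding adj_approx_def by (metis cinner_zero_right diff_0 zero_complex.sel(1))
  then have "(snorm v)\<^sup>2 \<le> \<delta> * snorm v" by (simp add: snorm_square self_nonneg)
  then show ?thesis using \<delta> snorm_nonneg[of v] by (cases "snorm v = 0") (auto simp: power2_eq_square)
qed

lemma adj_approx_diff:
  assumes "adj_approx h \<delta> v" "adj_approx k \<epsilon> w"
  shows "adj_approx (h - k) (\<delta> + \<epsilon>) (v - w)"
  using adj_approx_add[OF assms(1) adj_approx_scaleC[OF assms(2), of "-1"]]
  by (simp add: scaleC_minus_left)

lemma adj_approx_sum:
  assumes "finite I" "\<And>i. i \<in> I \<Longrightarrow> adj_approx (h i) (\<delta> i) (v i)"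
  shows "adj_approx (\<Sum>i\<in>I. h i) (\<Sum>i\<in>I. \<delta> i) (\<Sum>i\<in>I. v i)"
  using assms
proof (induction I rule: finite_induct)
  case empty
  have "\<beta> x 0 = 0" for x using scale_right[of x 0 0] by simp
  then show ?case by (simp add: adj_approx_def)
qed (simp add: adj_approx_add)

text \<open>The difference approximates the image of 0, so its seminorm is small, and
  \<open>T\<close> is bounded for the seminorm.\<close>

lemma adj_approx_unique:
  assumes "adj_approx h \<delta> v" "adj_approx h \<epsilon> w" "\<delta> \<ge> 0" "\<epsilon> \<ge> 0"
  shows "norm (T v - T w) \<le> \<kappa> * (\<delta> + \<epsilon>)"
proof -
  have "norm (T v - T w) \<le> \<kappa> * snorm (v - w)"
    using T_le[of "v - w"] by (simp add: bounded_clinear_diff[OF T_linear])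
  also have "\<dots> \<le> \<kappa> * (\<delta> + \<epsilon>)"
    using adj_approx_zero[of "\<delta> + \<epsilon>" "v - w"] adj_approx_diff[OF assms(1,2)] assms(3,4) \<kappa>_nonneg
    by (intro mult_left_mono) auto
  finally show ?thesis .
qed

text \<open>Approximants with tolerance 1 / (n + 1) have Cauchy images by
  \<open>adj_approx_unique\<close>; the same estimate compares any other approximant with the
  limit.\<close>

lemma gram_exists: "\<exists>y. \<forall>\<delta>>0. \<forall>v. adj_approx h \<delta> v \<longrightarrow> norm (T v - y) \<le> \<kappa> * \<delta>"
proof -
  have "\<exists>v. adj_approx h (inverse (real (Suc n))) v" for n
    using adj_approx_exists[of "inverse (real (Suc n))" h] by auto
  then obtain v where v: "\<And>n. adj_approx h (inverse (real (Suc n))) (v n)" by metis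
  have lim0: "(\<lambda>n. \<kappa> * (\<delta> + inverse (real (Suc n)))) \<longlonglongrightarrow> \<kappa> * (\<delta> + 0)" for \<delta>
    by (intro tendsto_intros LIMSEQ_inverse_real_of_nat)
  have "Cauchy (\<lambda>n. T (v n))"
  proof (rule metric_CauchyI)
    fix e :: real assume e: "e > 0"
    have "(\<lambda>n. \<kappa> * (0 + inverse (real (Suc n)))) \<longlonglongrightarrow> 0" using lim0[of 0] by simp
    then have "eventually (\<lambda>n. \<kappa> * (0 + inverse (real (Suc n))) < e / 2) sequentially"
      using e by (intro order_tendstoD(2)[where y = 0]) auto
    then obtain N where N: "\<And>n. n \<ge> N \<Longrightarrow> \<kappa> * inverse (real (Suc n)) < e / 2"
      unfolding eventually_sequentially by auto
    have "dist (T (v m)) (T (v n)) < e" if "m \<ge> N" "n \<ge> N" for m n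
    proof -
      have "dist (T (v m)) (T (v n)) \<le> \<kappa> * (inverse (real (Suc m)) + inverse (real (Suc n)))"
        unfolding dist_norm by (rule adj_approx_unique[OF v v]) simp_all
      also have "\<dots> < e" using N[OF that(1)] N[OF that(2)] by (simp add: distrib_left)
      finally show ?thesis .
    qed
    then show "\<exists>M. \<forall>m\<ge>M. \<forall>n\<ge>M. dist (T (v m)) (T (v n)) < e" by blast
  qed
  then obtain y where y: "(\<lambda>n. T (v n)) \<longlonglongrightarrow> y" unfolding Cauchy_convergent_iff convergent_def by blast
  have "norm (T w - y) \<le> \<kappa> * \<delta>" if "\<delta> > 0" "adj_approx h \<delta> w" for \<delta> w
  proof (rule LIMSEQ_le)
    show "(\<lambda>n. norm (T w - T (v n))) \<longlonglongrightarrow> norm (T w - y)" by (intro tendsto_intros y)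
    show "(\<lambda>n. \<kappa> * (\<delta> + inverse (real (Suc n)))) \<longlonglongrightarrow> \<kappa> * \<delta>" using lim0[of \<delta>] by simp
    show "\<exists>N. \<forall>n\<ge>N. norm (T w - T (v n)) \<le> \<kappa> * (\<delta> + inverse (real (Suc n)))"
      using adj_approx_unique[OF that(2) v] that(1) by auto
  qed
  then show ?thesis by blast
qed

text \<open>This is \<open>K K\<^sup>*\<close> for the factorization \<open>T = K \<circ> J\<close> through the completion of \<open>\<beta>\<close>.\<close>

definition gram :: "'b \<Rightarrow> 'b" where
  "gram h = (SOME y. \<forall>\<delta>>0. \<forall>v. adj_approx h \<delta> v \<longrightarrow> norm (T v - y) \<le> \<kappa> * \<delta>)"

lemma gram_approx: "\<delta> > 0 \<Longrightarrow> adj_approx h \<delta> v \<Longrightarrow> norm (T v - gram h) \<le> \<kappa> * \<delta>"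
  using someI_ex[OF gram_exists[of h]] unfolding gram_def by blast

text \<open>The limit is recognized along any family of approximants; \<open>a\<close> and
  \<open>b\<close> absorb the constants that sums and multiples introduce.\<close>

lemma gram_eqI:
  assumes "\<And>\<delta>. \<delta> > 0 \<Longrightarrow> \<exists>v. adj_approx h (a * \<delta>) v \<and> norm (T v - y) \<le> b * \<delta>" and a: "a > 0"
  shows "gram h = y"
proof -
  have "norm (gram h - y) \<le> 0 + e" if "e > 0" for e
  proof -
    define L where "L = \<kappa> * a + \<bar>b\<bar> + 1"
    have L: "L > 0" unfolding L_def using \<kappa>_nonneg a by (intro add_nonneg_pos) auto
    obtain v where v: "adj_approx h (a * (e / L)) v" "norm (T v - y) \<le> b * (e / L)"
      using assms(1)[of "e / L"] \<open>e > 0\<close> L by auto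
    have "norm (gram h - y) \<le> norm (T v - gram h) + norm (T v - y)"
      using norm_triangle_ineq4[of "T v - y" "T v - gram h"] by simp
    also have "\<dots> \<le> \<kappa> * (a * (e / L)) + b * (e / L)"
      using gram_approx[OF _ v(1)] v(2) a L \<open>e > 0\<close> by (intro add_mono) simp_all
    also have "\<dots> = (\<kappa> * a + b) * (e / L)" by (simp add: algebra_simps)
    also have "\<dots> \<le> L * (e / L)" using L \<open>e > 0\<close> by (intro mult_right_mono) (auto simp: L_def)
    finally show ?thesis using L by simp
  qed
  then have "norm (gram h - y) \<le> 0" by (rule field_le_epsilon)
  then show ?thesis by simp
qed

lemma gram_add: "gram (h + k) = gram h + gram k"
proof (rule gram_eqI[of _ 2 _ "2 * \<kappa>"])
  fix \<delta> :: real assume \<delta>: "\<delta> > 0"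
  obtain v where v: "adj_approx h \<delta> v" using adj_approx_exists[OF \<delta>] by blast
  obtain w where w: "adj_approx k \<delta> w" using adj_approx_exists[OF \<delta>] by blast
  have "norm (T (v + w) - (gram h + gram k)) \<le> norm (T v - gram h) + norm (T w - gram k)"
    using norm_triangle_ineq[of "T v - gram h" "T w - gram k"]
    by (simp add: bounded_clinear_add[OF T_linear] algebra_simps)
  also have "\<dots> \<le> 2 * \<kappa> * \<delta>" using gram_approx[OF \<delta> v] gram_approx[OF \<delta> w] by simp
  finally show "\<exists>v. adj_approx (h + k) (2 * \<delta>) v \<and> norm (T v - (gram h + gram k)) \<le> 2 * \<kappa> * \<delta>"
    using adj_approx_add[OF v w] by (intro exI[of _ "v + w"]) simp
qed simp

lemma gram_scaleC: "gram (c *\<^sub>C h) = c *\<^sub>C gram h"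
proof (rule gram_eqI[of _ "cmod c + 1" _ "cmod c * \<kappa>"])
  fix \<delta> :: real assume \<delta>: "\<delta> > 0"
  obtain v where v: "adj_approx h \<delta> v" using adj_approx_exists[OF \<delta>] by blast
  have "norm (T (c *\<^sub>C v) - c *\<^sub>C gram h) = cmod c * norm (T v - gram h)"
    by (simp add: bounded_clinear_scaleC[OF T_linear] flip: scaleC_diff_right norm_scaleC)
  also have "\<dots> \<le> cmod c * \<kappa> * \<delta>" using mult_left_mono[OF gram_approx[OF \<delta> v], of "cmod c"] by simp
  finally have "norm (T (c *\<^sub>C v) - c *\<^sub>C gram h) \<le> cmod c * \<kappa> * \<delta>" .
  moreover have "adj_approx (c *\<^sub>C h) ((cmod c + 1) * \<delta>) (c *\<^sub>C v)"
    using adj_approx_mono[OF adj_approx_scaleC[OF v, of c], of "(cmod c + 1) * \<delta>"] \<delta> by (simp add: algebra_simps)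
  ultimately show "\<exists>v. adj_approx (c *\<^sub>C h) ((cmod c + 1) * \<delta>) v \<and> norm (T v - c *\<^sub>C gram h) \<le> cmod c * \<kappa> * \<delta>"
    by blast
qed (simp add: add_nonneg_pos)

text \<open>In the completion this reads <K L h, k> = <L h, L k> with L the adjoint of K;
  \<open>v\<close> and \<open>w\<close> stand for L h and L k. The error has one part from T v and
  one from \<open>w\<close>.\<close>

lemma gram_inner_approx:
  assumes \<delta>: "\<delta> > 0" and v: "adj_approx h \<delta> v" "norm v \<le> 2 * norm h" and w: "adj_approx k \<delta> w"
  shows "\<bar>Re (cinner (gram h) k) - \<beta> v w\<bar> \<le> \<delta> * (\<kappa> * (norm h + norm k))"
proof -
  have "\<bar>Re (cinner (gram h) k) - Re (cinner (T v) k)\<bar> \<le> norm (T v - gram h) * norm k"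
    using Re_cinner_le[of "T v - gram h" k] by (simp add: cinner_diff_left abs_minus_commute)
  also have "\<dots> \<le> \<kappa> * \<delta> * norm k" by (intro mult_right_mono gram_approx \<delta> v) simp
  finally have "\<bar>Re (cinner (gram h) k) - Re (cinner (T v) k)\<bar> \<le> \<kappa> * \<delta> * norm k" .
  moreover have "\<bar>Re (cinner (T v) k) - \<beta> v w\<bar> \<le> \<delta> * (\<kappa> * norm h)"
  proof -
    have "snorm v \<le> \<kappa> * norm h"
      using snorm_le[of v] mult_left_mono[OF v(2) \<kappa>_nonneg] by simp
    then have "\<delta> * snorm v \<le> \<delta> * (\<kappa> * norm h)" using \<delta> by (intro mult_left_mono) auto
    then show ?thesis using w unfolding adj_approx_def by (meson order_trans)
  qed
  ultimately show ?thesis by (simp add: algebra_simps)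
qed

lemma gram_self_adjoint: "cinner (gram h) k = cinner h (gram k)"
proof -
  have Re_eq: "Re (cinner (gram h) k) = Re (cinner (gram k) h)" for h k
  proof -
    have "\<bar>Re (cinner (gram h) k) - Re (cinner (gram k) h)\<bar> \<le> 0 + e" if "e > 0" for e
    proof -
      define L where "L = 2 * (\<kappa> * (norm h + norm k)) + 1"
      have L: "L > 0" unfolding L_def using \<kappa>_nonneg by (intro add_nonneg_pos) auto
      define \<delta> where "\<delta> = e / L"
      have \<delta>: "\<delta> > 0" using L \<open>e > 0\<close> by (simp add: \<delta>_def)
      obtain v where v: "norm v \<le> 2 * norm h" "adj_approx h \<delta> v" using adj_approx_exists[OF \<delta>] .
      obtain w where w: "norm w \<le> 2 * norm k" "adj_approx k \<delta> w" using adj_approx_exists[OF \<delta>] .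
      have "\<bar>Re (cinner (gram h) k) - Re (cinner (gram k) h)\<bar> \<le> \<delta> * (2 * (\<kappa> * (norm h + norm k)))"
        using gram_inner_approx[OF \<delta> v(2,1) w(2)] gram_inner_approx[OF \<delta> w(2,1) v(2)]
        by (simp add: commute[of w v] algebra_simps)
      also have "\<dots> \<le> \<delta> * L" using \<delta> by (intro mult_left_mono) (auto simp: L_def)
      finally show ?thesis using L by (simp add: \<delta>_def)
    qed
    then have "\<bar>Re (cinner (gram h) k) - Re (cinner (gram k) h)\<bar> \<le> 0" by (rule field_le_epsilon)
    then show ?thesis by simp
  qed
  have Re_eq': "Re (cinner (gram h) k) = Re (cinner h (gram k))" for h k
    using Re_eq[of h k] cinner_commute[of h "gram k"] by simp
  \<comment> \<open>Complex linearity of \<open>gram\<close> carries the real parts over to the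
    imaginary parts.\<close>
  have "Im z = Re (- \<i> * z)" for z by simp
  then have "Im (cinner (gram h) k) = Re (cinner (gram ((- \<i>) *\<^sub>C h)) k)"
    by (simp add: gram_scaleC cinner_scaleC_left)
  also have "\<dots> = Im (cinner h (gram k))" unfolding Re_eq' by (simp add: cinner_scaleC_left)
  finally show ?thesis using Re_eq'[of h k] by (simp add: complex_eq_iff)
qed

lemma gram_nonneg: "0 \<le> Re (cinner (gram h) h)"
proof (rule ccontr)
  assume "\<not> 0 \<le> Re (cinner (gram h) h)"
  then have neg: "- Re (cinner (gram h) h) > 0" by simp
  define L where "L = \<kappa> * (norm h + norm h) + 1"
  have L: "L > 0" unfolding L_def using \<kappa>_nonneg by (intro add_nonneg_pos) auto
  define \<delta> where "\<delta> = - Re (cinner (gram h) h) / L"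
  have \<delta>: "\<delta> > 0" unfolding \<delta>_def using neg L by (rule divide_pos_pos)
  obtain v where v: "norm v \<le> 2 * norm h" "adj_approx h \<delta> v" using adj_approx_exists[OF \<delta>] .
  have "0 \<le> \<beta> v v" by (rule self_nonneg)
  also have "\<dots> \<le> Re (cinner (gram h) h) + \<delta> * (\<kappa> * (norm h + norm h))"
    using gram_inner_approx[OF \<delta> v(2,1) v(2)] by simp
  also have "\<dots> < Re (cinner (gram h) h) + \<delta> * L" using \<delta> by (simp add: L_def)
  also have "\<dots> = 0" using L by (simp add: \<delta>_def)
  finally show False by simp
qed

text \<open>Cauchy-Schwarz in the completion: <T x, h> pairs J x with the adjoint image of h, whose
  squared length is <gram h, h>, while 2 C bounds the square of the norm of J. The approximants are
  removed by \<delta> tending to 0.\<close>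

lemma gram_dominates: "(cmod (cinner (T x) h))\<^sup>2 \<le> 2 * C * (norm x)\<^sup>2 * Re (cinner (gram h) h)"
proof -
  have Re_le: "\<bar>Re (cinner (T x) h)\<bar> \<le> snorm x * sqrt (Re (cinner (gram h) h))" for x
  proof -
    define R where "R = Re (cinner (gram h) h)"
    have lim: "((\<lambda>\<delta>. snorm x * (sqrt (R + \<delta> * (\<kappa> * (norm h + norm h))) + \<delta>)) \<longlongrightarrow>
        snorm x * (sqrt (R + 0 * (\<kappa> * (norm h + norm h))) + 0)) (at_right 0)"
      by (intro tendsto_intros)
    have "\<bar>Re (cinner (T x) h)\<bar> \<le> snorm x * (sqrt (R + \<delta> * (\<kappa> * (norm h + norm h))) + \<delta>)" if \<delta>: "\<delta> > 0" for \<delta>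
    proof -
      obtain v where v: "norm v \<le> 2 * norm h" "adj_approx h \<delta> v" using adj_approx_exists[OF \<delta>] .
      have "snorm v \<le> sqrt (R + \<delta> * (\<kappa> * (norm h + norm h)))"
        unfolding snorm_def using gram_inner_approx[OF \<delta> v(2,1) v(2)] by (simp add: R_def)
      then have "snorm x * snorm v \<le> snorm x * sqrt (R + \<delta> * (\<kappa> * (norm h + norm h)))"
        by (intro mult_left_mono) auto
      moreover have "\<bar>Re (cinner (T x) h)\<bar> \<le> snorm x * snorm v + \<delta> * snorm x"
        using v(2)[unfolded adj_approx_def, rule_format, of x] Cauchy_Schwarz[of x v] by linarith
      ultimately show ?thesis by (simp add: algebra_simps)
    qed
    then have "eventually (\<lambda>\<delta>. \<bar>Re (cinner (T x) h)\<bar> \<le> snorm x * (sqrt (R + \<delta> * (\<kappa> * (norm h + norm h))) + \<delta>)) (at_right 0)"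
      by (auto simp: eventually_at_right_field intro: exI[of _ 1])
    from tendsto_lowerbound[OF lim this] show ?thesis by (simp add: R_def)
  qed
  obtain c where c: "cmod c = 1" "c * cinner (T x) h = complex_of_real (cmod (cinner (T x) h))"
    by (rule unimodular_phase)
  then have "cmod (cinner (T x) h) = Re (cinner (T (c *\<^sub>C x)) h)"
    by (simp add: bounded_clinear_scaleC[OF T_linear] cinner_scaleC_left)
  also have "\<dots> \<le> snorm x * sqrt (Re (cinner (gram h) h))"
    using Re_le[of "c *\<^sub>C x"] by (simp add: snorm_scaleC c)
  finally have le: "cmod (cinner (T x) h) \<le> snorm x * sqrt (Re (cinner (gram h) h))" .
  then have "(cmod (cinner (T x) h))\<^sup>2 \<le> (snorm x * sqrt (Re (cinner (gram h) h)))\<^sup>2"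
    by (intro power_mono) auto
  also have "\<dots> = \<beta> x x * Re (cinner (gram h) h)"
    using gram_nonneg[of h] by (simp add: power_mult_distrib snorm_square)
  also have "\<dots> \<le> 2 * C * (norm x)\<^sup>2 * Re (cinner (gram h) h)"
    by (intro mult_right_mono form_le gram_nonneg)
  finally show ?thesis .
qed

text \<open>
  For fixed coefficients the approximants of all the vectors \<open>\<Sum> c\<^sub>i b\<^sub>i h\<^sub>i\<close> with unimodular
  \<open>b\<^sub>i\<close> in a finite net can be chosen with norm at most \<open>2 \<parallel>c\<parallel>\<close>; up to an error that is small in
  mean, they are the corresponding combinations of fixed approximants of the \<open>h\<^sub>i\<close>.
\<close>

lemma gram_orthonormal_sum:
  assumes h: "orthonormal I h" and I: "finite (I :: 'i set)"
  shows "(\<Sum>i\<in>I. (norm (gram (h i)))\<^sup>2) \<le> (2 * C)\<^sup>2"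
proof -
  \<comment> \<open>With the norms themselves as weights, the weighted sum of norms is
    \<open>S\<close> and the length of the weight vector is sqrt S; so the estimate becomes S <= 2 C
    sqrt S.\<close>
  define c where "c i = norm (gram (h i))" for i
  define S where "S = (\<Sum>i\<in>I. (c i)\<^sup>2)"
  have S0: "S \<ge> 0" and c0: "c i \<ge> 0" for i by (simp_all add: S_def sum_nonneg c_def)
  have main: "(1 - \<eta>) * S \<le> 2 * C * sqrt S" if \<eta>: "0 < \<eta>" "\<eta> < 1" for \<eta>
  proof -
    obtain Z where Z: "finite Z" "Z \<subseteq> sphere (0::complex) 1" "\<And>u. cmod u = 1 \<Longrightarrow> \<exists>z\<in>Z. cmod (z - u) < \<eta>"
      using circle_net[OF \<eta>(1)] by blast
    define P where "P = PiE I (\<lambda>_. Z)"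
    have P: "finite P" unfolding P_def using I Z by (intro finite_PiE) auto
    \<comment> \<open>Error per unit of \<delta>: the first term comes from replacing each
      \<open>gram (h i)\<close> by \<open>T (v i)\<close>, the second from the mean of the
      correction \<open>q\<close>.\<close>
    define K where "K = (1 - \<eta>) * (\<kappa> * (\<Sum>i\<in>I. c i)) + card P * (\<kappa> * (1 + (\<Sum>i\<in>I. c i)))"
    have approx: "(1 - \<eta>) * S \<le> 2 * C * sqrt S + \<delta> * K" if \<delta>: "\<delta> > 0" for \<delta>
    proof -
      have "\<exists>v. adj_approx (h i) \<delta> v" for i using adj_approx_exists[OF \<delta>] by blast
      then obtain v where v: "\<And>i. adj_approx (h i) \<delta> (v i)" by metis
      have "\<exists>u. norm u \<le> 2 * norm k \<and> adj_approx k \<delta> u" for k using adj_approx_exists[OF \<delta>] by blast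
      then obtain u where u: "\<And>k. norm (u k) \<le> 2 * norm k" "\<And>k. adj_approx k \<delta> (u k)" by metis
      define hb where "hb b = (\<Sum>i\<in>I. (c i * b i) *\<^sub>C h i)" for b :: "'i \<Rightarrow> complex"
      define y where "y b = u (hb b) - (\<Sum>i\<in>I. (c i * b i) *\<^sub>C v i)" for b :: "'i \<Rightarrow> complex"
      have cb: "cmod (c i * b i) = c i" if "b \<in> P" "i \<in> I" for b :: "'i \<Rightarrow> complex" and i
        using that Z(2) c0[of i] by (auto simp: P_def norm_mult PiE_def Pi_def)
      have "norm (u (hb b)) \<le> 2 * sqrt S" if "b \<in> P" for b
      proof -
        have "(norm (hb b))\<^sup>2 = S" unfolding hb_def S_def
          using orthonormal_norm_sum[OF h I order_refl, of "\<lambda>i. c i * b i"] cb[OF that] by simp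
        then have "norm (hb b) = sqrt S" by (metis norm_ge_zero real_sqrt_unique)
        then show ?thesis using u(1)[of "hb b"] by simp
      qed
      note ub = this
      have My: "M (absval (y b)) \<le> \<delta> * (\<kappa> * (1 + (\<Sum>i\<in>I. c i)))" if b: "b \<in> P" for b
      proof -
        have "adj_approx (hb b) (\<Sum>i\<in>I. c i * \<delta>) (\<Sum>i\<in>I. (c i * b i) *\<^sub>C v i)"
          unfolding hb_def
        proof (rule adj_approx_sum[OF I])
          fix i assume "i \<in> I"
          then show "adj_approx ((c i * b i) *\<^sub>C h i) (c i * \<delta>) ((c i * b i) *\<^sub>C v i)"
            using adj_approx_scaleC[OF v[of i], of "c i * b i"] cb[OF b] by simp
        qed
        from adj_approx_diff[OF u(2)[of "hb b"] this]
        have "adj_approx 0 (\<delta> * (1 + (\<Sum>i\<in>I. c i))) (y b)"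
          by (simp add: y_def distrib_left sum_distrib_left mult.commute)
        then have "snorm (y b) \<le> \<delta> * (1 + (\<Sum>i\<in>I. c i))"
          using \<delta> c0 by (intro adj_approx_zero) (simp_all add: sum_nonneg)
        then have "\<kappa> * snorm (y b) \<le> \<kappa> * (\<delta> * (1 + (\<Sum>i\<in>I. c i)))"
          using \<kappa>_nonneg by (rule mult_left_mono)
        with M_absval_le[of "y b"] show ?thesis by (simp add: mult.left_commute)
      qed
      define g where "g = (\<Sum>i\<in>I. ((1 - \<eta>) * c i) *\<^sub>R absval (v i))"
      define q where "q = (\<Sum>b\<in>P. absval (y b))"
      have gB: "g \<in> dual_bounded" and qB: "q \<in> dual_bounded"
        unfolding g_def q_def by (intro dual_bounded_sum dual_bounded_scaleR absval_bounded)+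
      have sum_apply: "(\<Sum>i\<in>J. f i) \<phi> = (\<Sum>i\<in>J. f i \<phi>)" for J :: "'j set" and f :: "'j \<Rightarrow> ('a \<Rightarrow> complex) \<Rightarrow> real" and \<phi>
        by (induction J rule: infinite_finite_induct) simp_all
      \<comment> \<open>For given \<phi>, phases \<open>b\<close> from the net nearly align all the
        numbers \<phi> (v i). The aligned sum is \<phi> of \<open>u (hb b)\<close>, whose norm is at
        most 2 sqrt S, up to a correction. As \<open>b\<close> varies with \<phi>, \<open>q\<close>
        sums the corrections over all of \<open>P\<close>.\<close>
      have point: "(g + (- 1) *\<^sub>R q) \<phi> \<le> 2 * sqrt S" if \<phi>: "\<phi> \<in> dual_ball" for \<phi>
      proof -
        note lin = dual_ball_linear[OF \<phi>]
        have "\<exists>z\<in>Z. (1 - \<eta>) * cmod w \<le> Re (z * w)" for w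
        proof -
          obtain u where u: "cmod u = 1" "u * w = complex_of_real (cmod w)" by (rule unimodular_phase)
          obtain z where z: "z \<in> Z" "cmod (z - u) < \<eta>" using Z(3)[OF u(1)] by blast
          have "Re (z * w) = cmod w + Re ((z - u) * w)" by (simp add: left_diff_distrib u(2))
          moreover have "\<bar>Re ((z - u) * w)\<bar> \<le> \<eta> * cmod w"
            using abs_Re_le_cmod[of "(z - u) * w"] mult_right_mono[OF less_imp_le[OF z(2)], of "cmod w"]
            by (simp add: norm_mult)
          ultimately have "(1 - \<eta>) * cmod w \<le> Re (z * w)" by (simp add: algebra_simps)
          with z(1) show ?thesis by blast
        qed
        then obtain z where z: "\<And>w. z w \<in> Z" "\<And>w. (1 - \<eta>) * cmod w \<le> Re (z w * w)" by metis
        define b where "b = restrict (\<lambda>i. z (\<phi> (v i))) I"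
        have b: "b \<in> P" unfolding b_def P_def using z(1) by auto
        have "g \<phi> = (\<Sum>i\<in>I. c i * ((1 - \<eta>) * cmod (\<phi> (v i))))"
          unfolding g_def sum_apply by (simp add: scaleR_fun_def mult_ac)
        also have "\<dots> \<le> (\<Sum>i\<in>I. c i * Re (b i * \<phi> (v i)))"
          using z(2) c0 by (intro sum_mono mult_left_mono) (auto simp: b_def)
        also have "\<dots> = Re (\<phi> (\<Sum>i\<in>I. (c i * b i) *\<^sub>C v i))"
          by (simp add: bounded_clinear_sum[OF lin] bounded_clinear_scaleC[OF lin] scaleC_complex_def mult.assoc)
        also have "\<dots> = Re (\<phi> (u (hb b))) - Re (\<phi> (y b))"
          by (simp add: y_def bounded_clinear_diff[OF lin])
        also have "\<dots> \<le> cmod (\<phi> (u (hb b))) + cmod (\<phi> (y b))"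
          using abs_Re_le_cmod[of "\<phi> (u (hb b))"] abs_Re_le_cmod[of "\<phi> (y b)"] by linarith
        also have "cmod (\<phi> (u (hb b))) \<le> 2 * sqrt S"
          using dual_ball_le[OF \<phi>] ub[OF b] by (rule order_trans)
        also have "cmod (\<phi> (y b)) \<le> q \<phi>"
          unfolding q_def sum_apply by (rule member_le_sum[OF b _ P, where f = "\<lambda>b. cmod (\<phi> (y b))"]) simp
        finally show ?thesis by (simp add: scaleR_fun_def)
      qed
      have "(1 - \<eta>) * (S - \<kappa> * \<delta> * (\<Sum>i\<in>I. c i)) = (\<Sum>i\<in>I. ((1 - \<eta>) * c i) * (c i - \<kappa> * \<delta>))"
        by (simp add: S_def sum.distrib sum_subtractf sum_distrib_left algebra_simps power2_eq_square)
      also have "\<dots> \<le> (\<Sum>i\<in>I. ((1 - \<eta>) * c i) * M (absval (v i)))"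
      proof (intro sum_mono mult_left_mono)
        fix i
        have "c i \<le> norm (T (v i)) + norm (T (v i) - gram (h i))"
          unfolding c_def using norm_triangle_ineq4[of "T (v i)" "T (v i) - gram (h i)"] by simp
        then show "c i - \<kappa> * \<delta> \<le> M (absval (v i))"
          using gram_approx[OF \<delta> v[of i]] T_le_M[of "v i"] by linarith
        show "0 \<le> (1 - \<eta>) * c i" using c0 \<eta> by simp
      qed
      also have "\<dots> = M g"
        unfolding g_def by (simp add: M_sum M_scale dual_bounded_scaleR absval_bounded)
      also have "M g = M (g + (- 1) *\<^sub>R q) + M q"
        unfolding M_add[OF gB dual_bounded_scaleR[OF qB]] M_scale[OF qB] by simp
      also have "M (g + (- 1) *\<^sub>R q) \<le> C * (2 * sqrt S)"
        by (intro M_le dual_bounded_add gB dual_bounded_scaleR qB point)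
      also have "M q \<le> card P * (\<delta> * (\<kappa> * (1 + (\<Sum>i\<in>I. c i))))"
        unfolding q_def M_sum[OF absval_bounded] using My by (rule sum_bounded_above)
      finally show ?thesis by (simp add: K_def algebra_simps)
    qed
    have "K \<ge> 0" unfolding K_def using \<eta> \<kappa>_nonneg c0 by (intro add_nonneg_nonneg mult_nonneg_nonneg sum_nonneg) auto
    show ?thesis
    proof (rule field_le_epsilon)
      fix e :: real assume e: "e > 0"
      have "(1 - \<eta>) * S \<le> 2 * C * sqrt S + e / (K + 1) * K"
        using e \<open>K \<ge> 0\<close> by (intro approx) simp
      also have "e / (K + 1) * K \<le> e" using e \<open>K \<ge> 0\<close> by (simp add: field_simps)
      finally show "(1 - \<eta>) * S \<le> 2 * C * sqrt S + e" by simp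
    qed
  qed
  have "S \<le> 2 * C * sqrt S"
  proof (rule field_le_epsilon)
    fix e :: real assume e: "e > 0"
    define \<eta> where "\<eta> = min (1 / 2) (e / (S + 1))"
    have \<eta>: "0 < \<eta>" "\<eta> < 1" using e S0 by (auto simp: \<eta>_def)
    have "\<eta> * S \<le> e / (S + 1) * S" using S0 by (intro mult_right_mono) (auto simp: \<eta>_def)
    also have "\<dots> \<le> e" using e S0 by (simp add: field_simps)
    finally show "S \<le> 2 * C * sqrt S + e" using main[OF \<eta>] by (simp add: algebra_simps)
  qed
  then have "sqrt S * sqrt S \<le> 2 * C * sqrt S" using S0 by simp
  then have "sqrt S \<le> 2 * C"
    using C_nonneg S0 mult_right_le_imp_le[of "sqrt S" "sqrt S" "2 * C"] by (cases "S = 0") fastforce+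
  then have "(sqrt S)\<^sup>2 \<le> (2 * C)\<^sup>2" using S0 by (intro power_mono) auto
  then show ?thesis using S0 by (simp add: S_def c_def)
qed

end

section \<open>Orthonormal series and compactness\<close>

text \<open>Passing from the closure to \<open>S\<close>, from \<open>S\<close> to \<open>Q\<close>
  and from \<open>Q\<close> to a finite net costs e / 4 each.\<close>

lemma compact_closure_of_compact_approx:
  fixes S :: "'b::banach set"
  assumes "\<And>e. e > 0 \<Longrightarrow> \<exists>Q. compact Q \<and> (\<forall>x\<in>S. \<exists>y\<in>Q. norm (x - y) \<le> e)"
  shows "compact (closure S)"
  unfolding compact_eq_totally_bounded
proof (intro conjI allI impI)
  show "complete (closure S)" by (simp add: complete_eq_closed)
  fix e :: real assume e: "e > 0"
  obtain Q where Q: "compact Q" "\<And>x. x \<in> S \<Longrightarrow> \<exists>y\<in>Q. norm (x - y) \<le> e / 4"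
    using assms[of "e / 4"] e by auto
  have "\<forall>e>0. \<exists>k. finite k \<and> Q \<subseteq> (\<Union>x\<in>k. ball x e)"
    using Q(1) unfolding compact_eq_totally_bounded by blast
  then obtain k where k: "finite k" "Q \<subseteq> (\<Union>x\<in>k. ball x (e / 4))" using e by (metis zero_less_divide_iff zero_less_numeral)
  have "closure S \<subseteq> (\<Union>x\<in>k. ball x e)"
  proof
    fix x assume "x \<in> closure S"
    then obtain y where y: "y \<in> S" "dist y x < e / 4"
      using e unfolding closure_approachable by (metis zero_less_divide_iff zero_less_numeral)
    obtain z where z: "z \<in> Q" "norm (y - z) \<le> e / 4" using Q(2)[OF y(1)] by blast
    obtain w where w: "w \<in> k" "dist w z < e / 4" using k(2) z(1) by auto
    have "dist w x \<le> dist w z + dist z y + dist y x"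
      using dist_triangle[of w x z] dist_triangle[of z x y] by linarith
    also have "\<dots> < e" using w(2) z(2) y(2) e by (simp add: dist_norm norm_minus_commute)
    finally show "x \<in> (\<Union>x\<in>k. ball x e)" using w(1) by auto
  qed
  with k(1) show "\<exists>k. finite k \<and> closure S \<subseteq> (\<Union>x\<in>k. ball x e)" by blast
qed

lemma bounded_linear_scaleC_left: "bounded_linear (\<lambda>c. c *\<^sub>C (w::'b::cbanach))"
proof (rule bounded_linear_intro[where K = "norm w"])
  show "(r *\<^sub>R c) *\<^sub>C w = r *\<^sub>R (c *\<^sub>C w)" for r c
    by (simp add: scaleR_conv_of_real scaleC_scaleC[symmetric] scaleC_of_real)
qed (simp_all add: scaleC_add_left norm_scaleC)

text \<open>Induction: one more vector adds the continuous image of a disc, and sums of compact sets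
  are compact.\<close>

lemma compact_bounded_combinations:
  fixes w :: "nat \<Rightarrow> 'b::cbanach"
  shows "compact {y. \<exists>c. (\<forall>i<n. cmod (c i) \<le> r) \<and> y = (\<Sum>i<n. c i *\<^sub>C w i)}"
proof (induction n)
  case (Suc n)
  let ?S = "\<lambda>n. {y. \<exists>c. (\<forall>i<n. cmod (c i) \<le> r) \<and> y = (\<Sum>i<n. c i *\<^sub>C w i)}"
  have "compact ((\<lambda>c. c *\<^sub>C w n) ` cball 0 r)"
    by (intro compact_continuous_image linear_continuous_on bounded_linear_scaleC_left) simp
  with Suc have "compact {x + y | x y. x \<in> ?S n \<and> y \<in> (\<lambda>c. c *\<^sub>C w n) ` cball 0 r}"
    by (rule compact_sums)
  also have "{x + y | x y. x \<in> ?S n \<and> y \<in> (\<lambda>c. c *\<^sub>C w n) ` cball 0 r} = ?S (Suc n)"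
  proof (intro equalityI subsetI)
    fix z assume "z \<in> {x + y | x y. x \<in> ?S n \<and> y \<in> (\<lambda>c. c *\<^sub>C w n) ` cball 0 r}"
    then obtain c d where cd: "\<forall>i<n. cmod (c i) \<le> r" "cmod d \<le> r" "z = (\<Sum>i<n. c i *\<^sub>C w i) + d *\<^sub>C w n" by auto
    have "(\<forall>i<Suc n. cmod ((c(n := d)) i) \<le> r) \<and> z = (\<Sum>i<Suc n. (c(n := d)) i *\<^sub>C w i)"
      using cd by (auto simp: less_Suc_eq)
    then show "z \<in> ?S (Suc n)" by blast
  next
    fix z assume "z \<in> ?S (Suc n)"
    then obtain c where "\<forall>i<Suc n. cmod (c i) \<le> r" "z = (\<Sum>i<Suc n. c i *\<^sub>C w i)" by blast
    then have "(\<Sum>i<n. c i *\<^sub>C w i) \<in> ?S n" "c n *\<^sub>C w n \<in> (\<lambda>c. c *\<^sub>C w n) ` cball 0 r"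
      "z = (\<Sum>i<n. c i *\<^sub>C w i) + c n *\<^sub>C w n" by (auto intro!: exI[of _ c])
    then show "z \<in> {x + y | x y. x \<in> ?S n \<and> y \<in> (\<lambda>c. c *\<^sub>C w n) ` cball 0 r}" by blast
  qed
  finally show ?case .
qed simp

lemma orthonormal_series_tail:
  fixes f :: "nat \<Rightarrow> 'b::chilbert_space"
  assumes f: "orthonormal UNIV f" and c: "summable (\<lambda>n. (cmod (c n))\<^sup>2)" and e: "e > 0"
  obtains N where "\<And>F. finite F \<Longrightarrow> F \<inter> {..<N} = {} \<Longrightarrow> norm (\<Sum>n\<in>F. c n *\<^sub>C f n) < e"
proof -
  obtain N where N: "\<And>n. n \<ge> N \<Longrightarrow> norm (\<Sum>i. (cmod (c (i + n)))\<^sup>2) < e\<^sup>2"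
    using suminf_exist_split[OF _ c, of "e\<^sup>2"] e by auto
  have "norm (\<Sum>n\<in>F. c n *\<^sub>C f n) < e" if F: "finite F" "F \<inter> {..<N} = {}" for F
  proof -
    have "(norm (\<Sum>n\<in>F. c n *\<^sub>C f n))\<^sup>2 = (\<Sum>n\<in>F. (cmod (c n))\<^sup>2)"
      by (rule orthonormal_norm_sum[OF f F(1)]) simp
    also have "\<dots> = (\<Sum>i\<in>(\<lambda>n. n - N) ` F. (cmod (c (i + N)))\<^sup>2)"
      using F(2)
      by (subst sum.reindex) (auto intro!: inj_on_diff_nat sum.cong simp: disjoint_iff not_less)
    also have "\<dots> \<le> (\<Sum>i. (cmod (c (i + N)))\<^sup>2)"
      using F(1) by (intro sum_le_suminf summable_ignore_initial_segment[OF c]) simp_all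
    also have "\<dots> < e\<^sup>2" using N[OF order_refl] by simp
    finally show ?thesis using e by (simp add: power_less_imp_less_base)
  qed
  then show ?thesis by (rule that)
qed

text \<open>The tail estimate covers arbitrary finite index sets, which upgrades convergence of the
  partial sums to the unconditional convergence in \<open>has_sum\<close>.\<close>

lemma orthonormal_series_has_sum:
  fixes f :: "nat \<Rightarrow> 'b::chilbert_space"
  assumes f: "orthonormal UNIV f" and c: "summable (\<lambda>n. (cmod (c n))\<^sup>2)"
  obtains y where "((\<lambda>n. c n *\<^sub>C f n) has_sum y) UNIV"
proof -
  let ?s = "\<lambda>F. \<Sum>n\<in>F. c n *\<^sub>C f n"
  have "Cauchy (\<lambda>N. ?s {..<N})"
  proof (rule metric_CauchyI)
    fix e :: real assume "e > 0"
    then obtain N where N: "\<And>F. finite F \<Longrightarrow> F \<inter> {..<N} = {} \<Longrightarrow> norm (?s F) < e / 2"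
      using orthonormal_series_tail[OF f c, of "e / 2"] by auto
    have near: "norm (?s {..<m} - ?s {..<N}) < e / 2" if "m \<ge> N" for m
    proof -
      have "?s {..<m} - ?s {..<N} = ?s ({..<m} - {..<N})"
        using that by (intro sum_diff[symmetric]) auto
      moreover have "norm (?s ({..<m} - {..<N})) < e / 2" by (rule N) auto
      ultimately show ?thesis by simp
    qed
    have "dist (?s {..<m}) (?s {..<n}) < e" if "m \<ge> N" "n \<ge> N" for m n
      using norm_triangle_ineq4[of "?s {..<m} - ?s {..<N}" "?s {..<n} - ?s {..<N}"]
        near[OF that(1)] near[OF that(2)] by (simp add: dist_norm)
    then show "\<exists>M. \<forall>m\<ge>M. \<forall>n\<ge>M. dist (?s {..<m}) (?s {..<n}) < e" by blast
  qed
  then obtain y where y: "(\<lambda>N. ?s {..<N}) \<longlonglongrightarrow> y" unfolding Cauchy_convergent_iff convergent_def by blast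
  have "(?s \<longlongrightarrow> y) (finite_subsets_at_top UNIV)"
  proof (rule tendstoI)
    fix e :: real assume e: "e > 0"
    then obtain N where N: "\<And>F. finite F \<Longrightarrow> F \<inter> {..<N} = {} \<Longrightarrow> norm (?s F) < e / 2"
      using orthonormal_series_tail[OF f c, of "e / 2"] by auto
    obtain m where m: "m \<ge> N" "norm (?s {..<m} - y) < e / 2"
      using LIMSEQ_D[OF y, of "e / 2"] e by (metis half_gt_zero nle_le)
    have "dist (?s F) y < e" if F: "finite F" "{..<m} \<subseteq> F" for F
    proof -
      have "?s F - ?s {..<m} = ?s (F - {..<m})" using F by (simp add: sum_diff)
      moreover have "norm (?s (F - {..<m})) < e / 2" using F m(1) by (intro N) auto
      ultimately have "norm (?s F - ?s {..<m}) < e / 2" by simp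
      then show ?thesis using norm_triangle_ineq[of "?s F - ?s {..<m}" "?s {..<m} - y"] m(2)
        by (simp add: dist_norm)
    qed
    then show "eventually (\<lambda>F. dist (?s F) y < e) (finite_subsets_at_top UNIV)"
      unfolding eventually_finite_subsets_at_top by (intro exI[of _ "{..<m}"]) auto
  qed
  then show ?thesis by (intro that) (simp add: has_sum_def)
qed

text \<open>Serves with \<open>N\<close> = 0 for the norm of a sum and with large \<open>N\<close>
  for the truncation error.\<close>

lemma orthonormal_series_norm_le:
  fixes f :: "nat \<Rightarrow> 'b::chilbert_space"
  assumes f: "orthonormal UNIV f" and y: "((\<lambda>n. c n *\<^sub>C f n) has_sum y) UNIV"
    and b: "0 \<le> b" "\<And>m. (\<Sum>n\<in>{N..<m}. (cmod (c n))\<^sup>2) \<le> b\<^sup>2"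
  shows "norm (y - (\<Sum>n<N. c n *\<^sub>C f n)) \<le> b"
proof (rule LIMSEQ_le_const2)
  have "(\<lambda>n. c n *\<^sub>C f n) sums y" by (rule has_sum_imp_sums[OF y])
  then show "(\<lambda>m. norm ((\<Sum>n<m. c n *\<^sub>C f n) - (\<Sum>n<N. c n *\<^sub>C f n))) \<longlonglongrightarrow>
      norm (y - (\<Sum>n<N. c n *\<^sub>C f n))"
    unfolding sums_def by (intro tendsto_intros)
  have "norm ((\<Sum>n<m. c n *\<^sub>C f n) - (\<Sum>n<N. c n *\<^sub>C f n)) \<le> b" if "m \<ge> N" for m
  proof -
    have "(\<Sum>n<m. c n *\<^sub>C f n) - (\<Sum>n<N. c n *\<^sub>C f n) = (\<Sum>n\<in>{..<m} - {..<N}. c n *\<^sub>C f n)"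
      using that by (intro sum_diff[symmetric]) auto
    also have "{..<m} - {..<N} = {N..<m}" by auto
    finally have "(norm ((\<Sum>n<m. c n *\<^sub>C f n) - (\<Sum>n<N. c n *\<^sub>C f n)))\<^sup>2 = (\<Sum>n\<in>{N..<m}. (cmod (c n))\<^sup>2)"
      using orthonormal_norm_sum[OF f, of "{N..<m}" c] by simp
    also have "\<dots> \<le> b\<^sup>2" by (rule b)
    finally show ?thesis using b(1) by (simp add: power_mono_iff)
  qed
  then show "\<exists>N'. \<forall>m\<ge>N'. norm ((\<Sum>n<m. c n *\<^sub>C f n) - (\<Sum>n<N. c n *\<^sub>C f n)) \<le> b" by blast
qed

lemma orthonormal_series_cinner:
  fixes f :: "nat \<Rightarrow> 'b::chilbert_space"
  assumes f: "orthonormal UNIV f" and y: "((\<lambda>n. c n *\<^sub>C f n) has_sum y) UNIV"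
  shows "cinner y (f k) = c k"
proof -
  have "((\<lambda>n. cinner (f k) (c n *\<^sub>C f n)) has_sum cinner (f k) y) UNIV"
    using has_sum_bounded_linear[OF bounded_linear_cinner y] .
  moreover have "((\<lambda>n. cinner (f k) (c n *\<^sub>C f n)) has_sum cnj (c k)) {k}"
    using f by (intro has_sum_finiteI) (simp_all add: cinner_scaleC_right orthonormal_def)
  then have "((\<lambda>n. cinner (f k) (c n *\<^sub>C f n)) has_sum cnj (c k)) UNIV"
    by (rule has_sum_cong_neutral[THEN iffD1, rotated -1])
      (use f in \<open>auto simp: cinner_scaleC_right orthonormal_def\<close>)
  ultimately have "cinner (f k) y = cnj (c k)" by (rule has_sum_unique)
  then show ?thesis using cinner_commute[of y "f k"] by simp
qed

lemma orthonormal_series_orthogonal: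
  fixes f :: "nat \<Rightarrow> 'b::chilbert_space"
  assumes y: "((\<lambda>n. c n *\<^sub>C f n) has_sum y) UNIV" and d: "\<And>n. cinner d (f n) = 0"
  shows "cinner d y = 0"
proof -
  have "((\<lambda>n. cinner d (c n *\<^sub>C f n)) has_sum cinner d y) UNIV"
    using has_sum_bounded_linear[OF bounded_linear_cinner y] .
  then have "((\<lambda>n. 0) has_sum cinner d y) (UNIV :: nat set)" by (simp add: cinner_scaleC_right d)
  then show ?thesis using has_sum_unique[OF _ has_sum_0[of UNIV "\<lambda>_::nat. 0 :: complex"]] by auto
qed

section \<open>The sequence space as a Hilbert structure\<close>

lift_definition ell2_unit :: "nat \<Rightarrow> ell2" is "\<lambda>k n. if n = k then 1 else 0"
proof -
  fix k
  show "summable (\<lambda>n. (cmod (if n = k then 1 else 0))\<^sup>2)"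
    by (rule summable_finite[of "{k}"]) auto
qed

lemma cinner_ell2_unit: "cinner x (ell2_unit k) = ell2_nth x k"
proof -
  have "(\<lambda>n. ell2_nth x n * cnj (ell2_nth (ell2_unit k) n)) sums
      (\<Sum>n\<in>{k}. ell2_nth x n * cnj (ell2_nth (ell2_unit k) n))"
    by (rule sums_finite) (auto simp: ell2_unit.rep_eq)
  then show ?thesis unfolding cinner_ell2_def by (simp add: sums_iff ell2_unit.rep_eq)
qed

lemma orthonormal_ell2_unit: "orthonormal I ell2_unit"
  unfolding orthonormal_def by (simp add: cinner_ell2_unit ell2_unit.rep_eq)

lemma norm_ell2_unit: "norm (ell2_unit k) = 1"
proof -
  have "(norm (ell2_unit k))\<^sup>2 = 1"
    by (simp add: cinner_ell2_unit ell2_unit.rep_eq flip: Re_cinner_self)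
  then show ?thesis using norm_ge_zero[of "ell2_unit k"] by (simp add: power2_eq_1_iff)
qed

text \<open>The Hilbert space to be exhibited must be a record on a subset of
  \<open>nat \<Rightarrow> complex\<close>. Transport along \<open>ell2_nth\<close> lets all
  computations take place in the type \<open>ell2\<close>.\<close>

definition ell2_hilbert :: "(nat \<Rightarrow> complex) hilbert" where
  "ell2_hilbert = \<lparr>hcarrier = range ell2_nth, hzero = (\<lambda>_. 0), hadd = (\<lambda>x y n. x n + y n),
    hscale = (\<lambda>c x n. c * x n), hinner = (\<lambda>x y. cinner (Abs_ell2 x) (Abs_ell2 y))\<rparr>"

lemma ell2_hilbert_simps [simp]:
  "hcarrier ell2_hilbert = range ell2_nth"
  "hzero ell2_hilbert = ell2_nth 0"
  "hadd ell2_hilbert (ell2_nth x) (ell2_nth y) = ell2_nth (x + y)"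
  "hscale ell2_hilbert c (ell2_nth x) = ell2_nth (c *\<^sub>C x)"
  "hinner ell2_hilbert (ell2_nth x) (ell2_nth y) = cinner x y"
  by (simp_all add: ell2_hilbert_def zero_ell2.rep_eq plus_ell2.rep_eq scaleC_ell2.rep_eq ell2_nth_inverse)

lemma hnorm_ell2_hilbert [simp]: "hnorm ell2_hilbert (ell2_nth x) = norm x"
  by (simp add: hnorm_def Re_cinner_self)

lemma hdist_ell2_hilbert [simp]: "hdist ell2_hilbert (ell2_nth x) (ell2_nth y) = norm (x - y)"
  by (simp add: hdist_def scaleC_minus_left)

lemma hilbert_space_ell2_hilbert: "hilbert_space ell2_hilbert"
proof
  fix X :: "nat \<Rightarrow> nat \<Rightarrow> complex"
  assume X: "range X \<subseteq> hcarrier ell2_hilbert"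
    and cau: "\<forall>e>0. \<exists>M. \<forall>m\<ge>M. \<forall>n\<ge>M. hdist ell2_hilbert (X m) (X n) < e"
  have "\<exists>x. X n = ell2_nth x" for n using X by auto
  then obtain x where x: "\<And>n. X n = ell2_nth (x n)" by metis
  have "Cauchy x" using cau by (simp add: x Cauchy_def dist_ell2_def)
  then obtain L where "x \<longlonglongrightarrow> L" unfolding Cauchy_convergent_iff convergent_def by blast
  then have "(\<lambda>n. norm (x n - L)) \<longlonglongrightarrow> 0" by (intro tendsto_norm_zero LIM_zero)
  then have "(\<lambda>n. hdist ell2_hilbert (X n) (ell2_nth L)) \<longlonglongrightarrow> 0" by (simp add: x)
  then show "\<exists>L\<in>hcarrier ell2_hilbert. (\<lambda>n. hdist ell2_hilbert (X n) L) \<longlonglongrightarrow> 0" by auto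
qed (auto simp: cinner_add_left cinner_scaleC_left cinner_self scaleC_add_right scaleC_add_left
  scaleC_scaleC scaleC_minus_left add_ac simp del: ell2_hilbert_simps(2) simp add: ell2_hilbert_simps(2)
  intro: cinner_commute)

section \<open>Compact self-adjoint operators\<close>

locale self_adjoint_operator =
  fixes G :: "'b::chilbert_space \<Rightarrow> 'b"
  assumes G_add: "G (x + y) = G x + G y" and G_scaleC: "G (c *\<^sub>C x) = c *\<^sub>C G x"
    and G_self_adjoint: "cinner (G x) y = cinner x (G y)"
    and G_pos: "0 \<le> Re (cinner (G x) x)"
    and G_compact: "compact (closure (G ` cball 0 1))"
begin

lemma G_scaleR: "G (r *\<^sub>R x) = r *\<^sub>R G x"
  using G_scaleC[of "complex_of_real r" x] by (simp add: scaleC_of_real)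

lemma G_bounded_linear: "bounded_linear G"
proof -
  have "bounded (G ` cball 0 1)" using compact_imp_bounded[OF G_compact] closure_subset bounded_subset by blast
  then obtain B where "\<forall>y\<in>G ` cball 0 1. norm y \<le> B" unfolding bounded_iff by blast
  then have B: "norm (G x) \<le> B" if "norm x \<le> 1" for x using that by simp
  show ?thesis
  proof (rule bounded_linear_intro[where K = B])
    fix x
    show "norm (G x) \<le> norm x * B"
    proof (cases "x = 0")
      case True
      then show ?thesis using G_scaleR[of 0 0] by simp
    next
      case False
      have "norm (G (inverse (norm x) *\<^sub>R x)) \<le> B" using False by (intro B) simp
      then show ?thesis using False by (simp add: G_scaleR field_simps)
    qed
  qed (simp_all add: G_add G_scaleR)
qed

lemma G_semi_inner: "semi_inner (\<lambda>x y. Re (cinner (G x) y))"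
proof
  fix x y
  show "Re (cinner (G x) y) = Re (cinner (G y) x)"
    using cinner_commute[of "G y" x] by (simp add: G_self_adjoint)
qed (simp_all add: G_add G_scaleR cinner_add_left cinner_scaleR_left G_pos)

text \<open>Cauchy-Schwarz for the form <G x, y> at y = G x, then cancellation of one factor (norm
  (G x))^2.\<close>

lemma G_norm_square_le:
  assumes q: "Re (cinner (G (G x)) (G x)) \<le> l * (norm (G x))\<^sup>2" and l: "l \<ge> 0"
  shows "(norm (G x))\<^sup>2 \<le> l * Re (cinner (G x) x)"
proof -
  interpret semi_inner "\<lambda>x y. Re (cinner (G x) y)" by (rule G_semi_inner)
  have "(norm (G x))\<^sup>2 * (norm (G x))\<^sup>2 = (Re (cinner (G x) (G x)))\<^sup>2"
    by (simp add: Re_cinner_self power2_eq_square)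
  also have "\<dots> \<le> (snorm x * snorm (G x))\<^sup>2"
    using Cauchy_Schwarz[of x "G x"] by (subst abs_le_square_iff[symmetric]) simp
  also have "\<dots> \<le> Re (cinner (G x) x) * (l * (norm (G x))\<^sup>2)"
    using q G_pos by (simp add: power_mult_distrib snorm_square mult_left_mono)
  finally have le: "(norm (G x))\<^sup>2 * (norm (G x))\<^sup>2 \<le> (l * Re (cinner (G x) x)) * (norm (G x))\<^sup>2"
    by (simp add: mult_ac)
  show ?thesis
  proof (cases "G x = 0")
    case False
    then have "(norm (G x))\<^sup>2 > 0" by simp
    with le show ?thesis by (rule mult_right_le_imp_le)
  qed (use l in simp)
qed

text \<open>The Rayleigh quotient is maximized over the unit sphere of \<open>X\<close>, which
  \<open>G\<close> leaves invariant because the members of \<open>F\<close> are eigenvectors. Along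
  a maximizing sequence G x - l x tends to 0, and compactness extracts a limit.\<close>

lemma maximal_eigenvector:
  fixes F :: "'b set"
  defines "X \<equiv> {x. \<forall>f\<in>F. cinner x f = 0}"
  assumes F: "\<And>f. f \<in> F \<Longrightarrow> \<exists>l. G f = l *\<^sub>R f" and z: "z \<in> X" "z \<noteq> 0"
  obtains u l where "u \<in> X" "norm u = 1" "G u = l *\<^sub>R u" "0 \<le> l"
    "\<And>x. x \<in> X \<Longrightarrow> Re (cinner (G x) x) \<le> l * (norm x)\<^sup>2"
proof -
  interpret bounded_linear G by (rule G_bounded_linear)
  have GX: "G x \<in> X" if "x \<in> X" for x
    unfolding X_def
  proof (intro CollectI ballI)
    fix f assume f: "f \<in> F"
    then obtain l where "G f = l *\<^sub>R f" using F by blast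
    then show "cinner (G x) f = 0" using that f by (simp add: X_def G_self_adjoint cinner_scaleR_right)
  qed
  have Xs: "r *\<^sub>R x \<in> X" if "x \<in> X" for r x
    using that by (simp add: X_def cinner_scaleR_left)
  define Q where "Q = {x \<in> X. norm x = 1}"
  define l where "l = (SUP x\<in>Q. Re (cinner (G x) x))"
  have ne: "Q \<noteq> {}" using Xs[OF z(1), of "inverse (norm z)"] z(2) by (auto simp: Q_def intro!: exI[of _ "inverse (norm z) *\<^sub>R z"])
  have bdd: "bdd_above ((\<lambda>x. Re (cinner (G x) x)) ` Q)"
  proof (rule bdd_aboveI2)
    fix x assume "x \<in> Q"
    then have "norm x = 1" by (simp add: Q_def)
    then show "Re (cinner (G x) x) \<le> onorm G"
      using Re_cinner_le[of "G x" x] onorm[OF G_bounded_linear, of x] by simp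
  qed
  have le: "Re (cinner (G x) x) \<le> l * (norm x)\<^sup>2" if x: "x \<in> X" for x
  proof (cases "x = 0")
    case True
    then show ?thesis by simp
  next
    case False
    have "inverse (norm x) *\<^sub>R x \<in> Q" using Xs[OF x] False by (simp add: Q_def)
    then have "Re (cinner (G (inverse (norm x) *\<^sub>R x)) (inverse (norm x) *\<^sub>R x)) \<le> l"
      unfolding l_def by (intro cSUP_upper bdd)
    then show ?thesis using False
      by (simp add: G_scaleR cinner_scaleR_left cinner_scaleR_right field_simps power2_eq_square)
  qed
  have l0: "l \<ge> 0"
  proof -
    obtain x where "x \<in> Q" using ne by blast
    then show ?thesis using le[of x] G_pos[of x] by (simp add: Q_def)
  qed
  have Gle: "(norm (G x))\<^sup>2 \<le> l * Re (cinner (G x) x)" if "x \<in> X" for x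
    by (rule G_norm_square_le[OF le[OF GX[OF that]] l0])
  show ?thesis
  proof (cases "l = 0")
    \<comment> \<open>Here \<open>G\<close> vanishes on \<open>X\<close> and any unit vector serves;
      the compactness argument divides by l.\<close>
    case True
    obtain u where u: "u \<in> Q" using ne by blast
    then have "(norm (G u))\<^sup>2 \<le> 0" using Gle[of u] True by (simp add: Q_def)
    then have "G u = 0 *\<^sub>R u" by simp
    then show ?thesis using u le True by (intro that[of u 0]) (auto simp: Q_def)
  next
    case False
    with l0 have lpos: "l > 0" by simp
    have "\<exists>x\<in>Q. l - inverse (real (Suc n)) < Re (cinner (G x) x)" for n
      using less_cSUP_iff[OF ne bdd, of "l - inverse (real (Suc n))"] by (simp add: l_def)
    then obtain x where x: "\<And>n. x n \<in> Q" "\<And>n. l - inverse (real (Suc n)) < Re (cinner (G (x n)) (x n))"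
      by metis
    have xX: "x n \<in> X" "norm (x n) = 1" for n using x(1)[of n] by (auto simp: Q_def)
    \<comment> \<open>The square expands to (norm (G x))^2 - 2 l <G x, x> + l^2, which
      \<open>Gle\<close> reduces to l (l - <G x, x>).\<close>
    have near: "(norm (G (x n) - l *\<^sub>R x n))\<^sup>2 \<le> l * inverse (real (Suc n))" for n
    proof -
      have c: "Re (cinner (x n) (G (x n))) = Re (cinner (G (x n)) (x n))" by (simp add: G_self_adjoint)
      have "(norm (G (x n) - l *\<^sub>R x n))\<^sup>2 = (norm (G (x n)))\<^sup>2 - 2 * l * Re (cinner (G (x n)) (x n)) + l * l * (norm (x n))\<^sup>2"
        unfolding Re_cinner_self[symmetric]
        by (simp add: cinner_diff_left cinner_diff_right cinner_scaleR_left cinner_scaleR_right c algebra_simps)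
      also have "\<dots> \<le> l * (l - Re (cinner (G (x n)) (x n)))"
        using Gle[OF xX(1)[of n]] xX(2)[of n] by (simp add: algebra_simps)
      also have "\<dots> \<le> l * inverse (real (Suc n))"
        using x(2)[of n] l0 by (intro mult_left_mono) auto
      finally show ?thesis .
    qed
    have "(\<lambda>n. (norm (G (x n) - l *\<^sub>R x n))\<^sup>2) \<longlonglongrightarrow> 0"
    proof (rule tendsto_sandwich[OF _ _ tendsto_const])
      show "(\<lambda>n. l * inverse (real (Suc n))) \<longlonglongrightarrow> 0"
        using tendsto_mult[OF tendsto_const[of l] LIMSEQ_inverse_real_of_nat] by simp
    qed (use near in simp_all)
    then have "(\<lambda>n. sqrt ((norm (G (x n) - l *\<^sub>R x n))\<^sup>2)) \<longlonglongrightarrow> sqrt 0" by (rule tendsto_real_sqrt)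
    then have diff: "(\<lambda>n. G (x n) - l *\<^sub>R x n) \<longlonglongrightarrow> 0" by (simp add: tendsto_norm_zero_iff)
    have "G (x n) \<in> closure (G ` cball 0 1)" for n
      using xX(2)[of n] closure_subset[of "G ` cball 0 1"] by auto
    then obtain y r where r: "strict_mono (r :: nat \<Rightarrow> nat)" and y: "((\<lambda>n. G (x n)) \<circ> r) \<longlonglongrightarrow> y"
      using G_compact unfolding compact_def by meson
    have "(\<lambda>n. (1 / l) *\<^sub>R (G (x (r n)) - (G (x (r n)) - l *\<^sub>R x (r n)))) \<longlonglongrightarrow> (1 / l) *\<^sub>R (y - 0)"
      using y LIMSEQ_subseq_LIMSEQ[OF diff r] by (intro tendsto_intros) (simp_all add: o_def)
    then have xu: "(\<lambda>n. x (r n)) \<longlonglongrightarrow> (1 / l) *\<^sub>R y" using lpos by simp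
    define u where "u = (1 / l) *\<^sub>R y"
    have "(\<lambda>n. norm (x (r n))) \<longlonglongrightarrow> norm u" unfolding u_def by (intro tendsto_norm xu)
    then have nu: "norm u = 1" using xX(2) by (simp add: LIMSEQ_const_iff)
    have "(\<lambda>n. G (x (r n))) \<longlonglongrightarrow> G u" unfolding u_def by (intro tendsto xu)
    then have "G u = y" using y LIMSEQ_unique by (auto simp: o_def)
    then have Gu: "G u = l *\<^sub>R u" using lpos by (simp add: u_def)
    have "u \<in> X" unfolding X_def
    proof (intro CollectI ballI)
      fix f assume f: "f \<in> F"
      have "(\<lambda>n. cinner f (x (r n))) \<longlonglongrightarrow> cinner f u"
        unfolding u_def by (rule bounded_linear.tendsto[OF bounded_linear_cinner xu])
      moreover have "cinner f (x (r n)) = 0" for n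
        using xX(1)[of "r n"] f cinner_commute[of "x (r n)" f] by (simp add: X_def)
      ultimately have "cinner f u = 0" by (simp add: LIMSEQ_const_iff)
      then show "cinner u f = 0" using cinner_commute[of f u] by simp
    qed
    then show ?thesis using nu Gu l0 le by (intro that[of u l])
  qed
qed

end

text \<open>Otherwise each unit vector equals its projection, so its n squared coefficients sum to
  1. Summing over n + 1 unit vectors and exchanging the sums, Bessel's inequality gives n + 1 <=
  n.\<close>

lemma ell2_orthogonal_vector:
  fixes f :: "nat \<Rightarrow> ell2"
  assumes f: "orthonormal {..<n} f"
  obtains x where "x \<noteq> 0" "\<And>i. i < n \<Longrightarrow> cinner x (f i) = 0"
proof (rule ccontr)
  assume "\<not> thesis"
  with that have no: "x = 0" if "\<And>i. i < n \<Longrightarrow> cinner x (f i) = 0" for x using that by blast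
  have one: "(\<Sum>i<n. (cmod (cinner (ell2_unit k) (f i)))\<^sup>2) = 1" for k
  proof -
    define x where "x = ell2_unit k - (\<Sum>i<n. cinner (ell2_unit k) (f i) *\<^sub>C f i)"
    have "x = 0"
    proof (rule no)
      fix i assume "i < n"
      then show "cinner x (f i) = 0"
        unfolding x_def cinner_diff_left using orthonormal_cinner_sum[OF f, of "{..<n}" i] by simp
    qed
    then show ?thesis
      using orthonormal_norm_diff_projection[OF f, of "{..<n}" "ell2_unit k"]
      by (simp add: x_def norm_ell2_unit)
  qed
  have "real (Suc n) = (\<Sum>k<Suc n. \<Sum>i<n. (cmod (cinner (ell2_unit k) (f i)))\<^sup>2)" by (simp add: one)
  also have "\<dots> = (\<Sum>i<n. \<Sum>k<Suc n. (cmod (cinner (f i) (ell2_unit k)))\<^sup>2)"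
    by (subst sum.swap) (simp add: cinner_commute[of "ell2_unit _"])
  also have "\<dots> \<le> (\<Sum>i<n. 1)"
  proof (rule sum_mono)
    fix i assume "i \<in> {..<n}"
    then have "(norm (f i))\<^sup>2 = 1" using f by (simp add: orthonormal_def flip: Re_cinner_self)
    then show "(\<Sum>k<Suc n. (cmod (cinner (f i) (ell2_unit k)))\<^sup>2) \<le> 1"
      using Bessel[OF orthonormal_ell2_unit[of UNIV], of "{..<Suc n}" "f i"] by simp
  qed
  finally show False by simp
qed

lemma self_adjoint_operator_eigenbasis:
  fixes G :: "ell2 \<Rightarrow> ell2"
  assumes "self_adjoint_operator G"
  obtains f :: "nat \<Rightarrow> ell2" and l where "orthonormal UNIV f" "\<And>n. G (f n) = l n *\<^sub>R f n" "\<And>n. 0 \<le> l n"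
    "\<And>n x. (\<And>i. i < n \<Longrightarrow> cinner x (f i) = 0) \<Longrightarrow> Re (cinner (G x) x) \<le> l n * (norm x)\<^sup>2"
proof -
  interpret self_adjoint_operator G by fact
  define P where "P f n u \<longleftrightarrow> norm u = 1 \<and> (\<forall>i<n. cinner u (f i) = 0) \<and> (\<exists>l\<ge>0. G u = l *\<^sub>R u \<and>
    (\<forall>x. (\<forall>i<n. cinner x (f i) = 0) \<longrightarrow> Re (cinner (G x) x) \<le> l * (norm x)\<^sup>2))"
    for f :: "nat \<Rightarrow> ell2" and n u
  have orth: "orthonormal {..<n} f" if "\<And>i. i < n \<Longrightarrow> P f i (f i)" for f :: "nat \<Rightarrow> ell2" and n
    unfolding orthonormal_def
  proof (intro ballI)
    fix i j assume ij: "i \<in> {..<n}" "j \<in> {..<n}"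
    have zero: "cinner (f j) (f i) = 0" if "i < j" "j < n" for i j
      using \<open>\<And>i. i < n \<Longrightarrow> P f i (f i)\<close>[OF that(2)] that(1) by (simp add: P_def)
    have "norm (f i) = 1" using that[of i] ij by (simp add: P_def)
    then show "cinner (f i) (f j) = (if i = j then 1 else 0)"
      using zero[of i j] zero[of j i] ij cinner_commute[of "f i" "f j"]
      by (cases i j rule: linorder_cases) (auto simp: cinner_self)
  qed
  have "\<exists>f. \<forall>n. P f n (f n)"
  proof (rule dependent_wf_choice[OF wf_less_than])
    fix f g :: "nat \<Rightarrow> ell2" and n u
    assume "\<And>z. (z, n) \<in> less_than \<Longrightarrow> f z = g z"
    then have "(\<forall>i<n. cinner x (f i) = 0) \<longleftrightarrow> (\<forall>i<n. cinner x (g i) = 0)" for x by auto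
    then show "P f n u = P g n u" unfolding P_def by simp
  next
    fix n and f :: "nat \<Rightarrow> ell2"
    assume "\<And>y. (y, n) \<in> less_than \<Longrightarrow> P f y (f y)"
    then have Pf: "\<And>i. i < n \<Longrightarrow> P f i (f i)" by simp
    obtain z where z: "z \<noteq> 0" "\<And>i. i < n \<Longrightarrow> cinner z (f i) = 0"
      using ell2_orthogonal_vector[OF orth[OF Pf]] by blast
    have X: "{x. \<forall>h\<in>f ` {..<n}. cinner x h = 0} = {x. \<forall>i<n. cinner x (f i) = 0}" by auto
    have eig: "\<exists>l. G h = l *\<^sub>R h" if "h \<in> f ` {..<n}" for h
      using that Pf unfolding P_def by blast
    have zX: "z \<in> {x. \<forall>h\<in>f ` {..<n}. cinner x h = 0}" using z(2) by auto
    obtain u l where "u \<in> {x. \<forall>h\<in>f ` {..<n}. cinner x h = 0}" "norm u = 1" "G u = l *\<^sub>R u" "0 \<le> l"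
      "\<And>x. x \<in> {x. \<forall>h\<in>f ` {..<n}. cinner x h = 0} \<Longrightarrow> Re (cinner (G x) x) \<le> l * (norm x)\<^sup>2"
      using maximal_eigenvector[OF eig zX z(1)] by blast
    then show "\<exists>u. P f n u" unfolding X P_def by auto
  qed
  then obtain f where f: "\<And>n. P f n (f n)" by blast
  then have "\<forall>n. \<exists>l. l \<ge> 0 \<and> G (f n) = l *\<^sub>R f n \<and>
    (\<forall>x. (\<forall>i<n. cinner x (f i) = 0) \<longrightarrow> Re (cinner (G x) x) \<le> l * (norm x)\<^sup>2)" unfolding P_def by blast
  then obtain l where l: "\<And>n. l n \<ge> 0 \<and> G (f n) = l n *\<^sub>R f n \<and>
    (\<forall>x. (\<forall>i<n. cinner x (f i) = 0) \<longrightarrow> Re (cinner (G x) x) \<le> l n * (norm x)\<^sup>2)" by metis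
  have "orthonormal UNIV f"
    unfolding orthonormal_def
  proof (intro ballI)
    fix i j
    show "cinner (f i) (f j) = (if i = j then 1 else 0)"
      using orth[of "Suc (max i j)" f] f unfolding orthonormal_def by auto
  qed
  then show ?thesis using l by (intro that[of f l]) auto
qed

text \<open>Hilbert-Schmidt operators are compact: by self-adjointness the i-th coordinate of G x is
  <x, G e_i>, at most norm (G e_i) on the unit ball, so cutting off coordinates is uniformly
  accurate there.\<close>

lemma square_summable_images_compact:
  fixes G :: "ell2 \<Rightarrow> ell2"
  assumes sa: "\<And>x y. cinner (G x) y = cinner x (G y)"
    and sum: "\<And>n. (\<Sum>i<n. (norm (G (ell2_unit i)))\<^sup>2) \<le> B"
  shows "compact (closure (G ` cball 0 1))"
proof (rule compact_closure_of_compact_approx)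
  fix e :: real assume e: "e > 0"
  have summ: "summable (\<lambda>i. (norm (G (ell2_unit i)))\<^sup>2)"
    by (rule summableI_nonneg_bounded[OF _ sum]) simp
  obtain N where N: "\<And>n. n \<ge> N \<Longrightarrow> norm (\<Sum>i. (norm (G (ell2_unit (i + n))))\<^sup>2) < e\<^sup>2"
    using suminf_exist_split[OF _ summ, of "e\<^sup>2"] e by auto
  define r where "r = (\<Sum>i<N. norm (G (ell2_unit i)))"
  define Q where "Q = {y. \<exists>c. (\<forall>i<N. cmod (c i) \<le> r) \<and> y = (\<Sum>i<N. c i *\<^sub>C ell2_unit i)}"
  have coord: "cmod (ell2_nth (G x) i) \<le> norm (G (ell2_unit i))" if "norm x \<le> 1" for x i
  proof -
    have "cmod (ell2_nth (G x) i) \<le> norm x * norm (G (ell2_unit i))"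
      using cmod_cinner_le[of x "G (ell2_unit i)"] unfolding cinner_ell2_unit[symmetric] sa .
    also have "\<dots> \<le> 1 * norm (G (ell2_unit i))" using that by (intro mult_right_mono) auto
    finally show ?thesis by simp
  qed
  have "\<exists>y\<in>Q. norm (G x - y) \<le> e" if x: "norm x \<le> 1" for x
  proof -
    define y where "y = (\<Sum>i<N. ell2_nth (G x) i *\<^sub>C ell2_unit i)"
    have "cmod (ell2_nth (G x) i) \<le> r" if "i < N" for i
      using coord[OF x, of i] member_le_sum[of i "{..<N}" "\<lambda>i. norm (G (ell2_unit i))"] that by (simp add: r_def)
    then have "y \<in> Q" unfolding Q_def y_def by blast
    moreover have "norm (G x - y) \<le> e"
    proof (rule ell2_norm_le)
      fix m
      have nth: "ell2_nth (G x - y) i = (if i < N then 0 else ell2_nth (G x) i)" for i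
        unfolding cinner_ell2_unit[symmetric] cinner_diff_left y_def
        using orthonormal_cinner_sum[OF orthonormal_ell2_unit[of UNIV], of "{..<N}" i] by simp
      have "(L2_set (\<lambda>i. cmod (ell2_nth (G x - y) i)) {..<m})\<^sup>2 = (\<Sum>i<m. (cmod (ell2_nth (G x - y) i))\<^sup>2)"
        by (simp add: L2_set_def sum_nonneg)
      also have "\<dots> \<le> (\<Sum>i<m. if i < N then 0 else (norm (G (ell2_unit i)))\<^sup>2)"
        unfolding nth by (intro sum_mono) (simp add: power_mono coord[OF x])
      also have "\<dots> = (\<Sum>i\<in>{N..<m}. (norm (G (ell2_unit i)))\<^sup>2)"
        by (rule sum.mono_neutral_cong_right) auto
      also have "\<dots> = (\<Sum>i<m - N. (norm (G (ell2_unit (i + N))))\<^sup>2)"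
        by (rule sum.reindex_bij_witness[of _ "\<lambda>i. i + N" "\<lambda>i. i - N"]) auto
      also have "\<dots> \<le> (\<Sum>i. (norm (G (ell2_unit (i + N))))\<^sup>2)"
        by (intro sum_le_suminf summable_ignore_initial_segment[OF summ]) simp_all
      also have "\<dots> \<le> e\<^sup>2" using N[OF order_refl] by simp
      finally show "L2_set (\<lambda>i. cmod (ell2_nth (G x - y) i)) {..<m} \<le> e"
        by (rule power2_le_imp_le) (use e in simp)
    qed
    ultimately show ?thesis by blast
  qed
  moreover have "compact Q" unfolding Q_def by (rule compact_bounded_combinations)
  ultimately show "\<exists>Q. compact Q \<and> (\<forall>x\<in>G ` cball 0 1. \<exists>y\<in>Q. norm (x - y) \<le> e)"
    by (intro exI[of _ Q]) simp
qed

section \<open>Factorization\<close>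

lemma sum_ell2_nth_le:
  assumes "finite F"
  shows "(\<Sum>n\<in>F. (cmod (ell2_nth x n))\<^sup>2) \<le> (norm x)\<^sup>2"
  using Bessel[OF orthonormal_ell2_unit[of UNIV] assms, of x] by (simp add: cinner_ell2_unit)

text \<open>
  Only the domination of \<open>T\<close> by \<open>G\<close> is used: in an eigenbasis of \<open>G\<close> with eigenvalues \<open>l\<^sub>n\<close>, the
  coordinates of \<open>T x\<close> divided by \<open>\<surd>(B l\<^sub>n)\<close> form a vector of norm at most \<open>\<parallel>x\<parallel>\<close>.
\<close>

lemma schatten4_factorization:
  fixes T :: "'a::cbanach \<Rightarrow> ell2" and G :: "ell2 \<Rightarrow> ell2"
  assumes T: "bounded_clinear T" and B: "0 \<le> B"
    and G_add: "\<And>x y. G (x + y) = G x + G y" and G_scaleC: "\<And>c x. G (c *\<^sub>C x) = c *\<^sub>C G x"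
    and G_sa: "\<And>x y. cinner (G x) y = cinner x (G y)" and G_pos: "\<And>x. 0 \<le> Re (cinner (G x) x)"
    and dom: "\<And>x h. (cmod (cinner (T x) h))\<^sup>2 \<le> B * (norm x)\<^sup>2 * Re (cinner (G h) h)"
    and hs: "\<And>I h. orthonormal I h \<Longrightarrow> finite (I :: nat set) \<Longrightarrow> (\<Sum>i\<in>I. (norm (G (h i)))\<^sup>2) \<le> B\<^sup>2"
  obtains J K where "bounded_clinear_into ell2_hilbert J" "bounded_clinear_from ell2_hilbert K"
    "T = K \<circ> J" "onorm_into ell2_hilbert J \<le> 1" "schatten_class 4 ell2_hilbert K"
    "schatten_norm 4 ell2_hilbert K \<le> B"
proof -
  have "self_adjoint_operator G"
  proof
    show "compact (closure (G ` cball 0 1))"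
      by (rule square_summable_images_compact[OF G_sa hs[OF orthonormal_ell2_unit]]) simp
  qed (fact G_add G_scaleC G_sa G_pos)+
  then obtain f :: "nat \<Rightarrow> ell2" and l where f: "orthonormal UNIV f" and Gf: "\<And>n. G (f n) = l n *\<^sub>R f n"
    and l0: "\<And>n. 0 \<le> l n"
    and l_max: "\<And>n x. (\<And>i. i < n \<Longrightarrow> cinner x (f i) = 0) \<Longrightarrow> Re (cinner (G x) x) \<le> l n * (norm x)\<^sup>2"
    using self_adjoint_operator_eigenbasis by blast
  have ff: "cinner (f i) (f j) = (if i = j then 1 else 0)" for i j using f by (simp add: orthonormal_def)
  have nf: "norm (f n) = 1" for n
  proof -
    have "(norm (f n))\<^sup>2 = 1" using ff by (simp flip: Re_cinner_self)
    then show ?thesis using norm_ge_zero[of "f n"] by (simp add: power2_eq_1_iff)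
  qed
  have l_sum: "(\<Sum>n\<in>F. (l n)\<^sup>2) \<le> B\<^sup>2" if "finite F" for F
    using hs[OF orthonormal_subset[OF f subset_UNIV] that] by (simp add: Gf nf)
  have "summable (\<lambda>n. (l n)\<^sup>2)" by (rule summableI_nonneg_bounded[OF _ l_sum]) auto
  then have "(\<lambda>n. (l n)\<^sup>2) \<longlonglongrightarrow> 0" by (rule summable_LIMSEQ_zero)
  then have "(\<lambda>n. sqrt ((l n)\<^sup>2)) \<longlonglongrightarrow> sqrt 0" by (rule tendsto_real_sqrt)
  then have l_lim: "l \<longlonglongrightarrow> 0" using l0 by (simp add: abs_of_nonneg)
  have l_le: "l n \<le> B" for n by (rule power2_le_imp_le[OF _ B]) (use l_sum[of "{n}"] in simp)
  \<comment> \<open>The singular values of \<open>K\<close>. Normalizing J by sqrt B multiplies the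
    eigenvalues of K times its adjoint by B; the fourth powers B^2 (l n)^2 then sum to at most
    B^4.\<close>
  define s where "s n = sqrt (B * l n)" for n
  have s0: "0 \<le> s n" for n using B l0 by (simp add: s_def)
  have s2: "(s n)\<^sup>2 = B * l n" for n using B l0 by (simp add: s_def)
  have s_le: "s n \<le> B" for n
  proof (rule power2_le_imp_le[OF _ B])
    show "(s n)\<^sup>2 \<le> B\<^sup>2" unfolding s2 power2_eq_square[of B] using l_le B by (intro mult_left_mono)
  qed
  have s_lim: "s \<longlonglongrightarrow> 0"
  proof -
    have "(\<lambda>n. sqrt (B * l n)) \<longlonglongrightarrow> sqrt (B * 0)" by (intro tendsto_intros l_lim)
    then show ?thesis by (simp add: s_def[abs_def])
  qed
  \<comment> \<open>The coordinates of J x. Where s n = 0 the quotient is 0 by convention;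
    \<open>a_s\<close> remains true because domination forces <T x, f n> = 0 there.\<close>
  define a where "a x n = cinner (T x) (f n) / s n" for x n
  have a_s: "s n * a x n = cinner (T x) (f n)" for x n
  proof (cases "s n = 0")
    case True
    have "B * (norm x)\<^sup>2 * Re (cinner (G (f n)) (f n)) = (norm x)\<^sup>2 * (s n)\<^sup>2"
      by (simp add: Gf cinner_scaleR_left ff s2)
    then have "(cmod (cinner (T x) (f n)))\<^sup>2 \<le> (norm x)\<^sup>2 * (s n)\<^sup>2"
      using dom[of x "f n"] by (simp only:)
    then show ?thesis using True by simp
  qed (simp add: a_def)
  have a_sum: "(\<Sum>n<m. (cmod (a x n))\<^sup>2) \<le> (norm x)\<^sup>2" for x m
  proof -
    \<comment> \<open>Domination is tested on the combination \<open>h\<close> of the f n with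
      coefficients a_n / s_n: both <T x, h> and B <G h, h> equal \<open>Q\<close>, so Q^2 <= (norm
      x)^2 Q.\<close>
    define Q where "Q = (\<Sum>n<m. (cmod (a x n))\<^sup>2)"
    define c where "c n = a x n / s n" for n
    define h where "h = (\<Sum>n<m. c n *\<^sub>C f n)"
    have "cinner (T x) h = (\<Sum>n<m. cnj (c n) * (s n * a x n))"
      unfolding h_def cinner_sum_right cinner_scaleC_right a_s ..
    also have "\<dots> = (\<Sum>n<m. complex_of_real ((cmod (a x n))\<^sup>2))"
    proof (intro sum.cong refl)
      fix n
      show "cnj (c n) * (s n * a x n) = complex_of_real ((cmod (a x n))\<^sup>2)"
        by (cases "s n = 0") (auto simp: c_def a_def complex_norm_square mult.commute simp del: of_real_power)
    qed
    finally have "cinner (T x) h = complex_of_real Q" by (simp add: Q_def del: of_real_power)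
    moreover have "B * Re (cinner (G h) h) = Q"
    proof -
      have G_sum: "G (\<Sum>n\<in>F. g n) = (\<Sum>n\<in>F. G (g n))" for F :: "nat set" and g
      proof (induction F rule: infinite_finite_induct)
        case empty show ?case using G_scaleC[of 0 0] by simp
      next
        case infinite then show ?case using G_scaleC[of 0 0] by simp
      qed (simp add: G_add)
      have "G h = (\<Sum>n<m. (l n * c n) *\<^sub>C f n)"
        unfolding h_def G_sum G_scaleC Gf
        by (intro sum.cong refl) (simp add: scaleC_of_real[symmetric] scaleC_scaleC mult.commute)
      then have "cinner (G h) h = (\<Sum>n<m. cnj (c n) * (l n * c n))"
        unfolding h_def cinner_sum_right cinner_scaleC_right
        using orthonormal_cinner_sum[OF f, of "{..<m}" _ "\<lambda>n. l n * c n"] by (auto intro!: sum.cong)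
      also have "\<dots> = (\<Sum>n<m. complex_of_real (l n * (cmod (c n))\<^sup>2))"
        by (intro sum.cong refl) (simp add: complex_norm_square mult_ac del: of_real_power)
      finally have "B * Re (cinner (G h) h) = (\<Sum>n<m. (s n)\<^sup>2 * (cmod (c n))\<^sup>2)"
        by (simp add: s2 sum_distrib_left mult.assoc del: of_real_power of_real_mult)
      also have "\<dots> = Q" unfolding Q_def
      proof (intro sum.cong refl)
        fix n
        have "a x n = s n * c n" by (cases "s n = 0") (simp_all add: c_def a_def)
        then show "(s n)\<^sup>2 * (cmod (c n))\<^sup>2 = (cmod (a x n))\<^sup>2"
          by (simp add: norm_mult power_mult_distrib)
      qed
      finally show ?thesis .
    qed
    moreover have "(cmod (cinner (T x) h))\<^sup>2 \<le> (norm x)\<^sup>2 * (B * Re (cinner (G h) h))"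
      using dom[of x h] by (simp only: mult.commute[of B "(norm x)\<^sup>2"] mult.assoc)
    ultimately have "Q * Q \<le> (norm x)\<^sup>2 * Q" by (simp add: power2_eq_square)
    moreover have "Q \<ge> 0" by (simp add: Q_def sum_nonneg)
    ultimately have "Q \<le> (norm x)\<^sup>2"
      by (cases "Q = 0") (auto dest: mult_right_le_imp_le)
    then show ?thesis by (simp add: Q_def)
  qed
  define J where "J x = Abs_ell2 (a x)" for x
  have J: "ell2_nth (J x) = a x" for x
    unfolding J_def using summableI_nonneg_bounded[OF _ a_sum[of x]] by (simp add: Abs_ell2_inverse)
  have J_norm: "norm (J x) \<le> norm x" for x
    by (rule ell2_norm_le) (simp add: J L2_set_def real_le_lsqrt sum_nonneg a_sum)
  have J_add: "J (x + y) = J x + J y" for x y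
    by (rule ell2_eqI) (simp add: J plus_ell2.rep_eq a_def bounded_clinear_add[OF T] cinner_add_left add_divide_distrib)
  have J_scaleC: "J (c *\<^sub>C x) = c *\<^sub>C J x" for c x
    by (rule ell2_eqI) (simp add: J scaleC_ell2.rep_eq a_def bounded_clinear_scaleC[OF T] cinner_scaleC_left)
  define K where "K z = (\<Sum>\<^sub>\<infinity>n. (s n * z n) *\<^sub>C f n)" for z :: "nat \<Rightarrow> complex"
  have sz_le: "(\<Sum>n\<in>F. (cmod (s n * ell2_nth w n))\<^sup>2) \<le> (b * norm w)\<^sup>2"
    if "finite F" "0 \<le> b" "\<And>n. n \<in> F \<Longrightarrow> s n \<le> b" for F b w
  proof -
    have "(\<Sum>n\<in>F. (cmod (s n * ell2_nth w n))\<^sup>2) \<le> (\<Sum>n\<in>F. b\<^sup>2 * (cmod (ell2_nth w n))\<^sup>2)"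
      using that s0 by (intro sum_mono) (auto simp: norm_mult power_mult_distrib intro!: mult_right_mono power_mono)
    also have "\<dots> \<le> b\<^sup>2 * (norm w)\<^sup>2"
      using sum_ell2_nth_le[OF that(1), of w] by (simp add: mult_left_mono flip: sum_distrib_left)
    finally show ?thesis by (simp add: power_mult_distrib)
  qed
  have K: "((\<lambda>n. (s n * ell2_nth w n) *\<^sub>C f n) has_sum K (ell2_nth w)) UNIV" for w
  proof -
    have "summable (\<lambda>n. (cmod (s n * ell2_nth w n))\<^sup>2)"
      by (rule summableI_nonneg_bounded[OF _ sz_le[OF _ B s_le, of _ w]]) auto
    from orthonormal_series_has_sum[OF f this]
    have "(\<lambda>n. (s n * ell2_nth w n) *\<^sub>C f n) summable_on UNIV" unfolding summable_on_def by blast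
    then show ?thesis unfolding K_def by (rule has_sum_infsum)
  qed
  have K_norm: "norm (K (ell2_nth w)) \<le> B * norm w" for w
    using orthonormal_series_norm_le[OF f K[of w], of "B * norm w" 0] sz_le[OF _ B s_le, of _ w] B by simp
  have K_into: "bounded_clinear_from ell2_hilbert K"
    unfolding bounded_clinear_from_def
  proof (intro conjI ballI allI exI)
    fix x y c assume "x \<in> hcarrier ell2_hilbert"
    then obtain v where v: "x = ell2_nth v" by auto
    show "norm (K x) \<le> B * hnorm ell2_hilbert x" using K_norm v by simp
    have "((\<lambda>n. c *\<^sub>C (s n * ell2_nth v n) *\<^sub>C f n) has_sum c *\<^sub>C K (ell2_nth v)) UNIV"
      by (rule has_sum_bounded_linear[OF _ K])
        (auto intro!: bounded_linear_intro[where K = "cmod c"] simp: scaleC_add_right scaleC_scaleR norm_scaleC)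
    moreover have "(s n * ell2_nth (c *\<^sub>C v) n) *\<^sub>C f n = c *\<^sub>C (s n * ell2_nth v n) *\<^sub>C f n" for n
      by (simp add: scaleC_ell2.rep_eq scaleC_scaleC mult_ac)
    ultimately show "K (hscale ell2_hilbert c x) = c *\<^sub>C K x"
      using K[of "c *\<^sub>C v"] has_sum_unique unfolding v by (simp add: has_sum_unique)
    assume "y \<in> hcarrier ell2_hilbert"
    then obtain w where w: "y = ell2_nth w" by auto
    have "(s n * ell2_nth (v + w) n) *\<^sub>C f n = (s n * ell2_nth v n) *\<^sub>C f n + (s n * ell2_nth w n) *\<^sub>C f n" for n
      by (simp add: plus_ell2.rep_eq distrib_left scaleC_add_left)
    then show "K (hadd ell2_hilbert x y) = K x + K y"
      using K[of "v + w"] has_sum_add[OF K[of v] K[of w]] unfolding v w by (simp add: has_sum_unique)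
  qed
  have T_eq: "T = K \<circ> (\<lambda>x. ell2_nth (J x))"
  proof
    fix x
    define y where "y = K (ell2_nth (J x))"
    \<comment> \<open>\<open>d\<close> is orthogonal to all f n, so <G d, d> <= l n (norm d)^2 for
      every n and hence <G d, d> = 0. Domination then makes \<open>d\<close> orthogonal to T x;
      being orthogonal to \<open>y\<close> as well, it is 0.\<close>
    define d where "d = T x - y"
    have series: "((\<lambda>n. cinner (T x) (f n) *\<^sub>C f n) has_sum y) UNIV"
      using K[of "J x"] by (simp add: J a_s y_def)
    have df: "cinner d (f n) = 0" for n
      using orthonormal_series_cinner[OF f series, of n] by (simp add: d_def cinner_diff_left)
    have "(\<lambda>n. l n * (norm d)\<^sup>2) \<longlonglongrightarrow> 0 * (norm d)\<^sup>2" by (intro tendsto_intros l_lim)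
    then have "Re (cinner (G d) d) \<le> 0"
      using LIMSEQ_le_const[of "\<lambda>n. l n * (norm d)\<^sup>2" 0] l_max[of _ d] df by auto
    then have "B * (norm x)\<^sup>2 * Re (cinner (G d) d) \<le> 0" using B by (intro mult_nonneg_nonpos) auto
    with dom[of x d] have "(cmod (cinner (T x) d))\<^sup>2 \<le> 0" by (rule order_trans)
    then have "cinner (T x) d = 0" by simp
    then have "cinner d (T x) = 0" using cinner_commute[of "T x" d] by simp
    moreover have "cinner d y = 0" by (rule orthonormal_series_orthogonal[OF series df])
    ultimately have "cinner d d = 0" by (subst (2) d_def) (simp add: cinner_diff_right)
    then have "d = 0" by (simp add: cinner_self)
    then show "T x = (K \<circ> (\<lambda>x. ell2_nth (J x))) x" by (simp add: d_def y_def)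
  qed
  have s4: "cmod (complex_of_real (s n)) powr 4 = B\<^sup>2 * (l n)\<^sup>2" for n
  proof -
    have "cmod (complex_of_real (s n)) powr 4 = s n ^ 4"
      using s0[of n] powr_numeral[of "s n" "Num.Bit0 (Num.Bit0 Num.One)"] by simp
    also have "\<dots> = ((s n)\<^sup>2)\<^sup>2" by (simp flip: power_mult)
    finally show ?thesis by (simp add: s2 power_mult_distrib)
  qed
  have s4_sum: "(\<Sum>n\<in>F. cmod (complex_of_real (s n)) powr 4) \<le> B ^ 4" if "finite F" for F
  proof -
    have "(\<Sum>n\<in>F. cmod (complex_of_real (s n)) powr 4) = B\<^sup>2 * (\<Sum>n\<in>F. (l n)\<^sup>2)"
      by (simp only: s4 sum_distrib_left)
    also have "\<dots> \<le> B\<^sup>2 * B\<^sup>2" using l_sum[OF that] by (intro mult_left_mono) auto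
    finally show ?thesis by (simp flip: power_add)
  qed
  have s4_summable: "(\<lambda>n. cmod (complex_of_real (s n)) powr 4) summable_on UNIV"
    using s4_sum by (intro nonneg_bdd_above_summable_on bdd_aboveI2[of _ _ "B ^ 4"]) auto
  have rep: "schatten_rep 4 ell2_hilbert K UNIV (\<lambda>n. complex_of_real (s n)) (\<lambda>n. ell2_nth (ell2_unit n)) f"
    unfolding schatten_rep_def
    using s4_summable K orthonormal_ell2_unit[of UNIV]
    by (auto simp: ff orthonormal_def scaleC_scaleC simp flip: cinner_ell2_unit)
  have "compact (closure (K ` {x \<in> hcarrier ell2_hilbert. hnorm ell2_hilbert x \<le> 1}))"
  proof (rule compact_closure_of_compact_approx)
    fix e :: real assume e: "e > 0"
    \<comment> \<open>Beyond \<open>M\<close> the factors s n are below e, so the tail is uniformly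
      small on the unit ball; the first \<open>M\<close> terms range over a compact set.\<close>
    then obtain M where M: "\<And>n. n \<ge> M \<Longrightarrow> s n < e"
      using order_tendstoD(2)[OF s_lim e] by (auto simp: eventually_sequentially)
    define Q where "Q = {y. \<exists>c. (\<forall>i<M. cmod (c i) \<le> B) \<and> y = (\<Sum>i<M. c i *\<^sub>C f i)}"
    have "\<exists>y\<in>Q. norm (K (ell2_nth w) - y) \<le> e" if w: "norm w \<le> 1" for w
    proof
      have "cmod (s i * ell2_nth w i) \<le> B" for i
      proof -
        have "s i * cmod (ell2_nth w i) \<le> B * 1"
          using s_le[of i] s0[of i] B ell2_nth_le_norm[of w i] w by (intro mult_mono) auto
        then show ?thesis using s0[of i] by (simp add: norm_mult)
      qed
      then show "(\<Sum>i<M. (s i * ell2_nth w i) *\<^sub>C f i) \<in> Q"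
        unfolding Q_def by (intro CollectI exI[of _ "\<lambda>i. s i * ell2_nth w i"] conjI allI impI refl)
      show "norm (K (ell2_nth w) - (\<Sum>i<M. (s i * ell2_nth w i) *\<^sub>C f i)) \<le> e"
      proof (rule orthonormal_series_norm_le[OF f K less_imp_le[OF e]])
        fix m
        have "(\<Sum>n = M..<m. (cmod (s n * ell2_nth w n))\<^sup>2) \<le> (e * norm w)\<^sup>2"
          using M e by (intro sz_le) (auto intro: less_imp_le)
        also have "\<dots> \<le> (e * 1)\<^sup>2" using w e by (intro power_mono mult_left_mono) auto
        finally show "(\<Sum>n = M..<m. (cmod (s n * ell2_nth w n))\<^sup>2) \<le> e\<^sup>2" by simp
      qed
    qed
    moreover have "compact Q" unfolding Q_def by (rule compact_bounded_combinations)
    ultimately show "\<exists>Q. compact Q \<and> (\<forall>x\<in>K ` {x \<in> hcarrier ell2_hilbert. hnorm ell2_hilbert x \<le> 1}. \<exists>y\<in>Q. norm (x - y) \<le> e)"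
      by (intro exI[of _ Q]) auto
  qed
  then have in_class: "schatten_class 4 ell2_hilbert K"
    using rep K_into unfolding schatten_class_def compact_operator_from_def by blast
  have "(\<Sum>\<^sub>\<infinity>n. cmod (complex_of_real (s n)) powr 4) \<le> B ^ 4"
    by (rule infsum_le_finite_sums[OF s4_summable]) (rule s4_sum)
  then have "(\<Sum>\<^sub>\<infinity>n. cmod (complex_of_real (s n)) powr 4) powr (1 / 4) \<le> (B ^ 4) powr (1 / 4)"
    by (intro powr_mono2 infsum_nonneg) auto
  also have "(B ^ 4) powr (1 / 4) = B"
    using B by (cases "B = 0") (simp_all add: powr_powr flip: powr_numeral)
  finally have norm_le: "schatten_norm 4 ell2_hilbert K \<le> B"
    using hilbert_space.schatten_norm_eq[OF hilbert_space_ell2_hilbert rep] by simp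
  have J_into: "bounded_clinear_into ell2_hilbert (\<lambda>x. ell2_nth (J x))"
    unfolding bounded_clinear_into_def using J_norm by (auto simp: J_add J_scaleC intro!: exI[of _ 1])
  have "onorm_into ell2_hilbert (\<lambda>x. ell2_nth (J x)) \<le> 1"
    unfolding onorm_into_def using J_norm by (intro cSUP_least) (auto simp: divide_le_eq_1)
  with J_into K_into T_eq in_class norm_le show ?thesis by (intro that)
qed

theorem theorem1:
  fixes T :: "'a::cstar_algebra \<Rightarrow> ell2" and \<epsilon> :: real
  assumes "absolutely_summing T" and "\<epsilon> > 0"
  shows "\<exists>(H :: (nat \<Rightarrow> complex) hilbert) J K.
    hilbert_space H \<and> bounded_clinear_into H J \<and> bounded_clinear_from H K \<and>
    T = K \<circ> J \<and>
    onorm_into H J \<le> 1 \<and>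
    schatten_class 4 H K \<and> schatten_norm 4 H K \<le> 2 * (1 + \<epsilon>) * pi1_norm T"
proof -
  define C where "C = pi1_norm T"
  obtain M where M: "dominating_mean C M" "\<And>x. norm (T x) \<le> M (\<lambda>\<phi>. cmod (\<phi> x))"
    using Pietsch_domination[OF assms(1)] unfolding C_def by blast
  have Tl: "bounded_clinear T" using assms(1) by (simp add: absolutely_summing_def)
  interpret cstar_dominating_mean C M by (simp add: cstar_dominating_mean_def M(1))
  obtain \<beta> :: "'a \<Rightarrow> 'a \<Rightarrow> real" where \<beta>: "semi_inner \<beta>"
    "\<And>c x y. \<beta> (c *\<^sub>C x) y = \<beta> x (cnj c *\<^sub>C y)" "\<And>x. \<beta> x x \<le> 2 * C * (norm x)\<^sup>2"
    "\<And>x \<delta>. \<delta> > 0 \<Longrightarrow> \<exists>v. norm v \<le> 2 \<and> M (absval x) \<le> \<beta> v x + \<delta>"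
    using dominating_form by blast
  interpret semi_inner \<beta> by (rule \<beta>(1))
  interpret dominated_operator C M \<beta> T
    by unfold_locales (use Tl M(2) \<beta> in auto)
  \<comment> \<open>2 C enters in two roles: in \<open>gram_dominates\<close> as the bound for the
    square of the norm of J, and in \<open>gram_orthonormal_sum\<close> as the Hilbert-Schmidt bound
    of \<open>gram\<close>.\<close>
  have B: "0 \<le> 2 * C" using C_nonneg by simp
  obtain J K where JK: "bounded_clinear_into ell2_hilbert J" "bounded_clinear_from ell2_hilbert K"
    "T = K \<circ> J" "onorm_into ell2_hilbert J \<le> 1" "schatten_class 4 ell2_hilbert K"
    "schatten_norm 4 ell2_hilbert K \<le> 2 * C"
    using schatten4_factorization[OF Tl B gram_add gram_scaleC gram_self_adjoint gram_nonneg
        gram_dominates gram_orthonormal_sum] by blast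
  have "2 * C \<le> 2 * (1 + \<epsilon>) * pi1_norm T"
    using assms(2) C_nonneg by (simp add: C_def algebra_simps)
  with JK(6) have "schatten_norm 4 ell2_hilbert K \<le> 2 * (1 + \<epsilon>) * pi1_norm T" by simp
  with JK hilbert_space_ell2_hilbert show ?thesis by blast
qed

end
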